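(* Let $(\mathbf{X},d,\mu)$ be a compact metric measure space and let $\mathcal{L}$ be an operator in the real space $L_2(\mathbf{X},\mu)$ such that Assumptions A, B, C, D stated in the context are satisfied. Then: (1) For every $\omega>0$ the space $\mathbf{E}_\omega(\mathcal{L})$ of $\omega$-Paley-Wiener functions is finite-dimensional. (2) The operator $\mathcal{L}$ has a discrete spectrum $0\le\lambda_0\le\lambda_1\le\lambda_2\le\dots$ which goes to infinity without any accumulation points, and there exists a complete family $\{\psi_j\}$ of orthonormal eigenfunctions of $\mathcal{L}$ which form a basis in $L_2(\mathbf{X},\mu)$. (3) There exists a constant $0<\gamma=\gamma(\mathbf{X})<1$ such that for all sufficiently large $\omega$ the following inequality holds: $$\mathcal{N}_\omega\le \inf\,\mathrm{card}\left(\mathcal{X}_{\gamma\omega^{-1/2}}\right),$$ where $\mathcal{N}_\omega$ is the number of eigenvalues of $\mathcal{L}$ (counted with multiplicities) which are not greater than $\omega>0$, and the infimum is taken over all metric $(\gamma\omega^{-1/2},N)$-lattices $\mathcal{X}_{\gamma\omega^{-1/2}}$ in $\mathbf{X}$.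
   Context: Setting. $(\mathbf{X},d)$ is a compact metric space with a positive Radon measure $\mu$; $B(x,r)$ is the open ball with center $x$ and radius $r$, and $|B(x,r)|=\mu(B(x,r))$. $\|\cdot\|$ and $\langle\cdot,\cdot\rangle$ are the norm and inner product of the real space $L_2(\mathbf{X},\mu)$. Assumption A (doubling). There is $D>0$ such that $0<|B(x,2r)|\le 2^{D}|B(x,r)|$ for all $x\in\mathbf{X}$, $r>0$. Assumption B. $L_2(\mathbf{X},\mu)$ is equipped with a densely defined, non-negative symmetric operator whose closure is self-adjoint; $\mathcal{L}$ denotes this self-adjoint non-negative operator, with domain $\mathcal{D}(\mathcal{L})$. The set $\mathcal{D}^\infty(\mathcal{L})=\bigcap_{k\in\mathbb{N}}\mathcal{D}(\mathcal{L}^k)$ is a subalgebra of the space $C(\mathbf{X})$ of continuous functions. For $f,g\in\mathcal{D}^\infty(\mathcal{L})$ put $$\Gamma(f,g)=\tfrac12\left(f\mathcal{L}g+g\mathcal{L}f-\mathcal{L}(fg)\right)\in L_1(\mathbf{X},\mu).$$ Assumption C. There is $c>0$ such that $\int_{\mathbf{X}}\Gamma(f,f)\,d\mu\le c\,\|\mathcal{L}^{1/2}f\|^2$ for all $f\in\mathcal{D}^\infty(\mathcal{L})$, where $\mathcal{L}^{1/2}$ is the non-negative square root of $\mathcal{L}$. Assumption D (local Poincaré inequality). There is a constant $C>0$ such that for any $f\in\mathcal{D}^\infty(\mathcal{L})$ and any ball $B(x,\rho)$, $x\in\mathbf{X}$, of sufficiently small radius $\rho$ (that is, $0<\rho<\rho_0$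 for some fixed $\rho_0>0$), $$\int_{B(x,\rho)}|f-f_B|^2\,d\mu\le C\rho^2\int_{B(x,\rho)}\Gamma(f,f)\,d\mu,\qquad f_B=\frac{1}{|B(x,\rho)|}\int_{B(x,\rho)}f\,d\mu .$$ Paley-Wiener spaces. For $\omega>0$, $\mathbf{E}_\omega(\mathcal{L})$ is the set of all $f\in L_2(\mathbf{X},\mu)$ whose image under the unitary operator that diagonalizes $\mathcal{L}$ (representing $\mathcal{L}$ as multiplication by $\lambda$ on a direct integral of Hilbert spaces over $\lambda\in[0,\infty)$) is supported in $[0,\omega]$; equivalently, $\mathbf{E}_\omega(\mathcal{L})$ is the range of the spectral projection $\mathbf{1}_{[0,\omega]}(\mathcal{L})$. Lattices. For $\rho>0$, a set of points $\mathcal{X}_\rho=\{x_j\}\subset\mathbf{X}$ is a metric $(\rho,N)$-lattice if the balls $B(x_j,\rho/2)$ are pairwise disjoint, and the balls $B(x_j,\rho)$ cover $\mathbf{X}$ with multiplicity at most $N$ (every point lies in at most $N$ of these balls). Here $N=N(\mathbf{X})$ is a fixed constant, depending only on $\mathbf{X}$, for which a $(\rho,N)$-lattice exists for every sufficiently small $\rho>0$.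
   Formalization: If L_2(X,μ) is finite-dimensional (e.g. X is one point), the eigenvalue sequence is finite; that it goes to infinity is claimed only for infinite-dimensional L_2. The constant γ may depend on the operator L and on N as well as on X (rescaling L shows dependence on L is unavoidable). *)

theory Defs
  imports "HOL-Analysis.Analysis"
begin

section \<open>The real space \<open>L\<^sub>2(X, \<mu>)\<close>\<close>

text \<open>
  The metric space \<open>X\<close> is the type \<open>'a\<close>. Elements of \<open>L\<^sub>2\<close> are represented by square integrable
  functions, and equality in \<open>L\<^sub>2\<close> is equality almost everywhere.
\<close>

definition radon_measure :: "'a::metric_space measure \<Rightarrow> bool" where
  "radon_measure M \<longleftrightarrow> sets M = sets borel
     \<and> (\<forall>K. compact K \<longrightarrow> emeasure M K < \<infinity>)
     \<and> (\<forall>A\<in>sets M. emeasure M A = (SUP K\<in>{K. compact K \<and> K \<subseteq> A}. emeasure M K))"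

definition l2 :: "'a measure \<Rightarrow> ('a \<Rightarrow> real) set" where
  "l2 M = {f \<in> borel_measurable M. integrable M (\<lambda>x. (f x)\<^sup>2)}"

definition l2_inner :: "'a measure \<Rightarrow> ('a \<Rightarrow> real) \<Rightarrow> ('a \<Rightarrow> real) \<Rightarrow> real" where
  "l2_inner M f g = (LINT x|M. f x * g x)"

definition l2_norm :: "'a measure \<Rightarrow> ('a \<Rightarrow> real) \<Rightarrow> real" where
  "l2_norm M f = sqrt (l2_inner M f f)"

definition ae_independent :: "'a measure \<Rightarrow> ('a \<Rightarrow> real) set \<Rightarrow> bool" where
  "ae_independent M B \<longleftrightarrow>
     (\<forall>c. (AE x in M. (\<Sum>b\<in>B. c b * b x) = 0) \<longrightarrow> (\<forall>b\<in>B. c b = 0))"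

text \<open>Dimension (possibly infinite) of the image of the linear space \<open>V\<close> in \<open>L\<^sub>2\<close>.\<close>

definition l2_dim :: "'a measure \<Rightarrow> ('a \<Rightarrow> real) set \<Rightarrow> enat" where
  "l2_dim M V = (SUP B\<in>{B. finite B \<and> B \<subseteq> V \<and> ae_independent M B}. enat (card B))"

section \<open>Unbounded operators\<close>

text \<open>
  An unbounded operator is given by its graph, consisting of all pairs of representatives, so that
  \<^const>\<open>Domain\<close>, \<^const>\<open>Range\<close>, composition \<open>S O T\<close> and powers \<open>T ^^ k\<close> are those of the
  relation, with the usual maximal domains.
\<close>

definition l2_operator :: "'a measure \<Rightarrow> ('a \<Rightarrow> real) rel \<Rightarrow> bool" where
  "l2_operator M T \<longleftrightarrow> T \<subseteq> l2 M \<times> l2 M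
     \<and> (\<lambda>_. 0, \<lambda>_. 0) \<in> T
     \<and> (\<forall>(f, h)\<in>T. \<forall>(g, k)\<in>T. \<forall>a b.
          (\<lambda>x. a * f x + b * g x, \<lambda>x. a * h x + b * k x) \<in> T)
     \<and> (\<forall>(f, h)\<in>T. \<forall>f'\<in>l2 M. \<forall>h'\<in>l2 M.
          (AE x in M. f x = f' x) \<longrightarrow> (AE x in M. h x = h' x) \<longrightarrow> (f', h') \<in> T)
     \<and> (\<forall>f h h'. (f, h) \<in> T \<longrightarrow> (f, h') \<in> T \<longrightarrow> (AE x in M. h x = h' x))"

text \<open>Some representative of \<open>T f\<close>, for \<open>f\<close> in the domain of \<open>T\<close>.\<close>

definition op_app :: "('a \<Rightarrow> real) rel \<Rightarrow> ('a \<Rightarrow> real) \<Rightarrow> 'a \<Rightarrow> real" where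
  "op_app T f = (SOME h. (f, h) \<in> T)"

definition densely_defined :: "'a measure \<Rightarrow> ('a \<Rightarrow> real) rel \<Rightarrow> bool" where
  "densely_defined M T \<longleftrightarrow>
     (\<forall>f\<in>l2 M. \<forall>e>0. \<exists>g\<in>Domain T. l2_norm M (\<lambda>x. f x - g x) < e)"

definition symmetric_op :: "'a measure \<Rightarrow> ('a \<Rightarrow> real) rel \<Rightarrow> bool" where
  "symmetric_op M T \<longleftrightarrow> (\<forall>(f, h)\<in>T. \<forall>(g, k)\<in>T. l2_inner M h g = l2_inner M f k)"

definition nonneg_op :: "'a measure \<Rightarrow> ('a \<Rightarrow> real) rel \<Rightarrow> bool" where
  "nonneg_op M T \<longleftrightarrow> (\<forall>(f, h)\<in>T. 0 \<le> l2_inner M h f)"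

definition op_closure :: "'a measure \<Rightarrow> ('a \<Rightarrow> real) rel \<Rightarrow> ('a \<Rightarrow> real) rel" where
  "op_closure M T = {(f, h). f \<in> l2 M \<and> h \<in> l2 M \<and>
     (\<exists>u v. (\<forall>n::nat. (u n, v n) \<in> T)
        \<and> (\<lambda>n. l2_norm M (\<lambda>x. u n x - f x)) \<longlonglongrightarrow> 0
        \<and> (\<lambda>n. l2_norm M (\<lambda>x. v n x - h x)) \<longlonglongrightarrow> 0)}"

definition op_adjoint :: "'a measure \<Rightarrow> ('a \<Rightarrow> real) rel \<Rightarrow> ('a \<Rightarrow> real) rel" where
  "op_adjoint M T = {(g, k). g \<in> l2 M \<and> k \<in> l2 M \<and>
     (\<forall>(f, h)\<in>T. l2_inner M h g = l2_inner M f k)}"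

definition selfadjoint_op :: "'a measure \<Rightarrow> ('a \<Rightarrow> real) rel \<Rightarrow> bool" where
  "selfadjoint_op M T \<longleftrightarrow> l2_operator M T \<and> densely_defined M T \<and> op_adjoint M T = T"

definition is_nonneg_sqrt :: "'a measure \<Rightarrow> ('a \<Rightarrow> real) rel \<Rightarrow> ('a \<Rightarrow> real) rel \<Rightarrow> bool" where
  "is_nonneg_sqrt M L R \<longleftrightarrow> selfadjoint_op M R \<and> nonneg_op M R \<and> R O R = L"

definition eigenspace :: "('a \<Rightarrow> real) rel \<Rightarrow> real \<Rightarrow> ('a \<Rightarrow> real) set" where
  "eigenspace L z = {f. (f, \<lambda>x. z * f x) \<in> L}"

definition eigenvalues :: "'a measure \<Rightarrow> ('a \<Rightarrow> real) rel \<Rightarrow> real set" where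
  "eigenvalues M L = {z. \<exists>f\<in>eigenspace L z. \<not> (AE x in M. f x = 0)}"

text \<open>
  The number of eigenvalues not greater than \<open>w\<close>, counted with multiplicities: the sum of the
  dimensions of the eigenspaces, taken in \<^typ>\<open>enat\<close> as a supremum of finite sums so that it is
  \<open>\<infinity>\<close> (rather than a junk value) if there are infinitely many such eigenvalues.
\<close>

definition eigenvalue_count :: "'a measure \<Rightarrow> ('a \<Rightarrow> real) rel \<Rightarrow> real \<Rightarrow> enat" where
  "eigenvalue_count M L w =
     (SUP F\<in>{F. finite F \<and> F \<subseteq> eigenvalues M L \<inter> {..w}}. \<Sum>z\<in>F. l2_dim M (eigenspace L z))"

text \<open>
  \<open>z\<close> is in the resolvent set iff \<open>L - z\<close> is a bijection from the domain of \<open>L\<close> onto \<open>L\<^sub>2\<close>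
  with bounded inverse; the lower bound also gives injectivity. For self-adjoint \<open>L\<close> the spectrum
  of the complexification is real, hence coincides with this set.
\<close>

definition op_spectrum :: "'a measure \<Rightarrow> ('a \<Rightarrow> real) rel \<Rightarrow> real set" where
  "op_spectrum M L = - {z.
     (\<forall>h\<in>l2 M. \<exists>(f, g)\<in>L. AE x in M. g x - z * f x = h x)
     \<and> (\<exists>K. \<forall>(f, g)\<in>L. l2_norm M f \<le> K * l2_norm M (\<lambda>x. g x - z * f x))}"

section \<open>Spectral projections and Paley-Wiener spaces\<close>

definition l2_projection :: "'a measure \<Rightarrow> ('a \<Rightarrow> real) rel \<Rightarrow> bool" where
  "l2_projection M P \<longleftrightarrow>
     l2_operator M P \<and> Domain P = l2 M \<and> symmetric_op M P \<and> P O P = P"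

definition projection_valued_measure :: "'a measure \<Rightarrow> (real set \<Rightarrow> ('a \<Rightarrow> real) rel) \<Rightarrow> bool" where
  "projection_valued_measure M E \<longleftrightarrow>
     (\<forall>B\<in>sets borel. l2_projection M (E B))
     \<and> E UNIV = {(f, g). f \<in> l2 M \<and> g \<in> l2 M \<and> (AE x in M. f x = g x)}
     \<and> (\<forall>A\<in>sets borel. \<forall>B\<in>sets borel. E (A \<inter> B) = E A O E B)
     \<and> (\<forall>f\<in>l2 M. \<forall>B::nat \<Rightarrow> real set. range B \<subseteq> sets borel \<longrightarrow> disjoint_family B \<longrightarrow>
          (\<lambda>n. l2_inner M (op_app (E (B n)) f) f) sums l2_inner M (op_app (E (\<Union>n. B n)) f) f)"

definition spectral_distr ::
    "'a measure \<Rightarrow> (real set \<Rightarrow> ('a \<Rightarrow> real) rel) \<Rightarrow> ('a \<Rightarrow> real) \<Rightarrow> real measure" where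
  "spectral_distr M E f =
     measure_of UNIV (sets borel) (\<lambda>B. ennreal (l2_inner M (op_app (E B) f) f))"

text \<open>\<open>L = \<integral> t dE(t)\<close>; by polarization it suffices to prescribe the domain and the quadratic form.\<close>

definition is_spectral_measure ::
    "'a measure \<Rightarrow> ('a \<Rightarrow> real) rel \<Rightarrow> (real set \<Rightarrow> ('a \<Rightarrow> real) rel) \<Rightarrow> bool" where
  "is_spectral_measure M L E \<longleftrightarrow> projection_valued_measure M E
     \<and> Domain L = {f \<in> l2 M. (\<integral>\<^sup>+t. ennreal (t\<^sup>2) \<partial>spectral_distr M E f) < \<infinity>}
     \<and> (\<forall>(f, h)\<in>L. l2_inner M h f = (LINT t|spectral_distr M E f. t))"

text \<open>
  By the spectral theorem a spectral measure of a self-adjoint \<open>L\<close> exists and is unique on Borel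
  sets, so that the choice below is immaterial: the value at \<open>B\<close> is the projection \<open>1\<^sub>B(L)\<close>.
\<close>

definition spectral_projection ::
    "'a measure \<Rightarrow> ('a \<Rightarrow> real) rel \<Rightarrow> real set \<Rightarrow> ('a \<Rightarrow> real) rel" where
  "spectral_projection M L = (SOME E. is_spectral_measure M L E)"

definition paley_wiener :: "'a measure \<Rightarrow> ('a \<Rightarrow> real) rel \<Rightarrow> real \<Rightarrow> ('a \<Rightarrow> real) set" where
  "paley_wiener M L w = Range (spectral_projection M L {0..w})"

section \<open>The standing assumptions\<close>

definition doubling :: "'a::metric_space measure \<Rightarrow> bool" where
  "doubling M \<longleftrightarrow> (\<exists>D>0. \<forall>x. \<forall>r>0.
     0 < measure M (ball x (2 * r)) \<and> measure M (ball x (2 * r)) \<le> 2 powr D * measure M (ball x r))"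

definition dom_infinity :: "('a \<Rightarrow> real) rel \<Rightarrow> ('a \<Rightarrow> real) set" where
  "dom_infinity L = (\<Inter>k\<in>{1..}. Domain (L ^^ k))"

text \<open>
  Being made of equivalence classes, \<^term>\<open>dom_infinity L\<close> consists of continuous functions in
  the sense that every class has a continuous representative. It is a linear space for every
  linear \<open>L\<close>; a unit is not required.
\<close>

definition subalgebra_of_C :: "'a::metric_space measure \<Rightarrow> ('a \<Rightarrow> real) set \<Rightarrow> bool" where
  "subalgebra_of_C M V \<longleftrightarrow>
     (\<forall>f\<in>V. \<exists>g. continuous_on UNIV g \<and> (AE x in M. f x = g x))
     \<and> (\<forall>f\<in>V. \<forall>g\<in>V. (\<lambda>x. f x * g x) \<in> V)"

text \<open>\<open>T\<close> is the initially given symmetric operator, and \<open>L\<close> its self-adjoint closure.\<close>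

definition assumption_B ::
    "'a::metric_space measure \<Rightarrow> ('a \<Rightarrow> real) rel \<Rightarrow> ('a \<Rightarrow> real) rel \<Rightarrow> bool" where
  "assumption_B M T L \<longleftrightarrow>
     l2_operator M T \<and> densely_defined M T \<and> nonneg_op M T \<and> symmetric_op M T
     \<and> L = op_closure M T \<and> selfadjoint_op M L \<and> nonneg_op M L
     \<and> subalgebra_of_C M (dom_infinity L)"

definition Gamma ::
    "('a \<Rightarrow> real) rel \<Rightarrow> ('a \<Rightarrow> real) \<Rightarrow> ('a \<Rightarrow> real) \<Rightarrow> 'a \<Rightarrow> real" where
  "Gamma L f g =
     (\<lambda>x. (f x * op_app L g x + g x * op_app L f x - op_app L (\<lambda>y. f y * g y) x) / 2)"

text \<open>\<open>R\<close> stands for the square root of \<open>L\<close>.\<close>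

definition assumption_C ::
    "'a measure \<Rightarrow> ('a \<Rightarrow> real) rel \<Rightarrow> ('a \<Rightarrow> real) rel \<Rightarrow> bool" where
  "assumption_C M L R \<longleftrightarrow> (\<exists>c>0. \<forall>f\<in>dom_infinity L.
     (LINT x|M. Gamma L f f x) \<le> c * (l2_norm M (op_app R f))\<^sup>2)"

definition ball_mean :: "'a::metric_space measure \<Rightarrow> ('a \<Rightarrow> real) \<Rightarrow> 'a \<Rightarrow> real \<Rightarrow> real" where
  "ball_mean M f x r = (LINT y:ball x r|M. f y) / measure M (ball x r)"

definition poincare :: "'a::metric_space measure \<Rightarrow> ('a \<Rightarrow> real) rel \<Rightarrow> bool" where
  "poincare M L \<longleftrightarrow> (\<exists>C>0. \<exists>r0>0. \<forall>f\<in>dom_infinity L. \<forall>x r. 0 < r \<longrightarrow> r < r0 \<longrightarrow>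
     (LINT y:ball x r|M. \<bar>f y - ball_mean M f x r\<bar>\<^sup>2)
       \<le> C * r\<^sup>2 * (LINT y:ball x r|M. Gamma L f f y))"

section \<open>Lattices and eigenbases\<close>

text \<open>
  For \<open>r > 0\<close> a lattice is \<open>r/2\<close>-separated, hence finite if \<open>X\<close> is compact, so that \<^const>\<open>card\<close>
  is its actual cardinality.
\<close>

definition metric_lattice :: "real \<Rightarrow> nat \<Rightarrow> 'a::metric_space set \<Rightarrow> bool" where
  "metric_lattice r N S \<longleftrightarrow>
     disjoint_family_on (\<lambda>p. ball p (r / 2)) S
     \<and> (\<Union>p\<in>S. ball p r) = UNIV
     \<and> (\<forall>x. finite {p\<in>S. x \<in> ball p r} \<and> card {p\<in>S. x \<in> ball p r} \<le> N)"

text \<open>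
  The index set of an eigenbasis of \<open>L\<^sub>2\<close>: all of \<^typ>\<open>nat\<close> if \<open>L\<^sub>2\<close> is infinite-dimensional,
  and \<open>{..<n}\<close> if it has dimension \<open>n\<close> (which happens when \<open>X\<close> is finite).
\<close>

definition basis_index :: "'a measure \<Rightarrow> nat set" where
  "basis_index M = {j. enat j < l2_dim M (l2 M)}"

definition orthonormal_basis :: "'a measure \<Rightarrow> (nat \<Rightarrow> 'a \<Rightarrow> real) \<Rightarrow> bool" where
  "orthonormal_basis M \<psi> \<longleftrightarrow>
     (\<forall>j\<in>basis_index M. \<psi> j \<in> l2 M)
     \<and> (\<forall>i\<in>basis_index M. \<forall>j\<in>basis_index M. l2_inner M (\<psi> i) (\<psi> j) = (if i = j then 1 else 0))
     \<and> (\<forall>f\<in>l2 M. (\<lambda>n. l2_norm M (\<lambda>x. f x -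
          (\<Sum>j\<in>basis_index M \<inter> {..<n}. l2_inner M f (\<psi> j) * \<psi> j x))) \<longlonglongrightarrow> 0)"

end

theory Submission
  imports Defs "HOL-Library.Function_Algebras"
begin

text \<open>
  Summing the local Poincare inequality over a lattice of radius \<open>\<rho>\<close> bounds \<open>\<parallel>f\<parallel>\<^sup>2\<close> by
  \<open>K N \<rho>\<^sup>2 \<langle>L f, f\<rangle>\<close> plus finitely many squares \<open>\<langle>f, g\<^sub>i\<rangle>\<^sup>2\<close>, one for each ball of the lattice.
  Overlapping balls can be summed because \<open>\<Gamma>(f, f) \<ge> 0\<close> almost everywhere: otherwise a Vitali
  type covering of a set where \<open>\<Gamma>(f, f) \<le> - e\<close> would contradict the Poincare inequality. The
  smooth vectors form a core of \<open>L\<close>, so the bound extends to the whole domain. It makes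
  \<open>(1 + L)\<^sup>-\<^sup>1\<close> compact, which gives the eigenbasis, and since a space of dimension larger than the
  number of balls contains a vector orthogonal to all \<open>g\<^sub>i\<close>, it bounds the dimension of every space
  on which \<open>\<langle>L f, f\<rangle> \<le> \<omega> \<parallel>f\<parallel>\<^sup>2\<close> as soon as \<open>K N \<rho>\<^sup>2 \<omega> < 1\<close>.
\<close>

section \<open>Semi-inner product spaces\<close>

text \<open>Assumption C turns the integral of \<Gamma>(f, f) into a multiple of <L f, f>, so K is
  the product of the constants of Assumptions D and C and depends on the space alone. Each ball
  contributes a single functional, the inner product with its normalized indicator; hence the
  dimension bound is the cardinality of the lattice itself, with no further factor. For \<rho> =
  \<gamma> \<omega> powr (-1/2) the condition K N \<rho>^2 \<omega> < 1 becomes K N \<gamma>^2 < 1,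
  which is why \<gamma> can be fixed before \<omega>.

  Two facts shape the rest. Elements of L2 are functions up to null sets and operators are
  relations, so the Hilbert space theory is developed for a semi-inner product on a total type, with
  equality replaced by a difference of norm 0. And \<open>spectral_projection\<close> is a choice,
  so a spectral measure has to be exhibited before anything can be said about Paley-Wiener spaces;
  it is read off the eigenbasis.\<close>

lemma quadratic_nonneg_imp_zero:
  fixes a b :: real
  assumes "\<And>t. 0 \<le> t\<^sup>2 * a - 2 * t * b"
  shows "b = 0"
proof (rule ccontr)
  assume "b \<noteq> 0"
  show False
  proof (cases "a > 0")
    case True
    have "0 \<le> (b / a)\<^sup>2 * a - 2 * (b / a) * b" by (rule assms)
    also have "\<dots> = - b\<^sup>2 / a" using True by (simp add: power2_eq_square field_simps)
    finally show False using True \<open>b \<noteq> 0\<close> by (simp add: divide_le_0_iff zero_le_divide_iff)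
  next
    case False
    have "0 \<le> b\<^sup>2 * a - 2 * b * b" by (rule assms)
    moreover have "b\<^sup>2 * a \<le> 0" using False by (simp add: mult_nonneg_nonpos)
    moreover have "0 < b * b" using \<open>b \<noteq> 0\<close> by (simp add: zero_less_mult_iff) linarith
    ultimately show False by linarith
  qed
qed

text \<open>Definiteness is left out on purpose: functions that agree almost everywhere stay
  different vectors, and null vectors are carried along instead of passing to a quotient.\<close>

locale semi_inner =
  fixes ip :: "'v::real_vector \<Rightarrow> 'v \<Rightarrow> real"
  assumes ip_commute: "ip x y = ip y x"
    and ip_add_left: "ip (x + y) z = ip x z + ip y z"
    and ip_scale_left: "ip (a *\<^sub>R x) y = a * ip x y"
    and ip_ge_zero: "0 \<le> ip x x"
begin

lemma ip_add_right: "ip z (x + y) = ip z x + ip z y"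
  using ip_add_left by (simp add: ip_commute)

lemma ip_scale_right: "ip y (a *\<^sub>R x) = a * ip y x"
  using ip_scale_left by (simp add: ip_commute)

lemma ip_zero_left [simp]: "ip 0 x = 0"
  using ip_scale_left[of 0 0 x] by simp

lemma ip_zero_right [simp]: "ip x 0 = 0"
  using ip_zero_left by (simp add: ip_commute)

lemma ip_minus_left: "ip (- x) y = - ip x y"
  using ip_scale_left[of "-1" x y] by simp

lemma ip_diff_left: "ip (x - y) z = ip x z - ip y z"
  using ip_add_left[of x "- y" z] by (simp add: ip_minus_left)

lemma ip_diff_right: "ip z (x - y) = ip z x - ip z y"
  using ip_diff_left by (simp add: ip_commute)

lemma ip_sum_left: "ip (sum f S) y = (\<Sum>i\<in>S. ip (f i) y)"
  by (induction S rule: infinite_finite_induct) (auto simp: ip_add_left)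

lemma ip_sum_right: "ip y (sum f S) = (\<Sum>i\<in>S. ip y (f i))"
  using ip_sum_left by (simp add: ip_commute)

lemmas ip_simps = ip_add_left ip_add_right ip_diff_left ip_diff_right ip_scale_left ip_scale_right

text \<open>The minimum of the quadratic \<open>q\<close> is found by dividing by
  \<open>ip y y\<close>. For a null vector \<open>y\<close> the quadratic degenerates to an affine
  function, which stays non-negative only if its slope vanishes.\<close>

lemma cauchy_schwarz_sq: "(ip x y)\<^sup>2 \<le> ip x x * ip y y"
proof -
  have q: "0 \<le> t\<^sup>2 * ip y y - 2 * t * ip x y + ip x x" for t
    using ip_ge_zero[of "x - t *\<^sub>R y"]
    by (simp add: ip_simps ip_commute[of y x] power2_eq_square algebra_simps)
  show ?thesis
  proof (cases "ip y y = 0")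
    case True
    have "ip x y = 0"
    proof (rule ccontr)
      assume n: "ip x y \<noteq> 0"
      define t where "t = (ip x x + 1) / ip x y"
      have "t * ip x y = ip x x + 1" using n by (simp add: t_def)
      moreover have "0 \<le> - 2 * (t * ip x y) + ip x x" using q[of t] True by (simp add: mult.assoc)
      ultimately show False using ip_ge_zero[of x] by simp
    qed
    with True show ?thesis by simp
  next
    case False
    then have p: "ip y y > 0" using ip_ge_zero[of y] by simp
    have "0 \<le> (ip x y / ip y y)\<^sup>2 * ip y y - 2 * (ip x y / ip y y) * ip x y + ip x x"
      by (rule q)
    also have "\<dots> = ip x x - (ip x y)\<^sup>2 / ip y y"
      using p by (simp add: power2_eq_square field_simps)
    finally show ?thesis using p by (simp add: field_simps)
  qed
qed

definition nrm :: "'v \<Rightarrow> real" where "nrm x = sqrt (ip x x)"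

lemma nrm_ge_zero [simp]: "0 \<le> nrm x" by (simp add: nrm_def ip_ge_zero)

lemma nrm_sq: "(nrm x)\<^sup>2 = ip x x" by (simp add: nrm_def ip_ge_zero)

lemma nrm_eq_0_iff: "nrm x = 0 \<longleftrightarrow> ip x x = 0" by (simp add: nrm_def)

lemma cauchy_schwarz: "\<bar>ip x y\<bar> \<le> nrm x * nrm y"
  using real_sqrt_le_mono[OF cauchy_schwarz_sq[of x y]] by (simp add: nrm_def real_sqrt_mult)

lemma nrm_zero [simp]: "nrm 0 = 0" by (simp add: nrm_def)

lemma nrm_scale: "nrm (a *\<^sub>R x) = \<bar>a\<bar> * nrm x"
  by (simp add: nrm_def ip_simps real_sqrt_mult flip: mult.assoc power2_eq_square)

lemma nrm_minus_commute: "nrm (x - y) = nrm (y - x)"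
  using nrm_scale[of "-1" "x - y"] by simp

lemma nrm_triangle: "nrm (x + y) \<le> nrm x + nrm y"
proof (rule power2_le_imp_le)
  have "(nrm (x + y))\<^sup>2 = ip x x + 2 * ip x y + ip y y"
    by (simp add: nrm_sq ip_simps ip_commute[of y x])
  also have "\<dots> \<le> ip x x + 2 * (nrm x * nrm y) + ip y y" using cauchy_schwarz[of x y] by simp
  also have "\<dots> = (nrm x + nrm y)\<^sup>2" by (simp add: power2_sum nrm_sq)
  finally show "(nrm (x + y))\<^sup>2 \<le> (nrm x + nrm y)\<^sup>2" .
qed simp

lemma nrm_triangle_sub: "nrm (x - z) \<le> nrm (x - y) + nrm (y - z)"
  using nrm_triangle[of "x - y" "y - z"] by simp

lemma null_left: "nrm x = 0 \<Longrightarrow> ip x y = 0"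
  using cauchy_schwarz[of x y] by simp

lemma null_right: "nrm x = 0 \<Longrightarrow> ip y x = 0"
  using null_left by (simp add: ip_commute)

lemma null_cong_left: "nrm (x - y) = 0 \<Longrightarrow> ip x z = ip y z"
  using null_left[of "x - y" z] by (simp add: ip_simps)

lemma nrm_cong: "nrm (x - y) = 0 \<Longrightarrow> nrm x = nrm y"
  using nrm_triangle_sub[of x 0 y] nrm_triangle_sub[of y 0 x] nrm_minus_commute[of x y] by simp

lemma ip_tendsto:
  assumes "(\<lambda>n. nrm (x n - a)) \<longlonglongrightarrow> 0" "(\<lambda>n. nrm (y n - b)) \<longlonglongrightarrow> 0"
  shows "(\<lambda>n. ip (x n) (y n)) \<longlonglongrightarrow> ip a b"
proof -
  have "(\<lambda>n. ip (x n) (y n) - ip a b) \<longlonglongrightarrow> 0"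
  proof (rule Lim_null_comparison[rotated])
    show "(\<lambda>n. nrm (x n - a) * nrm (y n - b) + nrm (x n - a) * nrm b + nrm a * nrm (y n - b)) \<longlonglongrightarrow> 0"
      by (rule tendsto_eq_intros assms refl | simp)+
    have "\<bar>ip (x n) (y n) - ip a b\<bar> \<le> nrm (x n - a) * nrm (y n - b) + nrm (x n - a) * nrm b + nrm a * nrm (y n - b)" for n
    proof -
      have "ip (x n) (y n) - ip a b = ip (x n - a) (y n - b) + ip (x n - a) b + ip a (y n - b)"
        by (simp add: ip_simps)
      then show ?thesis
        using cauchy_schwarz[of "x n - a" "y n - b"] cauchy_schwarz[of "x n - a" b]
          cauchy_schwarz[of a "y n - b"] by linarith
    qed
    then show "\<forall>\<^sub>F n in sequentially. norm (ip (x n) (y n) - ip a b) \<le> nrm (x n - a) * nrm (y n - b) + nrm (x n - a) * nrm b + nrm a * nrm (y n - b)"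
      by simp
  qed
  then show ?thesis by (simp add: LIM_zero_iff)
qed

lemma ip_tendsto_left:
  assumes "(\<lambda>n. nrm (x n - a)) \<longlonglongrightarrow> 0"
  shows "(\<lambda>n. ip (x n) b) \<longlonglongrightarrow> ip a b"
  using ip_tendsto[OF assms, of "\<lambda>_. b" b] by simp

lemma nrm_tendsto_add:
  assumes "(\<lambda>n. nrm (x n - a)) \<longlonglongrightarrow> 0" "(\<lambda>n. nrm (y n - b)) \<longlonglongrightarrow> 0"
  shows "(\<lambda>n. nrm ((x n + y n) - (a + b))) \<longlonglongrightarrow> 0"
proof (rule Lim_null_comparison[rotated])
  show "(\<lambda>n. nrm (x n - a) + nrm (y n - b)) \<longlonglongrightarrow> 0" using tendsto_add[OF assms] by simp
  have "nrm ((x n + y n) - (a + b)) \<le> nrm (x n - a) + nrm (y n - b)" for n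
    using nrm_triangle[of "x n - a" "y n - b"] by (simp add: algebra_simps)
  then show "\<forall>\<^sub>F n in sequentially. norm (nrm ((x n + y n) - (a + b))) \<le> nrm (x n - a) + nrm (y n - b)" by simp
qed

lemma nrm_tendsto_scale:
  assumes "(\<lambda>n. nrm (x n - a)) \<longlonglongrightarrow> 0"
  shows "(\<lambda>n. nrm (c *\<^sub>R x n - c *\<^sub>R a)) \<longlonglongrightarrow> 0"
proof -
  have "(\<lambda>n. \<bar>c\<bar> * nrm (x n - a)) \<longlonglongrightarrow> 0" by (rule tendsto_eq_intros assms refl | simp)+
  moreover have "nrm (c *\<^sub>R x n - c *\<^sub>R a) = \<bar>c\<bar> * nrm (x n - a)" for n
    using nrm_scale[of c "x n - a"] by (simp add: scaleR_diff_right)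
  ultimately show ?thesis by simp
qed

lemma nrm_tendsto_diff:
  assumes "(\<lambda>n. nrm (x n - a)) \<longlonglongrightarrow> 0" "(\<lambda>n. nrm (y n - b)) \<longlonglongrightarrow> 0"
  shows "(\<lambda>n. nrm ((x n - y n) - (a - b))) \<longlonglongrightarrow> 0"
  using nrm_tendsto_add[OF assms(1) nrm_tendsto_scale[OF assms(2), of "-1"]] by simp

lemma parallelogram: "ip (x - y) (x - y) + ip (x + y) (x + y) = 2 * ip x x + 2 * ip y y"
  by (simp add: ip_simps)

end

section \<open>Completeness, with limits unique only up to null vectors\<close>

locale semi_hilbert = semi_inner ip for ip :: "'v::real_vector \<Rightarrow> 'v \<Rightarrow> real" +
  assumes complete: "(\<And>e. 0 < e \<Longrightarrow> \<exists>N. \<forall>m\<ge>N. \<forall>n\<ge>N. nrm (x m - x n) < e)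
    \<Longrightarrow> \<exists>l. (\<lambda>n. nrm (x n - l)) \<longlonglongrightarrow> 0"
begin

lemma fast_cauchy_converges:
  assumes "\<And>m. nrm (y m - y (Suc m)) \<le> c / 2 ^ m"
  obtains l where "(\<lambda>m. nrm (y m - l)) \<longlonglongrightarrow> 0" "\<And>m. nrm (y m - l) \<le> 2 * c / 2 ^ m"
proof -
  have c: "0 \<le> c" using order_trans[OF nrm_ge_zero assms[of 0]] by simp
  \<comment> \<open>The factor \<open>1 - 1 / 2 ^ k\<close> is the exact partial geometric sum; the
    plain bound \<open>2 * c / 2 ^ m\<close> would not survive the induction.\<close>
  have step: "nrm (y m - y (m + k)) \<le> 2 * c / 2 ^ m * (1 - 1 / 2 ^ k)" for m k
  proof (induction k)
    case (Suc k)
    have "nrm (y m - y (m + Suc k)) \<le> nrm (y m - y (m + k)) + nrm (y (m + k) - y (Suc (m + k)))"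
      using nrm_triangle_sub[of "y m" "y (m + Suc k)" "y (m + k)"] by simp
    also have "\<dots> \<le> 2 * c / 2 ^ m * (1 - 1 / 2 ^ k) + c / 2 ^ (m + k)"
      using Suc assms[of "m + k"] by simp
    also have "\<dots> = 2 * c / 2 ^ m * (1 - 1 / 2 ^ Suc k)"
      by (simp add: power_add field_simps)
    finally show ?case .
  qed simp
  have bd: "nrm (y m - y n) \<le> 2 * c / 2 ^ m" if "m \<le> n" for m n
  proof -
    have "2 * c / 2 ^ m * (1 - 1 / 2 ^ (n - m)) \<le> 2 * c / 2 ^ m * 1"
      using c by (intro mult_left_mono) auto
    with step[of m "n - m"] that show ?thesis by simp
  qed
  have lim0: "(\<lambda>m. 2 * c / 2 ^ m) \<longlonglongrightarrow> 0"
    using tendsto_mult[OF tendsto_const[of "2*c"] LIMSEQ_realpow_zero[of "1/2::real"]]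
    by (simp add: power_divide)
  have "\<exists>N. \<forall>m\<ge>N. \<forall>n\<ge>N. nrm (y m - y n) < e" if e: "0 < e" for e
  proof -
    obtain N where N: "\<And>m. m \<ge> N \<Longrightarrow> 2 * c / 2 ^ m < e"
      using order_tendstoD(2)[OF lim0 e] by (auto simp: eventually_sequentially)
    have "nrm (y m - y n) < e" if "m \<ge> N" "n \<ge> N" for m n
      using bd[of m n] bd[of n m] N[of m] N[of n] that nrm_minus_commute[of "y m" "y n"]
      by (cases "m \<le> n") auto
    then show ?thesis by blast
  qed
  then obtain l where l: "(\<lambda>n. nrm (y n - l)) \<longlonglongrightarrow> 0" using complete by blast
  have "nrm (y m - l) \<le> 2 * c / 2 ^ m" for m
  proof (rule tendsto_lowerbound)
    show "(\<lambda>n. 2 * c / 2 ^ m + nrm (y n - l)) \<longlonglongrightarrow> 2 * c / 2 ^ m"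
      using tendsto_add[OF tendsto_const l] by simp
    show "\<forall>\<^sub>F n in sequentially. nrm (y m - l) \<le> 2 * c / 2 ^ m + nrm (y n - l)"
      using eventually_ge_at_top[of m]
    proof eventually_elim
      case (elim n)
      then show ?case using nrm_triangle_sub[of "y m" l "y n"] bd[of m n] by simp
    qed
  qed simp
  with l that show ?thesis by blast
qed

text \<open>A minimizing sequence for the distance to \<open>Y\<close> is Cauchy by the
  parallelogram law, since midpoints lie in \<open>Y\<close> and are no closer than
  \<open>d\<close>. At the minimizer, orthogonality is the first-order condition
  \<open>quadratic_nonneg_imp_zero\<close>.\<close>

lemma orthogonal_projection:
  assumes Y: "subspace Y"
    and closed: "\<And>y l. (\<And>n. y n \<in> Y) \<Longrightarrow> (\<lambda>n. nrm (y n - l)) \<longlonglongrightarrow> 0 \<Longrightarrow> l \<in> Y"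
  obtains y where "y \<in> Y" "\<And>z. z \<in> Y \<Longrightarrow> ip (x - y) z = 0"
proof -
  define Q where "Q y = ip (x - y) (x - y)" for y
  define d where "d = Inf (Q ` Y)"
  have bdd: "bdd_below (Q ` Y)" by (rule bdd_belowI[of _ 0]) (auto simp: Q_def ip_ge_zero)
  have ne: "Y \<noteq> {}" using subspace_0[OF Y] by blast
  have dle: "d \<le> Q y" if "y \<in> Y" for y unfolding d_def using bdd that by (intro cInf_lower) auto
  have "\<exists>y\<in>Y. Q y < d + 1 / Suc n" for n
  proof -
    have "Inf (Q ` Y) < d + 1 / Suc n" unfolding d_def by simp
    then show ?thesis using cInf_less_iff[of "Q ` Y"] ne bdd by auto
  qed
  then obtain y where y: "\<And>n. y n \<in> Y" and yd: "\<And>n. Q (y n) < d + 1 / Suc n" by metis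
  have bound: "ip (y m - y n) (y m - y n) \<le> 2 / Suc m + 2 / Suc n" for m n
  proof -
    let ?c = "(1/2) *\<^sub>R (y m + y n)"
    have "?c \<in> Y" using Y y by (simp add: subspace_add subspace_scale)
    then have "d \<le> Q ?c" by (rule dle)
    have "(x - y m) + (x - y n) = 2 *\<^sub>R (x - ?c)" by (simp add: algebra_simps scaleR_2)
    then have "4 * Q ?c = ip ((x - y m) + (x - y n)) ((x - y m) + (x - y n))"
      by (simp only: ip_scale_left ip_scale_right Q_def)
    moreover have "(x - y n) - (x - y m) = y m - y n" by simp
    ultimately have "ip (y m - y n) (y m - y n) = 2 * Q (y n) + 2 * Q (y m) - 4 * Q ?c"
      using parallelogram[of "x - y n" "x - y m"] unfolding Q_def by (simp add: add.commute)
    with \<open>d \<le> Q ?c\<close> yd[of m] yd[of n] show ?thesis by simp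
  qed
  have "\<exists>N. \<forall>m\<ge>N. \<forall>n\<ge>N. nrm (y m - y n) < e" if "0 < e" for e
  proof -
    obtain N where N: "inverse (real (Suc N)) < e\<^sup>2 / 4" using reals_Archimedean[of "e\<^sup>2/4"] \<open>0 < e\<close> by auto
    have "nrm (y m - y n) < e" if "m \<ge> N" "n \<ge> N" for m n
    proof (rule power2_less_imp_less)
      have "1 / real (Suc m) \<le> 1 / real (Suc N)" "1 / real (Suc n) \<le> 1 / real (Suc N)"
        using that by (auto simp: field_simps)
      then have "2 / real (Suc m) + 2 / real (Suc n) < e\<^sup>2" using N by (simp add: inverse_eq_divide)
      then show "(nrm (y m - y n))\<^sup>2 < e\<^sup>2" using bound[of m n] by (simp add: nrm_sq)
    qed (use \<open>0 < e\<close> in simp)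
    then show ?thesis by blast
  qed
  then obtain l where l: "(\<lambda>n. nrm (y n - l)) \<longlonglongrightarrow> 0" using complete by blast
  then have lY: "l \<in> Y" using closed y by blast
  have lx: "(\<lambda>n. nrm ((x - y n) - (x - l))) \<longlonglongrightarrow> 0"
    using nrm_tendsto_diff[OF _ l, of "\<lambda>_. x" x] by simp
  have "(\<lambda>n. Q (y n)) \<longlonglongrightarrow> Q l" unfolding Q_def by (rule ip_tendsto[OF lx lx])
  moreover have "(\<lambda>n. d + 1 / real (Suc n)) \<longlonglongrightarrow> d + 0"
    by (rule tendsto_add[OF tendsto_const LIMSEQ_Suc[OF lim_1_over_n]])
  ultimately have Ql: "Q l \<le> d" using yd by (intro LIMSEQ_le) (auto intro!: exI[of _ 0] less_imp_le)
  have "ip (x - l) z = 0" if "z \<in> Y" for z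
  proof (rule quadratic_nonneg_imp_zero)
    fix t
    have "l + t *\<^sub>R z \<in> Y" using Y lY that by (simp add: subspace_add subspace_scale)
    then have "Q l \<le> Q (l + t *\<^sub>R z)" using dle Ql by fastforce
    then show "0 \<le> t\<^sup>2 * ip z z - 2 * t * ip (x - l) z"
      unfolding Q_def by (simp add: ip_simps ip_commute algebra_simps power2_eq_square)
  qed
  with lY that show ?thesis by blast
qed

end

section \<open>Non-negative self-adjoint relations\<close>

text \<open>The equivalence \<open>adjoint\<close> says that \<open>L\<close> is its own adjoint.
  Since an adjoint is automatically linear, closed and insensitive to null vectors, these properties
  are derived below rather than assumed.\<close>

locale pos_selfadjoint = semi_hilbert ip for ip :: "'v::real_vector \<Rightarrow> 'v \<Rightarrow> real" +
  fixes L :: "'v rel"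
  assumes dense: "0 < e \<Longrightarrow> \<exists>(g, k)\<in>L. nrm (f - g) < e"
    and adjoint: "(g, k) \<in> L \<longleftrightarrow> (\<forall>(f, h)\<in>L. ip h g = ip f k)"
    and pos: "(f, h) \<in> L \<Longrightarrow> 0 \<le> ip h f"
begin

lemma L_sym: "(f, h) \<in> L \<Longrightarrow> (g, k) \<in> L \<Longrightarrow> ip h g = ip f k"
  using adjoint by blast

lemma L_I: "(\<And>f h. (f, h) \<in> L \<Longrightarrow> ip h g = ip f k) \<Longrightarrow> (g, k) \<in> L"
  using adjoint by blast

lemma L_zero: "(0, 0) \<in> L"
  by (rule L_I) simp

lemma L_add: "(f, h) \<in> L \<Longrightarrow> (g, k) \<in> L \<Longrightarrow> (f + g, h + k) \<in> L"
  by (rule L_I) (simp add: ip_simps L_sym)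

lemma L_diff: "(f, h) \<in> L \<Longrightarrow> (g, k) \<in> L \<Longrightarrow> (f - g, h - k) \<in> L"
  by (rule L_I) (simp add: ip_simps L_sym)

lemma L_scale: "(f, h) \<in> L \<Longrightarrow> (a *\<^sub>R f, a *\<^sub>R h) \<in> L"
  by (rule L_I) (simp add: ip_simps L_sym)

lemma L_sum: "(\<And>i. i \<in> S \<Longrightarrow> (f i, h i) \<in> L) \<Longrightarrow> (sum f S, sum h S) \<in> L"
  by (rule L_I) (auto simp: ip_sum_right L_sym intro!: sum.cong)

lemma L_null_cong:
  assumes "(f, h) \<in> L" "nrm (f - f') = 0" "nrm (h - h') = 0"
  shows "(f', h') \<in> L"
proof (rule L_I)
  fix u w assume uw: "(u, w) \<in> L"
  have "ip w f' = ip w f" "ip u h' = ip u h"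
    using null_cong_left[OF assms(2), of w] null_cong_left[OF assms(3), of u] by (simp_all add: ip_commute)
  then show "ip w f' = ip u h'" using L_sym[OF uw assms(1)] by simp
qed

lemma L_closed:
  assumes "\<And>n. (u n, v n) \<in> L" "(\<lambda>n. nrm (u n - f)) \<longlonglongrightarrow> 0" "(\<lambda>n. nrm (v n - h)) \<longlonglongrightarrow> 0"
  shows "(f, h) \<in> L"
proof (rule L_I)
  fix x w assume xw: "(x, w) \<in> L"
  have "(\<lambda>n. ip (u n) w) \<longlonglongrightarrow> ip f w" by (rule ip_tendsto_left[OF assms(2)])
  moreover have "(\<lambda>n. ip (v n) x) \<longlonglongrightarrow> ip h x" by (rule ip_tendsto_left[OF assms(3)])
  moreover have "ip (u n) w = ip (v n) x" for n
    using L_sym[OF xw assms(1)[of n]] by (simp add: ip_commute)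
  ultimately show "ip w f = ip x h" using LIMSEQ_unique by (simp add: ip_commute)
qed

lemma null_if_orthogonal_Domain:
  assumes "\<And>g k. (g, k) \<in> L \<Longrightarrow> ip f g = 0"
  shows "nrm f = 0"
proof (rule ccontr)
  assume "nrm f \<noteq> 0"
  then have "0 < nrm f" using nrm_ge_zero[of f] by linarith
  with dense[of "nrm f" f] obtain g k where gk: "(g, k) \<in> L" "nrm (f - g) < nrm f" by blast
  have "(nrm f)\<^sup>2 = ip f (f - g)" using assms[OF gk(1)] by (simp add: nrm_sq ip_simps)
  also have "\<dots> \<le> nrm f * nrm (f - g)" using cauchy_schwarz[of f "f - g"] by linarith
  also have "\<dots> < nrm f * nrm f" using gk(2) \<open>0 < nrm f\<close> by simp
  finally show False by (simp add: power2_eq_square)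
qed

lemma L_unique:
  assumes "(f, h) \<in> L" "(f, h') \<in> L"
  shows "nrm (h - h') = 0"
proof (rule null_if_orthogonal_Domain)
  fix g k assume gk: "(g, k) \<in> L"
  show "ip (h - h') g = 0" using L_sym[OF assms(1) gk] L_sym[OF assms(2) gk] by (simp add: ip_simps)
qed

text \<open>Positivity gives \<open>(nrm u)^2 <= ip (u + v) u\<close>. Thus \<open>1 + L\<close> is
  bounded below by 1, which makes its range closed and its inverse a contraction.\<close>

lemma nrm_le_shift:
  assumes "(u, v) \<in> L"
  shows "nrm u \<le> nrm (u + v)"
proof -
  have "(nrm u)\<^sup>2 \<le> ip (u + v) u" using pos[OF assms] by (simp add: nrm_sq ip_simps)
  also have "\<dots> \<le> nrm (u + v) * nrm u" using cauchy_schwarz[of "u + v" u] by linarith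
  finally show ?thesis
    by (metis mult_right_le_imp_le nrm_ge_zero order_le_less power2_eq_square)
qed

text \<open>The range \<open>Y\<close> of \<open>1 + L\<close> is closed by
  \<open>nrm_le_shift\<close>. A vector \<open>z\<close> orthogonal to it satisfies
  \<open>(z, - z) \<in> L\<close> by self-adjointness, and positivity forces \<open>z\<close> to be
  null.\<close>

lemma resolvent_exists: "\<exists>u. (u, x - u) \<in> L"
proof -
  define Y where "Y = {u + v | u v. (u, v) \<in> L}"
  have YD: "\<exists>u. (u, y - u) \<in> L" if yY: "y \<in> Y" for y
  proof -
    obtain u v where "y = u + v" "(u, v) \<in> L" using yY unfolding Y_def by blast
    then show ?thesis by (intro exI[of _ u]) simp
  qed
  have "subspace Y"
  proof (rule subspaceI)
    show "0 \<in> Y" using L_zero unfolding Y_def by force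
    fix a b assume "a \<in> Y" "b \<in> Y"
    then obtain u v u' v' where "a = u + v" "b = u' + v'" "(u, v) \<in> L" "(u', v') \<in> L"
      unfolding Y_def by blast
    then show "a + b \<in> Y"
      unfolding Y_def mem_Collect_eq using L_add[of u v u' v']
      by (intro exI[of _ "u + u'"] exI[of _ "v + v'"]) auto
  next
    fix c a assume "a \<in> Y"
    then obtain u v where "a = u + v" "(u, v) \<in> L" unfolding Y_def by blast
    then show "c *\<^sub>R a \<in> Y"
      unfolding Y_def using L_scale[of u v c] by (auto simp: scaleR_add_right)
  qed
  moreover have "l \<in> Y" if y: "\<And>n. y n \<in> Y" and l: "(\<lambda>n. nrm (y n - l)) \<longlonglongrightarrow> 0" for y :: "nat \<Rightarrow> 'v" and l
  proof -
    have "\<exists>u. (u, y n - u) \<in> L" for n using YD[OF y] .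
    then obtain u where u: "\<And>n. (u n, y n - u n) \<in> L" by metis
    have le: "nrm (u m - u n) \<le> nrm (y m - y n)" for m n
      using nrm_le_shift[OF L_diff[OF u[of m] u[of n]]] by simp
    have "\<exists>N. \<forall>m\<ge>N. \<forall>n\<ge>N. nrm (u m - u n) < e" if "0 < e" for e
    proof -
      from order_tendstoD(2)[OF l, of "e/2"] that obtain N where N: "\<And>n. n \<ge> N \<Longrightarrow> nrm (y n - l) < e / 2"
        by (auto simp: eventually_sequentially)
      have "nrm (u m - u n) < e" if "m \<ge> N" "n \<ge> N" for m n
        using le[of m n] nrm_triangle_sub[of "y m" "y n" l] N[OF that(1)] N[OF that(2)]
          nrm_minus_commute[of l "y n"] by simp
      then show ?thesis by blast
    qed
    then obtain w where w: "(\<lambda>n. nrm (u n - w)) \<longlonglongrightarrow> 0" using complete by blast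
    have "(w, l - w) \<in> L" using L_closed[OF u w nrm_tendsto_diff[OF l w]] .
    then show ?thesis unfolding Y_def by force
  qed
  ultimately obtain y where y: "y \<in> Y" and orth: "\<And>z. z \<in> Y \<Longrightarrow> ip (x - y) z = 0"
    using orthogonal_projection[of Y x] by blast
  obtain u where u: "(u, y - u) \<in> L" using YD[OF y] by blast
  have "(x - y, - (x - y)) \<in> L"
  proof (rule L_I)
    fix f h assume "(f, h) \<in> L"
    then have "ip (x - y) (f + h) = 0" using orth unfolding Y_def by blast
    then show "ip h (x - y) = ip f (- (x - y))"
      by (simp add: ip_simps ip_commute[of h] ip_commute[of f])
  qed
  then have "0 \<le> - ip (x - y) (x - y)" using pos[of "x - y" "- (x - y)"] by (simp only: ip_minus_left)
  then have null: "nrm (x - y) = 0" using ip_ge_zero[of "x - y"] by (simp add: nrm_eq_0_iff)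
  have "(u, x - u) \<in> L" using u
    by (rule L_null_cong) (use null nrm_minus_commute[of x y] in auto)
  then show ?thesis ..
qed

text \<open>The resolvent \<open>(1 + L)\<^sup>-\<^sup>1\<close>; it is linear up to null vectors only.\<close>

definition A :: "'v \<Rightarrow> 'v" where "A x = (SOME u. (u, x - u) \<in> L)"

lemma A_in: "(A x, x - A x) \<in> L"
  unfolding A_def using resolvent_exists by (rule someI_ex)

lemma A_unique:
  assumes "(u, v) \<in> L"
  shows "nrm (A (u + v) - u) = 0"
  using nrm_le_shift[OF L_diff[OF A_in assms], of "u + v"] nrm_ge_zero[of "A (u + v) - u"] by simp

lemma A_sym: "ip (A x) y = ip x (A y)"
  using L_sym[OF A_in[of x] A_in[of y]] by (simp add: ip_simps)

lemma A_nrm_le: "nrm (A x) \<le> nrm x"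
  using nrm_le_shift[OF A_in[of x]] by simp

lemma A_diff_null: "nrm (A (x - y) - (A x - A y)) = 0"
  using A_unique[OF L_diff[OF A_in[of x] A_in[of y]]] by simp

lemma A_diff_nrm_le: "nrm (A x - A y) \<le> nrm (x - y)"
  using A_nrm_le[of "x - y"] nrm_cong[OF A_diff_null[of x y]] by simp

lemma A_nrm_sq_le: "(nrm (A x))\<^sup>2 \<le> ip (A x) x"
  using pos[OF A_in[of x]] by (simp add: nrm_sq ip_simps ip_commute)

text \<open>Makes the Cauchy-Schwarz inequality available for the form of the resolvent itself, the
  key to the estimate \<open>sq\<close> in \<open>maximal_eigenvector\<close>.\<close>

sublocale A: semi_inner "\<lambda>x y. ip (A x) y"
proof
  show "ip (A x) y = ip (A y) x" for x y using A_sym[of x y] ip_commute[of x "A y"] by simp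
  show "ip (A (x + y)) z = ip (A x) z + ip (A y) z" for x y z by (simp add: A_sym ip_simps)
  show "ip (A (c *\<^sub>R x)) z = c * ip (A x) z" for x z c by (simp add: A_sym ip_simps)
  show "0 \<le> ip (A x) x" for x using A_nrm_sq_le[of x] zero_le_power2[of "nrm (A x)"] by linarith
qed

text \<open>The resolvent is injective up to null vectors: if \<open>A x\<close> is null then
  \<open>(0, x) \<in> L\<close>, so \<open>x\<close> is null by uniqueness. This keeps the
  eigenvalues of \<open>A\<close> away from 0, so that they can be inverted.\<close>

lemma nrm_pos_imp_A_pos:
  assumes "nrm x \<noteq> 0"
  shows "0 < ip (A x) x"
proof (rule ccontr)
  assume "\<not> ?thesis"
  then have "(nrm (A x))\<^sup>2 \<le> 0" using A_nrm_sq_le[of x] by linarith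
  then have n: "nrm (A x) = 0" by simp
  have "(0, x) \<in> L"
    by (rule L_null_cong[OF A_in[of x]]) (use n nrm_scale[of "-1" "A x"] in auto)
  then show False using L_unique[OF _ L_zero] assms by fastforce
qed

section \<open>Smooth vectors: density and the core property\<close>

lemma relpow_L_diff: "(f, h) \<in> L ^^ n \<Longrightarrow> (g, k) \<in> L ^^ n \<Longrightarrow> (f - g, h - k) \<in> L ^^ n"
proof (induction n arbitrary: h k)
  case (Suc n)
  then obtain h' k' where "(f, h') \<in> L ^^ n" "(h', h) \<in> L" "(g, k') \<in> L ^^ n" "(k', k) \<in> L" by auto
  then show ?case using Suc.IH[of h' k'] L_diff[of h' h k' k] by (auto intro: relcompI)
qed auto

lemma Domain_relpow_diff:
  "f \<in> Domain (L ^^ n) \<Longrightarrow> g \<in> Domain (L ^^ n) \<Longrightarrow> f - g \<in> Domain (L ^^ n)"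
  using relpow_L_diff by blast

lemma Domain_relpow_Suc: "(f, h) \<in> L \<Longrightarrow> h \<in> Domain (L ^^ n) \<Longrightarrow> f \<in> Domain (L ^^ Suc n)"
  by (meson Domain.simps relpow_Suc_I2)

text \<open>
  A Mittag-Leffler argument: with \<open>x\<^sub>k \<approx> A x\<^sub>k\<^sub>+\<^sub>1\<close> up to summable errors, the limits
  \<open>v\<^sub>k = lim\<^sub>m A\<^sup>m x\<^sub>k\<^sub>+\<^sub>m\<close> satisfy \<open>v\<^sub>k = A v\<^sub>k\<^sub>+\<^sub>1\<close>, so \<open>v\<^sub>0\<close> lies in every domain \<open>D(L\<^sup>n)\<close>.
\<close>

lemma smooth_dense:
  assumes "0 < e"
  shows "\<exists>g. (\<forall>n. g \<in> Domain (L ^^ n)) \<and> nrm (f - g) < e"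
proof -
  \<comment> \<open>The range of \<open>A\<close> is the domain of \<open>L\<close>, hence dense, so
    each \<open>x n\<close> can be approximated by some \<open>A x'\<close>. The errors start at
    \<open>e / 4\<close> and halve, so the total displacement of \<open>f\<close> is at most
    \<open>e / 2\<close>.\<close>
  have "\<exists>x. x 0 = f \<and> (\<forall>n. nrm (x n - A (x (Suc n))) \<le> e / 4 / 2 ^ n)"
  proof -
    have "\<exists>x'. nrm (x - A x') \<le> e / 4 / 2 ^ n" for x n
    proof -
      from dense[of "e / 4 / 2 ^ n" x] assms obtain g k
        where gk: "(g, k) \<in> L" "nrm (x - g) < e / 4 / 2 ^ n" by auto
      have "nrm (x - A (g + k)) \<le> e / 4 / 2 ^ n"
        using nrm_triangle_sub[of x "A (g + k)" g] A_unique[OF gk(1)] gk(2)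
          nrm_minus_commute[of g "A (g + k)"] by simp
      then show ?thesis ..
    qed
    define nx where "nx n x = (SOME x'. nrm (x - A x') \<le> e / 4 / 2 ^ n)" for n x
    have nx: "nrm (x - A (nx n x)) \<le> e / 4 / 2 ^ n" for x n
      unfolding nx_def by (rule someI_ex) fact
    show ?thesis using nx by (intro exI[of _ "rec_nat f nx"] conjI allI) (simp_all only: nat.rec)
  qed
  then obtain x where x0: "x 0 = f" and x: "\<And>n. nrm (x n - A (x (Suc n))) \<le> e / 4 / 2 ^ n" by blast
  have contr: "nrm ((A ^^ m) y - (A ^^ m) z) \<le> nrm (y - z)" for m y z
    by (induction m) (auto intro: order_trans[OF A_diff_nrm_le])
  define y where "y k m = (A ^^ m) (x (k + m))" for k m
  have "nrm (y k m - y k (Suc m)) \<le> (e / 4 / 2 ^ k) / 2 ^ m" for k m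
  proof -
    have "y k (Suc m) = (A ^^ m) (A (x (Suc (k + m))))" by (simp add: y_def funpow_swap1)
    then show ?thesis using contr[of m "x (k + m)" "A (x (Suc (k + m)))"] x[of "k + m"]
      by (simp add: y_def power_add)
  qed
  then have "\<exists>l. (\<lambda>m. nrm (y k m - l)) \<longlonglongrightarrow> 0 \<and> (\<forall>m. nrm (y k m - l) \<le> 2 * (e / 4 / 2 ^ k) / 2 ^ m)" for k
    using fast_cauchy_converges by metis
  then obtain v where v: "\<And>k. (\<lambda>m. nrm (y k m - v k)) \<longlonglongrightarrow> 0"
    and vb: "\<And>k m. nrm (y k m - v k) \<le> 2 * (e / 4 / 2 ^ k) / 2 ^ m" by metis
  \<comment> \<open>Shifting the index gives \<open>A (y (Suc k) m) = y k (Suc m)\<close>, and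
    \<open>A\<close> is continuous as a contraction.\<close>
  have Av: "nrm (A (v (Suc k)) - v k) = 0" for k
  proof -
    have "nrm (A (v (Suc k)) - v k) \<le> nrm (y (Suc k) m - v (Suc k)) + nrm (y k (Suc m) - v k)" for m
    proof -
      have "A (y (Suc k) m) = y k (Suc m)" by (simp add: y_def)
      then show ?thesis
        using nrm_triangle_sub[of "A (v (Suc k))" "v k" "y k (Suc m)"]
          A_diff_nrm_le[of "v (Suc k)" "y (Suc k) m"] nrm_minus_commute[of "v (Suc k)" "y (Suc k) m"]
        by simp
    qed
    moreover have "(\<lambda>m. nrm (y (Suc k) m - v (Suc k)) + nrm (y k (Suc m) - v k)) \<longlonglongrightarrow> 0"
      using tendsto_add[OF v LIMSEQ_Suc[OF v]] by simp
    ultimately have "nrm (A (v (Suc k)) - v k) \<le> 0"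
      by (intro LIMSEQ_le_const) auto
    then show ?thesis using nrm_ge_zero[of "A (v (Suc k)) - v k"] by linarith
  qed
  have vL: "(v k, v (Suc k) - v k) \<in> L" for k
    by (rule L_null_cong[OF A_in[of "v (Suc k)"]])
      (use Av[of k] nrm_minus_commute[of "v k" "A (v (Suc k))"] in auto)
  have "v k \<in> Domain (L ^^ n)" for n k
  proof (induction n arbitrary: k)
    case (Suc n)
    show ?case by (rule Domain_relpow_Suc[OF vL Domain_relpow_diff[OF Suc Suc]])
  qed auto
  moreover have "nrm (f - v 0) < e" using vb[of 0 0] assms by (simp add: y_def x0)
  ultimately show ?thesis by blast
qed

text \<open>Approximate \<open>f + h\<close> by a smooth \<open>w\<close> and take
  \<open>(A w, w - A w)\<close>: the contraction \<open>A\<close> controls the first component, and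
  the second is the difference of two controlled vectors. \<open>A w\<close> is smooth because
  \<open>L\<close> maps it to \<open>w - A w\<close>.\<close>

lemma smooth_core:
  assumes "(f, h) \<in> L" "0 < e"
  shows "\<exists>(g, k)\<in>L. (\<forall>n. g \<in> Domain (L ^^ n)) \<and> nrm (g - f) < e \<and> nrm (k - h) < e"
proof -
  from smooth_dense[of "e / 2" "f + h"] assms(2) obtain w
    where w: "\<And>n. w \<in> Domain (L ^^ n)" and we: "nrm (f + h - w) < e / 2" by auto
  have "A w \<in> Domain (L ^^ n)" for n
  proof (induction n)
    case (Suc n)
    show ?case by (rule Domain_relpow_Suc[OF A_in Domain_relpow_diff[OF w Suc]])
  qed auto
  moreover have gf: "nrm (A w - f) < e / 2"
    using nrm_triangle_sub[of "A w" f "A (f + h)"] A_unique[OF assms(1)]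
      A_diff_nrm_le[of w "f + h"] we nrm_minus_commute[of w "f + h"] by simp
  moreover have "nrm ((w - A w) - h) < e"
  proof -
    have "(w - A w) - h = (w - (f + h)) + (f - A w)" by simp
    then have "nrm ((w - A w) - h) \<le> nrm (w - (f + h)) + nrm (f - A w)"
      by (metis nrm_triangle)
    then show ?thesis
      using we gf nrm_minus_commute[of w "f + h"]
        nrm_minus_commute[of f "A w"] by linarith
  qed
  ultimately show ?thesis using A_in[of w] assms(2) by (intro bexI[of _ "(A w, w - A w)"]) auto
qed

text \<open>Both sides are continuous in the graph norm, in which smooth vectors are dense. The
  Poincare inequality is available for smooth vectors only.\<close>

lemma form_ineq_from_smooth:
  fixes g :: "'i \<Rightarrow> 'v"
  assumes "\<And>f h. (f, h) \<in> L \<Longrightarrow> (\<And>n. f \<in> Domain (L ^^ n)) \<Longrightarrow>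
      ip f f \<le> c * ip h f + (\<Sum>i\<in>I. (ip f (g i))\<^sup>2)"
    and "(f, h) \<in> L"
  shows "ip f f \<le> c * ip h f + (\<Sum>i\<in>I. (ip f (g i))\<^sup>2)"
proof -
  have "\<exists>u k. (u, k) \<in> L \<and> (\<forall>m. u \<in> Domain (L ^^ m)) \<and> nrm (u - f) < 1 / Suc n \<and> nrm (k - h) < 1 / Suc n" for n
    using smooth_core[OF assms(2), of "1 / Suc n"] by auto
  then obtain u k where uk: "\<And>n. (u n, k n) \<in> L" and sm: "\<And>n m. u n \<in> Domain (L ^^ m)"
    and u: "\<And>n. nrm (u n - f) < 1 / Suc n" and k: "\<And>n. nrm (k n - h) < 1 / Suc n" by metis
  have lim: "(\<lambda>n. 1 / real (Suc n)) \<longlonglongrightarrow> 0" by (rule LIMSEQ_Suc[OF lim_1_over_n])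
  have u0: "(\<lambda>n. nrm (u n - f)) \<longlonglongrightarrow> 0"
    by (rule Lim_null_comparison[OF _ lim]) (use u in \<open>auto intro!: always_eventually less_imp_le\<close>)
  have k0: "(\<lambda>n. nrm (k n - h)) \<longlonglongrightarrow> 0"
    by (rule Lim_null_comparison[OF _ lim]) (use k in \<open>auto intro!: always_eventually less_imp_le\<close>)
  show ?thesis
  proof (rule LIMSEQ_le)
    show "(\<lambda>n. ip (u n) (u n)) \<longlonglongrightarrow> ip f f" by (rule ip_tendsto[OF u0 u0])
    show "(\<lambda>n. c * ip (k n) (u n) + (\<Sum>i\<in>I. (ip (u n) (g i))\<^sup>2)) \<longlonglongrightarrow> c * ip h f + (\<Sum>i\<in>I. (ip f (g i))\<^sup>2)"
      by (intro tendsto_intros ip_tendsto[OF k0 u0] ip_tendsto_left[OF u0])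
    show "\<exists>N. \<forall>n\<ge>N. ip (u n) (u n) \<le> c * ip (k n) (u n) + (\<Sum>i\<in>I. (ip (u n) (g i))\<^sup>2)"
      using assms(1)[OF uk sm] by blast
  qed
qed

end

section \<open>Discrete spectrum\<close>

text \<open>Gaussian elimination, one equation at a time. The functionals are just numbers
  \<open>l i b\<close> on a finite index set, so the same statement serves for eigenvectors and for
  arbitrary independent sets of functions.\<close>

lemma underdetermined_system:
  fixes l :: "nat \<Rightarrow> 'b \<Rightarrow> real"
  assumes "finite B" "n < card B"
  shows "\<exists>c. (\<exists>b\<in>B. c b \<noteq> 0) \<and> (\<forall>i<n. (\<Sum>b\<in>B. c b * l i b) = 0)"
  using assms
proof (induction n arbitrary: B l)
  case 0
  then show ?case by (intro exI[of _ "\<lambda>_. 1"]) (auto simp: card_gt_0_iff)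
next
  case (Suc n)
  show ?case
  proof (cases "\<exists>b\<in>B. l n b \<noteq> 0")
    case False
    from Suc.IH[of B l] Suc.prems obtain c where "\<exists>b\<in>B. c b \<noteq> 0" "\<forall>i<n. (\<Sum>b\<in>B. c b * l i b) = 0" by auto
    moreover have "(\<Sum>b\<in>B. c b * l n b) = 0" using False by (intro sum.neutral) auto
    ultimately show ?thesis by (auto simp: less_Suc_eq)
  next
    case True
    then obtain b0 where b0: "b0 \<in> B" "l n b0 \<noteq> 0" by blast
    define B' where "B' = B - {b0}"
    have B': "finite B'" "n < card B'" using Suc.prems b0 by (auto simp: B'_def)
    \<comment> \<open>Row reduction with pivot \<open>b0\<close> in equation \<open>n\<close>: that
      equation becomes trivial for \<open>l'\<close>, and the coefficient of \<open>b0\<close> in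
      \<open>d\<close> below is the one that solves it.\<close>
    define l' where "l' i b = l i b - l n b / l n b0 * l i b0" for i b
    from Suc.IH[OF B', of l'] obtain c
      where c: "\<exists>b\<in>B'. c b \<noteq> 0" "\<And>i. i < n \<Longrightarrow> (\<Sum>b\<in>B'. c b * l' i b) = 0" by blast
    define d where "d = (\<lambda>b. if b = b0 then - (\<Sum>b\<in>B'. c b * l n b) / l n b0 else c b)"
    have sumd: "(\<Sum>b\<in>B. d b * l i b) = (\<Sum>b\<in>B'. c b * l' i b)" for i
    proof -
      have "(\<Sum>b\<in>B. d b * l i b) = d b0 * l i b0 + (\<Sum>b\<in>B'. d b * l i b)"
        unfolding B'_def using Suc.prems(1) b0(1) by (rule sum.remove)
      also have "(\<Sum>b\<in>B'. d b * l i b) = (\<Sum>b\<in>B'. c b * l i b)"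
        by (intro sum.cong) (auto simp: d_def B'_def)
      also have "d b0 * l i b0 = - (\<Sum>b\<in>B'. c b * (l n b / l n b0 * l i b0))"
        by (simp add: d_def sum_divide_distrib sum_distrib_right) (simp add: mult.assoc)
      finally show ?thesis by (simp add: l'_def right_diff_distrib sum_subtractf)
    qed
    have "l' n b = 0" for b using b0 by (simp add: l'_def)
    then have "(\<Sum>b\<in>B. d b * l i b) = 0" if "i < Suc n" for i
      using that c(2)[of i] unfolding sumd by (cases "i = n") auto
    moreover have "\<exists>b\<in>B. d b \<noteq> 0" using c(1) by (auto simp: d_def B'_def)
    ultimately show ?thesis by blast
  qed
qed

text \<open>Tychonoff's theorem. With countably many coordinates it replaces a diagonal extraction
  of subsequences.\<close>

lemma compact_PiE_UNIV:
  fixes S :: "'i \<Rightarrow> 'b::topological_space set"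
  assumes "\<And>i. compact (S i)"
  shows "compact (PiE UNIV S)"
proof -
  have "compactin (product_topology (\<lambda>_. euclidean) UNIV) (PiE UNIV S)"
    unfolding compactin_PiE using assms by simp
  then show ?thesis by (simp add: euclidean_product_topology)
qed

text \<open>The compactness hypothesis in quantitative form: up to finitely many functionals, the
  norm is an arbitrarily small multiple of the quadratic form.\<close>

locale small_form = pos_selfadjoint ip L for ip :: "'v::real_vector \<Rightarrow> 'v \<Rightarrow> real" and L +
  assumes small: "0 < e \<Longrightarrow> \<exists>(n::nat) g. \<forall>(f, h)\<in>L. ip f f \<le> e * ip h f + (\<Sum>i<n. (ip f (g i))\<^sup>2)"
begin

text \<open>A Rellich type theorem. Along a subsequence all functionals supplied by
  \<open>small\<close> converge, and the inequalities upgrade this to norm convergence because the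
  form of the differences stays bounded.\<close>

lemma bounded_form_convergent_subseq:
  assumes u: "\<And>n. (u n, w n) \<in> L" and c: "\<And>n. ip (w n) (u n) \<le> c" and b: "\<And>n. nrm (u n) \<le> 1"
  shows "\<exists>s l. strict_mono (s :: nat \<Rightarrow> nat) \<and> (\<lambda>n. nrm (u (s n) - l)) \<longlonglongrightarrow> 0"
proof -
  have c0: "0 \<le> c" using pos[OF u[of 0]] c[of 0] by linarith
  have "\<forall>m. \<exists>(n::nat) g. \<forall>(f, h)\<in>L. ip f f \<le> 1 / Suc m * ip h f + (\<Sum>i<n. (ip f (g i))\<^sup>2)"
    by (intro allI small) simp
  then have "\<exists>(N::nat \<Rightarrow> nat) G. \<forall>m. \<forall>(f, h)\<in>L. ip f f \<le> 1 / Suc m * ip h f + (\<Sum>i<N m. (ip f (G m i))\<^sup>2)"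
    unfolding choice_iff .
  then obtain N :: "nat \<Rightarrow> nat" and G where NG0: "\<forall>m. \<forall>(f, h)\<in>L. ip f f \<le> 1 / Suc m * ip h f + (\<Sum>i<N m. (ip f (G m i))\<^sup>2)"
    by (elim exE)
  have NG: "ip f f \<le> 1 / Suc m * ip h f + (\<Sum>i<N m. (ip f (G m i))\<^sup>2)" if "(f, h) \<in> L" for m f h
    using NG0 that by blast
  \<comment> \<open>Collects the values of all functionals, for all accuracies
    \<open>1 / Suc m\<close>, in one point of a product of compact intervals.\<close>
  define \<phi> where "\<phi> n = (\<lambda>p::nat\<times>nat. ip (u n) (G (fst p) (snd p)))" for n
  define K where "K = PiE UNIV (\<lambda>p::nat\<times>nat. {- nrm (G (fst p) (snd p)) .. nrm (G (fst p) (snd p))})"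
  have "\<phi> n \<in> K" for n
  proof -
    have "\<bar>ip (u n) g\<bar> \<le> nrm g" for g
      using cauchy_schwarz[of "u n" g] mult_right_mono[OF b[of n] nrm_ge_zero[of g]] by simp
    then show ?thesis by (auto simp: K_def \<phi>_def abs_le_iff minus_le_iff)
  qed
  moreover have "compact K" unfolding K_def by (intro compact_PiE_UNIV) simp
  ultimately obtain l s where s: "strict_mono (s::nat\<Rightarrow>nat)" and l: "(\<phi> \<circ> s) \<longlonglongrightarrow> l"
    using compact_imp_seq_compact seq_compactE by metis
  have coord: "(\<lambda>n. ip (u (s n)) (G m i)) \<longlonglongrightarrow> l (m, i)" for m i
    using continuous_on_tendsto_compose[OF continuous_on_product_coordinates l, of "(m, i)"]
    by (simp add: \<phi>_def o_def)
  have "\<exists>M. \<forall>j\<ge>M. \<forall>k\<ge>M. nrm (u (s j) - u (s k)) < e" if e: "0 < e" for e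
  proof -
    \<comment> \<open>The form of a difference is at most \<open>4 * c\<close>, so this
      \<open>m\<close> leaves half of \<open>e^2\<close> to the finitely many coordinates;
      \<open>2 * F j + 2 * F k\<close> stays below it once each \<open>F\<close> is below
      \<open>e^2 / 8\<close>.\<close>
    obtain m where m: "4 * c / Suc m < e\<^sup>2 / 2"
    proof -
      have "(\<lambda>m. 4 * c * (1 / real (Suc m))) \<longlonglongrightarrow> 4 * c * 0"
        by (intro tendsto_intros LIMSEQ_Suc[OF lim_1_over_n])
      then have "\<forall>\<^sub>F m in sequentially. 4 * c * (1 / real (Suc m)) < e\<^sup>2 / 2"
        using e by (intro order_tendstoD(2)) auto
      then show ?thesis using that by (auto simp: eventually_sequentially)
    qed
    define F where "F n = (\<Sum>i<N m. (ip (u (s n)) (G m i) - l (m, i))\<^sup>2)" for n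
    have "F \<longlonglongrightarrow> (\<Sum>i<N m. (l (m, i) - l (m, i))\<^sup>2)"
      unfolding F_def by (intro tendsto_intros coord)
    then have "\<forall>\<^sub>F n in sequentially. F n < e\<^sup>2 / 8"
      using e by (intro order_tendstoD(2)) auto
    then obtain M where M: "\<And>n. n \<ge> M \<Longrightarrow> F n < e\<^sup>2 / 8" by (auto simp: eventually_sequentially)
    have "nrm (u (s j) - u (s k)) < e" if "j \<ge> M" "k \<ge> M" for j k
    proof (rule power2_less_imp_less)
      let ?d = "u (s j) - u (s k)"
      \<comment> \<open>Parallelogram identity for the form of \<open>L\<close>; the term with the
        sums is non-negative and is dropped.\<close>
      have "ip (w (s j) - w (s k)) ?d + ip (w (s j) + w (s k)) (u (s j) + u (s k))
          = 2 * ip (w (s j)) (u (s j)) + 2 * ip (w (s k)) (u (s k))"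
        by (simp add: ip_simps)
      with pos[OF L_add[OF u[of "s j"] u[of "s k"]]] c[of "s j"] c[of "s k"]
      have form: "ip (w (s j) - w (s k)) ?d \<le> 4 * c" by linarith
      have "(\<Sum>i<N m. (ip ?d (G m i))\<^sup>2) \<le> (\<Sum>i<N m. 2 * (ip (u (s j)) (G m i) - l (m, i))\<^sup>2
          + 2 * (ip (u (s k)) (G m i) - l (m, i))\<^sup>2)"
      proof (rule sum_mono)
        fix i
        have "0 \<le> ((ip (u (s j)) (G m i) - l (m, i)) + (ip (u (s k)) (G m i) - l (m, i)))\<^sup>2" by simp
        then show "(ip ?d (G m i))\<^sup>2 \<le> 2 * (ip (u (s j)) (G m i) - l (m, i))\<^sup>2
          + 2 * (ip (u (s k)) (G m i) - l (m, i))\<^sup>2"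
          by (simp add: ip_diff_left power2_eq_square algebra_simps)
      qed
      also have "\<dots> = 2 * F j + 2 * F k" by (simp add: F_def sum.distrib sum_distrib_left)
      also have "\<dots> < e\<^sup>2 / 2" using M[OF that(1)] M[OF that(2)] by linarith
      finally have "ip ?d ?d < 1 / Suc m * ip (w (s j) - w (s k)) ?d + e\<^sup>2 / 2"
        using NG[OF L_diff[OF u[of "s j"] u[of "s k"]], of m] by linarith
      also have "1 / Suc m * ip (w (s j) - w (s k)) ?d \<le> 1 / Suc m * (4 * c)"
        by (intro mult_left_mono form) simp
      finally show "(nrm ?d)\<^sup>2 < e\<^sup>2" using m by (simp add: nrm_sq)
    qed (use e in simp)
    then show ?thesis by blast
  qed
  from complete[OF this] s show ?thesis by blast
qed

text \<open>Rayleigh principle: \<open>a\<close> is the supremum of \<open>ip (A x) x\<close> over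
  unit vectors of \<open>W\<close>. For a maximizing sequence \<open>A x - a x\<close> tends to 0,
  and compactness of \<open>A\<close> yields a limit. The norm bound on all of \<open>W\<close> is
  recorded because it later gives both the order of the eigenvalues and completeness.\<close>

lemma maximal_eigenvector:
  assumes sub: "subspace W"
    and closed: "\<And>x l. (\<And>n. x n \<in> W) \<Longrightarrow> (\<lambda>n. nrm (x n - l)) \<longlonglongrightarrow> 0 \<Longrightarrow> l \<in> W"
    and inv: "\<And>x. x \<in> W \<Longrightarrow> A x \<in> W"
    and x0: "x0 \<in> W" "nrm x0 \<noteq> 0"
  shows "\<exists>y\<in>W. \<exists>a. nrm y = 1 \<and> 0 < a \<and> a \<le> 1 \<and> nrm (A y - a *\<^sub>R y) = 0 \<and> (\<forall>x\<in>W. nrm (A x) \<le> a * nrm x)"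
proof -
  define S where "S = {ip (A x) x | x. x \<in> W \<and> nrm x = 1}"
  define a where "a = Sup S"
  have bdd: "bdd_above S"
  proof (rule bdd_aboveI[of _ 1])
    fix r assume "r \<in> S"
    then obtain x where x: "r = ip (A x) x" "nrm x = 1" unfolding S_def by blast
    then show "r \<le> 1" using cauchy_schwarz[of "A x" x] A_nrm_le[of x] by simp
  qed
  have norm1: "(1 / nrm x) *\<^sub>R x \<in> W" "nrm ((1 / nrm x) *\<^sub>R x) = 1" if "x \<in> W" "nrm x \<noteq> 0" for x
    using that sub by (auto simp: subspace_scale nrm_scale)
  have ne: "S \<noteq> {}" using norm1[OF x0] unfolding S_def by blast
  have upper: "ip (A x) x \<le> a" if "x \<in> W" "nrm x = 1" for x
    unfolding a_def using bdd that by (intro cSup_upper) (auto simp: S_def)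
  have a_pos: "0 < a"
    using upper[OF norm1[OF x0]] nrm_pos_imp_A_pos[of "(1 / nrm x0) *\<^sub>R x0"] norm1[OF x0] by linarith
  have quad: "ip (A x) x \<le> a * ip x x" if x: "x \<in> W" for x
  proof (cases "nrm x = 0")
    case True
    then show ?thesis by (simp add: null_right)
  next
    case False
    have "ip (A ((1 / nrm x) *\<^sub>R x)) ((1 / nrm x) *\<^sub>R x) = ip (A x) x / ip x x"
      by (simp add: A.ip_simps power2_eq_square flip: nrm_sq)
    with upper[OF norm1[OF x False]] False show ?thesis
      using ip_ge_zero[of x] by (simp add: nrm_eq_0_iff pos_divide_le_eq)
  qed
  \<comment> \<open>Cauchy-Schwarz for the form \<open>ip (A x) y\<close> applied to
    \<open>x\<close> and \<open>A x\<close>, followed by \<open>quad\<close> at \<open>A x\<close>,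
    which lies in \<open>W\<close> by invariance.\<close>
  have sq: "(nrm (A x))\<^sup>2 \<le> a * ip (A x) x" if x: "x \<in> W" for x
  proof (cases "nrm (A x) = 0")
    case True
    then show ?thesis using a_pos A.ip_ge_zero[of x] by simp
  next
    case False
    then have p: "0 < ip (A x) (A x)" using ip_ge_zero[of "A x"] by (simp add: nrm_eq_0_iff)
    have "(ip (A x) (A x))\<^sup>2 \<le> ip (A x) x * ip (A (A x)) (A x)" using A.cauchy_schwarz_sq[of x "A x"] .
    also have "\<dots> \<le> ip (A x) x * (a * ip (A x) (A x))"
      by (intro mult_left_mono quad inv x A.ip_ge_zero)
    finally have "ip (A x) (A x) * ip (A x) (A x) \<le> (a * ip (A x) x) * ip (A x) (A x)"
      by (simp add: power2_eq_square mult_ac)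
    then show ?thesis using p by (simp add: nrm_sq)
  qed
  have contr: "nrm (A x) \<le> a * nrm x" if x: "x \<in> W" for x
  proof (rule power2_le_imp_le)
    have "(nrm (A x))\<^sup>2 \<le> a * (a * ip x x)"
      using sq[OF x] mult_left_mono[OF quad[OF x] less_imp_le[OF a_pos]] by linarith
    then show "(nrm (A x))\<^sup>2 \<le> (a * nrm x)\<^sup>2" by (simp add: power_mult_distrib nrm_sq) (simp add: power2_eq_square mult.assoc)
  qed (use a_pos in simp)
  have "\<exists>x. x \<in> W \<and> nrm x = 1 \<and> a - 1 / Suc n < ip (A x) x" for n
  proof -
    have "a - 1 / Suc n < Sup S" unfolding a_def by simp
    then show ?thesis using less_cSup_iff[OF ne bdd] unfolding S_def by blast
  qed
  then obtain x where xW: "\<And>n. x n \<in> W" and x1: "\<And>n. nrm (x n) = 1"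
    and xa: "\<And>n. a - 1 / Suc n < ip (A (x n)) (x n)" by metis
  have res: "(nrm (A (x n) - a *\<^sub>R x n))\<^sup>2 \<le> a * (1 / Suc n)" for n
  proof -
    have "ip (x n) (x n) = 1" using x1[of n] nrm_sq[of "x n"] by simp
    then have "(nrm (A (x n) - a *\<^sub>R x n))\<^sup>2 = (nrm (A (x n)))\<^sup>2 - 2 * a * ip (A (x n)) (x n) + a * a"
      using ip_commute[of "x n" "A (x n)"] unfolding nrm_sq ip_simps by (simp add: algebra_simps)
    also have "\<dots> \<le> a * (a - ip (A (x n)) (x n))" using sq[OF xW[of n]] by (simp add: algebra_simps)
    also have "\<dots> \<le> a * (1 / Suc n)" using a_pos xa[of n] by (intro mult_left_mono) auto
    finally show ?thesis .
  qed
  \<comment> \<open>\<open>A (x n)\<close> lies in the domain of \<open>L\<close> with image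
    \<open>x n - A (x n)\<close>, so this bounds the form and
    \<open>bounded_form_convergent_subseq\<close> applies to the images
    \<open>A (x n)\<close>.\<close>
  have "ip (x n - A (x n)) (A (x n)) \<le> 1" for n
  proof -
    have "ip (x n) (A (x n)) \<le> 1"
      using cauchy_schwarz[of "x n" "A (x n)"] A_nrm_le[of "x n"] x1[of n] by simp
    then show ?thesis using ip_ge_zero[of "A (x n)"] by (simp add: ip_simps)
  qed
  moreover have "nrm (A (x n)) \<le> 1" for n using A_nrm_le[of "x n"] x1[of n] by simp
  ultimately obtain s l where s: "strict_mono (s :: nat \<Rightarrow> nat)"
    and l: "(\<lambda>n. nrm (A (x (s n)) - l)) \<longlonglongrightarrow> 0"
    using bounded_form_convergent_subseq[of "\<lambda>n. A (x n)" "\<lambda>n. x n - A (x n)" 1] A_in by blast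
  define y where "y = (1 / a) *\<^sub>R l"
  have "(\<lambda>n. (nrm (A (x n) - a *\<^sub>R x n))\<^sup>2) \<longlonglongrightarrow> 0"
  proof (rule Lim_null_comparison)
    show "(\<lambda>n. a * (1 / real (Suc n))) \<longlonglongrightarrow> 0"
      using tendsto_mult[OF tendsto_const LIMSEQ_Suc[OF lim_1_over_n]] by simp
  qed (use res in auto)
  then have "(\<lambda>n. nrm (A (x n) - a *\<^sub>R x n)) \<longlonglongrightarrow> 0"
    using tendsto_real_sqrt by fastforce
  then have r0: "(\<lambda>n. nrm (A (x (s n)) - a *\<^sub>R x (s n))) \<longlonglongrightarrow> 0"
    using LIMSEQ_subseq_LIMSEQ[OF _ s] by (force simp: o_def)
  have "(\<lambda>n. nrm (a *\<^sub>R x (s n) - l)) \<longlonglongrightarrow> 0"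
  proof (rule Lim_null_comparison)
    show "(\<lambda>n. nrm (A (x (s n)) - a *\<^sub>R x (s n)) + nrm (A (x (s n)) - l)) \<longlonglongrightarrow> 0"
      using tendsto_add[OF r0 l] by simp
    show "\<forall>\<^sub>F n in sequentially. norm (nrm (a *\<^sub>R x (s n) - l)) \<le> nrm (A (x (s n)) - a *\<^sub>R x (s n)) + nrm (A (x (s n)) - l)"
    proof (intro always_eventually allI)
      fix n
      show "norm (nrm (a *\<^sub>R x (s n) - l)) \<le> nrm (A (x (s n)) - a *\<^sub>R x (s n)) + nrm (A (x (s n)) - l)"
        using nrm_triangle_sub[of "a *\<^sub>R x (s n)" l "A (x (s n))"]
          nrm_minus_commute[of "A (x (s n))" "a *\<^sub>R x (s n)"] by simp
    qed
  qed
  from nrm_tendsto_scale[OF this, of "1/a"] have xy: "(\<lambda>n. nrm (x (s n) - y)) \<longlonglongrightarrow> 0"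
    using a_pos by (simp add: y_def)
  have yW: "y \<in> W" by (rule closed[OF _ xy]) (rule xW)
  have "(\<lambda>n. ip (x (s n)) (x (s n))) \<longlonglongrightarrow> ip y y" by (rule ip_tendsto[OF xy xy])
  moreover have "ip (x n) (x n) = 1" for n using x1[of n] nrm_sq[of "x n"] by simp
  ultimately have "ip y y = 1" using LIMSEQ_unique[OF _ tendsto_const] by fastforce
  then have y1: "nrm y = 1" by (simp add: nrm_def)
  have "nrm (A y - l) \<le> 0"
  proof (rule LIMSEQ_le_const)
    show "(\<lambda>n. nrm (x (s n) - y) + nrm (A (x (s n)) - l)) \<longlonglongrightarrow> 0" using tendsto_add[OF xy l] by simp
    have "nrm (A y - l) \<le> nrm (x (s n) - y) + nrm (A (x (s n)) - l)" for n
      using nrm_triangle_sub[of "A y" l "A (x (s n))"] A_diff_nrm_le[of y "x (s n)"]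
        nrm_minus_commute[of y "x (s n)"] by linarith
    then show "\<exists>N. \<forall>n\<ge>N. nrm (A y - l) \<le> nrm (x (s n) - y) + nrm (A (x (s n)) - l)" by blast
  qed
  then have Ay: "nrm (A y - a *\<^sub>R y) = 0" using a_pos order_antisym[OF _ nrm_ge_zero] by (simp add: y_def)
  have "a = nrm (A y)" using nrm_cong[OF Ay] a_pos y1 by (simp add: nrm_scale)
  then have "a \<le> 1" using A_nrm_le[of y] y1 by simp
  with yW y1 a_pos Ay contr show ?thesis by blast
qed

end

text \<open>
  A vector \<open>\<psi> j = 0\<close> stands for an index beyond the dimension, so that finite-dimensional
  spaces need no separate treatment.
\<close>

locale eigenbasis = pos_selfadjoint ip L for ip :: "'v::real_vector \<Rightarrow> 'v \<Rightarrow> real" and L +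
  fixes \<psi> :: "nat \<Rightarrow> 'v" and ev :: "nat \<Rightarrow> real"
  assumes \<psi>_unit: "\<psi> j \<noteq> 0 \<Longrightarrow> ip (\<psi> j) (\<psi> j) = 1"
    and \<psi>_orth: "i \<noteq> j \<Longrightarrow> ip (\<psi> i) (\<psi> j) = 0"
    and \<psi>_eigen: "(\<psi> j, ev j *\<^sub>R \<psi> j) \<in> L"
    and \<psi>_complete: "(\<lambda>n. nrm (f - (\<Sum>j<n. ip f (\<psi> j) *\<^sub>R \<psi> j))) \<longlonglongrightarrow> 0"
begin

lemma parseval: "(\<lambda>j. ip f (\<psi> j) * ip g (\<psi> j)) sums ip f g"
proof -
  have "(\<lambda>n. ip (f - (f - (\<Sum>j<n. ip f (\<psi> j) *\<^sub>R \<psi> j))) g) \<longlonglongrightarrow> ip (f - 0) g"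
    by (rule ip_tendsto_left)
      (use \<psi>_complete[of f] nrm_minus_commute in \<open>simp add: nrm_minus_commute[of "_ - _" f]\<close>)
  then show ?thesis
    by (simp add: sums_def ip_sum_left ip_scale_left ip_commute[of g])
qed

lemma L_coeff:
  assumes "(f, h) \<in> L"
  shows "ip h (\<psi> j) = ev j * ip f (\<psi> j)"
  using L_sym[OF assms \<psi>_eigen[of j]] unfolding ip_scale_right .

text \<open>Self-adjointness makes \<open>L\<close> maximal: a pair with the right coefficients
  satisfies the adjoint identity against every pair of \<open>L\<close> by Parseval, and therefore
  belongs to \<open>L\<close>.\<close>

lemma L_iff_coeff: "(f, h) \<in> L \<longleftrightarrow> (\<forall>j. ip h (\<psi> j) = ev j * ip f (\<psi> j))"
proof
  assume h: "\<forall>j. ip h (\<psi> j) = ev j * ip f (\<psi> j)"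
  show "(f, h) \<in> L"
  proof (rule L_I)
    fix x w assume xw: "(x, w) \<in> L"
    have "(\<lambda>j. ip w (\<psi> j) * ip f (\<psi> j)) = (\<lambda>j. ip x (\<psi> j) * ip h (\<psi> j))"
      using L_coeff[OF xw] h by (auto simp: mult_ac)
    then show "ip w f = ip x h" using parseval[of w f] parseval[of x h] sums_unique2 by metis
  qed
qed (simp add: L_coeff)

text \<open>The second hypothesis forces \<open>c\<close> to vanish at dummy indices, where no
  vector can produce a non-zero coefficient.\<close>

lemma riesz_fischer:
  assumes sm: "summable (\<lambda>j. (c j)\<^sup>2)" and z: "\<And>j. \<psi> j = 0 \<Longrightarrow> c j = 0"
  shows "\<exists>f. \<forall>j. ip f (\<psi> j) = c j"
proof -
  define S where "S n = (\<Sum>j<n. c j *\<^sub>R \<psi> j)" for n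
  have coeff: "ip (\<psi> i) (\<psi> j) = (if i = j \<and> \<psi> i \<noteq> 0 then 1 else 0)" for i j
    using \<psi>_unit \<psi>_orth by auto
  have ipS: "ip (\<Sum>j\<in>J. c j *\<^sub>R \<psi> j) (\<psi> i) = (if i \<in> J then c i else 0)" if "finite J" for J i
  proof -
    have "ip (\<Sum>j\<in>J. c j *\<^sub>R \<psi> j) (\<psi> i) = (\<Sum>j\<in>J. if j = i then c j else 0)"
      unfolding ip_sum_left ip_scale_left coeff using z by (intro sum.cong) auto
    then show ?thesis using that by simp
  qed
  have sq: "(nrm (S n - S m))\<^sup>2 = (\<Sum>j=m..<n. (c j)\<^sup>2)" if "m \<le> n" for m n
  proof -
    have "{..<n} = {..<m} \<union> {m..<n}" using that by auto
    then have "S n - S m = (\<Sum>j=m..<n. c j *\<^sub>R \<psi> j)"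
      unfolding S_def by (simp add: sum.union_disjoint ivl_disj_int)
    then have "(nrm (S n - S m))\<^sup>2 = (\<Sum>j=m..<n. c j * ip (\<Sum>j=m..<n. c j *\<^sub>R \<psi> j) (\<psi> j))"
      by (simp add: nrm_sq ip_sum_right ip_scale_right)
    also have "\<dots> = (\<Sum>j=m..<n. (c j)\<^sup>2)"
      by (intro sum.cong) (auto simp: ipS power2_eq_square)
    finally show ?thesis .
  qed
  have "\<exists>N. \<forall>m\<ge>N. \<forall>n\<ge>N. nrm (S m - S n) < e" if e: "0 < e" for e
  proof -
    from sm e obtain N where N: "\<And>m n. m \<ge> N \<Longrightarrow> norm (\<Sum>j=m..<n. (c j)\<^sup>2) < e\<^sup>2"
      unfolding summable_Cauchy by (meson zero_less_power)
    have "nrm (S n - S m) < e" if "N \<le> m" "m \<le> n" for m n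
      by (rule power2_less_imp_less) (use sq[OF that(2)] N[OF that(1), of n] e in auto)
    then have "nrm (S m - S n) < e" if "N \<le> m" "N \<le> n" for m n
      using that nrm_minus_commute by (metis nle_le)
    then show ?thesis by blast
  qed
  from complete[OF this] obtain f where f: "(\<lambda>n. nrm (S n - f)) \<longlonglongrightarrow> 0" by blast
  have "ip f (\<psi> i) = c i" for i
  proof (rule LIMSEQ_unique[OF ip_tendsto_left[OF f]])
    have "\<forall>\<^sub>F n in sequentially. ip (S n) (\<psi> i) = c i"
      using eventually_gt_at_top[of i] by eventually_elim (auto simp: S_def ipS)
    then show "(\<lambda>n. ip (S n) (\<psi> i)) \<longlonglongrightarrow> c i" by (rule tendsto_eventually)
  qed
  then show ?thesis by blast
qed

lemma null_if_coeffs_zero: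
  assumes "\<And>j. ip f (\<psi> j) = 0"
  shows "nrm f = 0"
proof -
  have "(\<lambda>_. 0) sums ip f f" using parseval[of f f] assms by simp
  then show ?thesis unfolding nrm_eq_0_iff using sums_unique2 sums_zero by blast
qed

lemma ev_nonneg: "\<psi> j \<noteq> 0 \<Longrightarrow> 0 \<le> ev j"
  using pos[OF \<psi>_eigen, of j] \<psi>_unit[of j] by (simp add: ip_scale_left)

end

section \<open>Counting eigenvectors and constructing the eigenbasis\<close>

context pos_selfadjoint
begin

text \<open>Serves twice: with a crude \<open>n\<close> it shows that only finitely many eigenvalues
  lie below any level, and with \<open>n\<close> the cardinality of a lattice it gives the final
  estimate.\<close>

lemma card_eigenvectors_le:
  fixes g :: "nat \<Rightarrow> 'v" and ev :: "nat \<Rightarrow> real"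
  assumes fi: "\<And>f h. (f, h) \<in> L \<Longrightarrow> ip f f \<le> e * ip h f + (\<Sum>i<n. (ip f (g i))\<^sup>2)"
    and e: "0 \<le> e" "e * w < 1"
    and J: "finite J" "\<And>j. j \<in> J \<Longrightarrow> (\<psi> j, ev j *\<^sub>R \<psi> j) \<in> L \<and> ev j \<le> w \<and> ip (\<psi> j) (\<psi> j) = 1"
    and orth: "\<And>i j. i \<in> J \<Longrightarrow> j \<in> J \<Longrightarrow> i \<noteq> j \<Longrightarrow> ip (\<psi> i) (\<psi> j) = 0"
  shows "card J \<le> n"
proof (rule ccontr)
  assume "\<not> ?thesis"
  then have "n < card J" by simp
  from underdetermined_system[OF J(1) this, of "\<lambda>i j. ip (\<psi> j) (g i)"] obtain c where
    c: "\<exists>b\<in>J. c b \<noteq> 0" and c0: "\<And>i. i < n \<Longrightarrow> (\<Sum>b\<in>J. c b * ip (\<psi> b) (g i)) = 0" by blast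
  define f where "f = (\<Sum>j\<in>J. c j *\<^sub>R \<psi> j)"
  define h where "h = (\<Sum>j\<in>J. c j *\<^sub>R ev j *\<^sub>R \<psi> j)"
  have fh: "(f, h) \<in> L" unfolding f_def h_def using J(2) by (intro L_sum L_scale) blast
  have coeff: "ip f (\<psi> i) = c i" if "i \<in> J" for i
  proof -
    have "ip f (\<psi> i) = (\<Sum>j\<in>J. if j = i then c j else 0)"
      unfolding f_def ip_sum_left ip_scale_left using J(2) orth that by (intro sum.cong) auto
    then show ?thesis using J(1) that by simp
  qed
  have ff: "ip f f = (\<Sum>j\<in>J. (c j)\<^sup>2)"
  proof -
    have "ip f f = (\<Sum>j\<in>J. c j * ip f (\<psi> j))"
      by (subst (2) f_def) (simp add: ip_sum_right ip_scale_right)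
    also have "\<dots> = (\<Sum>j\<in>J. (c j)\<^sup>2)" by (intro sum.cong) (auto simp: coeff power2_eq_square)
    finally show ?thesis .
  qed
  have "ip h f = (\<Sum>j\<in>J. ev j * (c j)\<^sup>2)"
  proof -
    have "ip h f = (\<Sum>j\<in>J. c j * (ev j * ip f (\<psi> j)))"
      unfolding h_def ip_sum_left ip_scale_left by (simp add: ip_commute)
    also have "\<dots> = (\<Sum>j\<in>J. ev j * (c j)\<^sup>2)" by (intro sum.cong) (auto simp: coeff power2_eq_square)
    finally show ?thesis .
  qed
  also have "\<dots> \<le> (\<Sum>j\<in>J. w * (c j)\<^sup>2)" using J(2) by (intro sum_mono mult_right_mono) auto
  finally have hf: "ip h f \<le> w * ip f f" by (simp add: ff sum_distrib_left)
  have "ip f (g i) = 0" if "i < n" for i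
    unfolding f_def ip_sum_left ip_scale_left using c0[OF that] .
  then have "(\<Sum>i<n. (ip f (g i))\<^sup>2) = 0" by simp
  then have "ip f f \<le> e * (w * ip f f)" using fi[OF fh] mult_left_mono[OF hf e(1)] by linarith
  moreover have "0 < ip f f"
  proof -
    obtain b where "b \<in> J" "c b \<noteq> 0" using c by blast
    then show ?thesis unfolding ff using J(1) by (intro sum_pos2[of J b]) auto
  qed
  then have "(e * w) * ip f f < 1 * ip f f" using e(2) by (intro mult_strict_right_mono)
  ultimately show False by (simp add: mult.assoc)
qed

end

context small_form
begin

text \<open>Each vector maximizes on the orthogonal complement of all earlier ones, so the recursion
  needs the whole history. Vector and eigenvalue are chosen as one pair.\<close>

lemma eigensequence_exists:
  "\<exists>\<psi> a. \<forall>n::nat.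
     (if \<exists>x. (\<forall>i<n. ip x (\<psi> i) = 0) \<and> nrm x \<noteq> 0
      then (\<forall>i<n. ip (\<psi> n) (\<psi> i) = 0) \<and> nrm (\<psi> n) = 1 else \<psi> n = 0) \<and>
     0 < a n \<and> a n \<le> 1 \<and> nrm (A (\<psi> n) - a n *\<^sub>R \<psi> n) = 0 \<and>
     (\<forall>x. (\<forall>i<n. ip x (\<psi> i) = 0) \<longrightarrow> nrm (A x) \<le> a n * nrm x)"
proof -
  define P where "P p n r \<longleftrightarrow>
     (if \<exists>x. (\<forall>i<n. ip x (fst (p i)) = 0) \<and> nrm x \<noteq> 0
      then (\<forall>i<n. ip (fst r) (fst (p i)) = 0) \<and> nrm (fst r) = 1 else fst r = 0) \<and>
     0 < snd r \<and> snd r \<le> 1 \<and> nrm (A (fst r) - snd r *\<^sub>R fst r) = 0 \<and>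
     (\<forall>x. (\<forall>i<n. ip x (fst (p i)) = 0) \<longrightarrow> nrm (A x) \<le> snd r * nrm x)"
    for p :: "nat \<Rightarrow> 'v \<times> real" and n and r :: "'v \<times> real"
  have "\<exists>f. \<forall>n. P f n (f n)"
  proof (rule dependent_wellorder_choice)
    fix r :: "'v \<times> real" and f g :: "nat \<Rightarrow> 'v \<times> real" and n :: nat
    assume "\<And>y. y < n \<Longrightarrow> f y = g y"
    then have "(\<forall>i<n. ip x (fst (f i)) = 0) \<longleftrightarrow> (\<forall>i<n. ip x (fst (g i)) = 0)" for x by simp
    then show "P f n r = P g n r" by (simp only: P_def)
  next
    fix n :: nat and p :: "nat \<Rightarrow> 'v \<times> real"
    assume prev: "\<And>i. i < n \<Longrightarrow> P p i (p i)"
    define W where "W = {x. \<forall>i<n. ip x (fst (p i)) = 0}"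
    show "\<exists>r. P p n r"
    proof (cases "\<exists>x\<in>W. nrm x \<noteq> 0")
      case False
      have "nrm (A x) \<le> nrm x" for x by (rule A_nrm_le)
      moreover have "nrm (A 0 - 0) = 0" using A_nrm_le[of 0] order_antisym[OF _ nrm_ge_zero] by simp
      \<comment> \<open>The dummy pair once the complement is null; the value 1 satisfies the norm
        bound because \<open>A\<close> is a contraction.\<close>
      ultimately have "P p n (0, 1)" using False unfolding P_def W_def by simp
      then show ?thesis ..
    next
      case True
      then obtain x0 where x0: "x0 \<in> W" "nrm x0 \<noteq> 0" by blast
      have "subspace W" by (rule subspaceI) (auto simp: W_def ip_simps)
      moreover have "l \<in> W" if "\<And>n. x n \<in> W" "(\<lambda>n. nrm (x n - l)) \<longlonglongrightarrow> 0" for x :: "nat \<Rightarrow> 'v" and l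
        using LIMSEQ_unique[OF ip_tendsto_left[OF that(2)]] that(1) by (simp add: W_def)
      \<comment> \<open>The complement is invariant because \<open>A\<close> is symmetric and the
        earlier vectors are eigenvectors of \<open>A\<close> up to null vectors.\<close>
      moreover have "A x \<in> W" if "x \<in> W" for x
      proof -
        have "ip (A x) (fst (p i)) = 0" if "i < n" for i
        proof -
          have "nrm (A (fst (p i)) - snd (p i) *\<^sub>R fst (p i)) = 0" using prev[OF that] by (simp add: P_def)
          then have "ip (A (fst (p i))) x = snd (p i) * ip (fst (p i)) x"
            using null_cong_left by (simp add: ip_scale_left)
          moreover have "ip (fst (p i)) x = 0" using \<open>x \<in> W\<close> that ip_commute[of "fst (p i)" x] by (simp add: W_def)
          ultimately show ?thesis using A_sym[of x "fst (p i)"] ip_commute[of x "A (fst (p i))"] by simp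
        qed
        then show ?thesis by (simp add: W_def)
      qed
      ultimately obtain y a where "y \<in> W" "nrm y = 1" "0 < a" "a \<le> 1"
        "nrm (A y - a *\<^sub>R y) = 0" "\<forall>x\<in>W. nrm (A x) \<le> a * nrm x"
        using maximal_eigenvector[of W x0] x0 by blast
      then have "P p n (y, a)" using x0 unfolding P_def W_def by auto
      then show ?thesis ..
    qed
  qed
  then obtain f where "\<forall>n. P f n (f n)" ..
  then show ?thesis unfolding P_def
    by - (rule exI[where x = "\<lambda>n. fst (f n)"], rule exI[where x = "\<lambda>n. snd (f n)"], assumption)
qed

text \<open>Completeness comes from a rate: for \<open>(g, k) \<in> L\<close> the residual of
  \<open>g\<close> is at most \<open>a n * nrm (g + k)\<close>, and \<open>a n\<close> tends to 0
  when no dummy index occurs. Density of the domain and contractivity of the residual extend this to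
  every vector.\<close>

lemma eigenbasis_exists:
  "\<exists>\<psi> ev. eigenbasis ip L \<psi> ev \<and>
     (\<forall>n. \<psi> n = 0 \<longleftrightarrow> (\<forall>x. (\<forall>i<n. ip x (\<psi> i) = 0) \<longrightarrow> nrm x = 0)) \<and>
     (\<forall>i j. i \<le> j \<longrightarrow> \<psi> j \<noteq> 0 \<longrightarrow> ev i \<le> ev j) \<and>
     (\<forall>w. finite {j. \<psi> j \<noteq> 0 \<and> ev j \<le> w})"
proof -
  from eigensequence_exists obtain \<psi> :: "nat \<Rightarrow> 'v" and a :: "nat \<Rightarrow> real" where seq: "\<forall>n.
     (if \<exists>x. (\<forall>i<n. ip x (\<psi> i) = 0) \<and> nrm x \<noteq> 0
      then (\<forall>i<n. ip (\<psi> n) (\<psi> i) = 0) \<and> nrm (\<psi> n) = 1 else \<psi> n = 0) \<and>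
     0 < a n \<and> a n \<le> 1 \<and> nrm (A (\<psi> n) - a n *\<^sub>R \<psi> n) = 0 \<and>
     (\<forall>x. (\<forall>i<n. ip x (\<psi> i) = 0) \<longrightarrow> nrm (A x) \<le> a n * nrm x)"
    by (elim exE)
  have gen: "if \<exists>x. (\<forall>i<n. ip x (\<psi> i) = 0) \<and> nrm x \<noteq> 0
      then (\<forall>i<n. ip (\<psi> n) (\<psi> i) = 0) \<and> nrm (\<psi> n) = 1 else \<psi> n = 0" for n
    using seq by (elim allE conjE)
  have a: "0 < a n" "a n \<le> 1" for n
    using spec[OF seq, of n] by simp_all
  have A\<psi>: "nrm (A (\<psi> n) - a n *\<^sub>R \<psi> n) = 0" for n
    using spec[OF seq, of n] by (elim conjE)
  have contr: "nrm (A x) \<le> a n * nrm x" if "\<And>i. i < n \<Longrightarrow> ip x (\<psi> i) = 0" for n x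
    using spec[OF seq, of n] that by (elim conjE) simp
  \<comment> \<open>\<open>A\<close> inverts \<open>1 + L\<close>, so an eigenvalue \<open>a\<close>
    of \<open>A\<close> belongs to the eigenvalue \<open>1 / a - 1\<close> of
    \<open>L\<close>.\<close>
  define ev where "ev n = 1 / a n - 1" for n
  have nz: "\<psi> n = 0 \<longleftrightarrow> (\<forall>x. (\<forall>i<n. ip x (\<psi> i) = 0) \<longrightarrow> nrm x = 0)" for n
    using gen[of n] by (auto split: if_splits)
  have orth': "ip (\<psi> n) (\<psi> i) = 0" if "i < n" for i n
    using gen[of n] that by (auto split: if_splits)
  have orth: "ip (\<psi> i) (\<psi> j) = 0" if "i \<noteq> j" for i j
    using orth'[of i j] orth'[of j i] that ip_commute[of "\<psi> i" "\<psi> j"] by (cases "i < j") auto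
  have unit: "nrm (\<psi> j) = 1" if "\<psi> j \<noteq> 0" for j
    using gen[of j] that by (auto split: if_splits)
  have unit': "ip (\<psi> j) (\<psi> j) = 1" if "\<psi> j \<noteq> 0" for j
    using unit[OF that] nrm_sq[of "\<psi> j"] by simp
  have eig: "(\<psi> j, ev j *\<^sub>R \<psi> j) \<in> L" for j
  proof -
    have "(a j *\<^sub>R \<psi> j, \<psi> j - a j *\<^sub>R \<psi> j) \<in> L"
      by (rule L_null_cong[OF A_in[of "\<psi> j"]]) (use A\<psi>[of j] nrm_minus_commute[of "a j *\<^sub>R \<psi> j" "A (\<psi> j)"] in auto)
    from L_scale[OF this, of "1 / a j"] show ?thesis
      using a(1)[of j] by (simp add: ev_def scaleR_diff_right scaleR_diff_left)
  qed
  \<comment> \<open>For \<open>i \<le> j\<close> the vector \<open>\<psi> j\<close> still competes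
    in the maximization at stage \<open>i\<close>, whence \<open>a j \<le> a i\<close>.\<close>
  have mono: "ev i \<le> ev j" if "i \<le> j" "\<psi> j \<noteq> 0" for i j
  proof -
    have "a j = nrm (A (\<psi> j))"
      using nrm_cong[OF A\<psi>[of j]] a(1)[of j] unit[OF that(2)] by (simp add: nrm_scale)
    also have "\<dots> \<le> a i * nrm (\<psi> j)" by (rule contr) (use orth'[of _ j] that in auto)
    finally have "a j \<le> a i" using unit[OF that(2)] by simp
    then show ?thesis unfolding ev_def using a(1)[of j] a(1)[of i] by (simp add: frac_le)
  qed
  have fin: "finite {j. \<psi> j \<noteq> 0 \<and> ev j \<le> w}" for w
  proof -
    \<comment> \<open>This choice gives \<open>e * w \<le> 1 / 2\<close>, whatever the size or sign
      of \<open>w\<close>.\<close>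
    define e where "e = 1 / (2 * max 1 w)"
    have e: "0 < e" "e * w < 1" by (auto simp: e_def max_def field_simps)
    from small[OF e(1)] obtain n g where
      fi: "\<And>f h. (f, h) \<in> L \<Longrightarrow> ip f f \<le> e * ip h f + (\<Sum>i<(n::nat). (ip f (g i))\<^sup>2)" by blast
    have "card J \<le> n" if "finite J" "J \<subseteq> {j. \<psi> j \<noteq> 0 \<and> ev j \<le> w}" for J
      by (rule card_eigenvectors_le[OF fi, where \<psi> = \<psi> and ev = ev and w = w])
        (use that e eig unit' orth in auto)
    then show ?thesis using finite_if_finite_subsets_card_bdd[of "{j. \<psi> j \<noteq> 0 \<and> ev j \<le> w}" n] by blast
  qed
  define r where "r n f = f - (\<Sum>j<n. ip f (\<psi> j) *\<^sub>R \<psi> j)" for n f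
  have r_orth: "ip (r n f) (\<psi> i) = 0" if "i < n" for n f i
  proof -
    have "ip (\<Sum>j<n. ip f (\<psi> j) *\<^sub>R \<psi> j) (\<psi> i) = (\<Sum>j<n. if j = i then ip f (\<psi> i) else 0)"
      unfolding ip_sum_left ip_scale_left
    proof (intro sum.cong refl)
      fix j
      show "ip f (\<psi> j) * ip (\<psi> j) (\<psi> i) = (if j = i then ip f (\<psi> i) else 0)"
        by (cases "j = i"; cases "\<psi> i = 0") (simp_all add: orth unit')
    qed
    then show ?thesis using that by (simp add: r_def ip_diff_left)
  qed
  have r_le: "nrm (r n f) \<le> nrm f" for n f
  proof -
    have "f - r n f = (\<Sum>j<n. ip f (\<psi> j) *\<^sub>R \<psi> j)" by (simp add: r_def)
    then have "ip (r n f) (f - r n f) = 0" using r_orth[of _ n f] by (simp add: ip_sum_right ip_scale_right)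
    then have "ip (r n f) (r n f) = ip (r n f) f" by (simp add: ip_diff_right)
    then have "nrm (r n f) * nrm (r n f) \<le> nrm (r n f) * nrm f"
      using cauchy_schwarz[of "r n f" f] by (simp flip: power2_eq_square add: nrm_sq)
    then show ?thesis using nrm_ge_zero[of "r n f"] nrm_ge_zero[of f]
      by (cases "nrm (r n f) = 0") (auto simp: mult_le_cancel_left)
  qed
  have r_diff: "r n (f - g) = r n f - r n g" for n f g
    by (simp add: r_def ip_diff_left scaleR_diff_left sum_subtractf)
  \<comment> \<open>The residual commutes with \<open>1 + L\<close>, so \<open>r n g\<close> equals
    \<open>A (r n (g + k))\<close> up to a null vector. The argument is orthogonal to the first
    \<open>n\<close> eigenvectors, and \<open>contr\<close> supplies the factor
    \<open>a n\<close>.\<close>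
  have r_dom: "nrm (r n g) \<le> a n * nrm (g + k)" if gk: "(g, k) \<in> L" for n g k
  proof -
    have "(r n g, k - (\<Sum>j<n. ip g (\<psi> j) *\<^sub>R ev j *\<^sub>R \<psi> j)) \<in> L"
      unfolding r_def by (intro L_diff gk L_sum L_scale eig)
    moreover have "r n g + (k - (\<Sum>j<n. ip g (\<psi> j) *\<^sub>R ev j *\<^sub>R \<psi> j)) = r n (g + k)"
      using L_sym[OF gk eig] by (simp add: r_def ip_add_left ip_scale_right scaleR_add_left sum.distrib mult.commute)
    ultimately have "nrm (r n g) = nrm (A (r n (g + k)))"
      using A_unique nrm_cong by metis
    also have "\<dots> \<le> a n * nrm (r n (g + k))" by (rule contr) (rule r_orth)
    also have "\<dots> \<le> a n * nrm (g + k)" using a(1)[of n] r_le by (intro mult_left_mono) auto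
    finally show ?thesis .
  qed
  have "(\<lambda>n. nrm (r n f)) \<longlonglongrightarrow> 0" for f
  proof (cases "\<exists>N. \<psi> N = 0")
    case True
    then obtain N where N: "\<psi> N = 0" by blast
    have "nrm (r n f) = 0" if "N \<le> n" for n
      using nz[of N] N r_orth[of _ n f] that by auto
    then show ?thesis by (intro tendsto_eventually) (auto simp: eventually_sequentially)
  next
    case False
    \<comment> \<open>Only finitely many eigenvalues are at most \<open>1 / d\<close>, and beyond
      them \<open>1 / a n > 1 / d\<close>.\<close>
    have a0: "\<exists>N. \<forall>n\<ge>N. a n < d" if d: "0 < d" for d
    proof -
      obtain N where N: "\<And>j. \<psi> j \<noteq> 0 \<and> ev j \<le> 1 / d \<Longrightarrow> j < N"
        using fin[of "1/d"] unfolding finite_nat_set_iff_bounded by blast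
      have "a n < d" if "n \<ge> N" for n
      proof -
        have "1 / d < ev n" using N[of n] that False by force
        then have "1 / d < 1 / a n" by (simp add: ev_def)
        then show ?thesis using d a(1)[of n] by (simp add: field_simps)
      qed
      then show ?thesis by blast
    qed
    show ?thesis
    proof (rule LIMSEQ_I)
      fix e :: real assume e: "0 < e"
      from dense[of "e / 2" f] e obtain g k where gk: "(g, k) \<in> L" "nrm (f - g) < e / 2" by auto
      define c where "c = nrm (g + k) + 1"
      have c: "0 < c" "nrm (g + k) \<le> c" unfolding c_def using nrm_ge_zero[of "g + k"] by linarith+
      from a0[of "e / 2 / c"] e c obtain N where N: "\<And>n. n \<ge> N \<Longrightarrow> a n < e / 2 / c" by auto
      have "norm (nrm (r n f) - 0) < e" if "n \<ge> N" for n
      proof -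
        have "nrm (r n f) \<le> nrm (r n (f - g)) + nrm (r n g)"
          using nrm_triangle[of "r n (f - g)" "r n g"] by (simp add: r_diff)
        also have "nrm (r n (f - g)) < e / 2" using r_le[of n "f - g"] gk(2) by linarith
        also have "nrm (r n g) \<le> a n * nrm (g + k)" by (rule r_dom[OF gk(1)])
        also have "a n * nrm (g + k) \<le> a n * c" using a(1)[of n] c(2) by (intro mult_left_mono) auto
        also have "a n * c < e / 2" using N[OF that] c(1) by (simp add: field_simps)
        finally show ?thesis by simp
      qed
      then show "\<exists>N. \<forall>n\<ge>N. norm (nrm (r n f) - 0) < e" by blast
    qed
  qed
  then have "eigenbasis ip L \<psi> ev"
    unfolding r_def by unfold_locales (use unit' orth eig in auto)
  with nz mono fin show ?thesis by blast
qed

end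

section \<open>Balls, lattices and doubling measures\<close>

text \<open>A ball of radius \<open>r / 2\<close> holds at most one point of an
  \<open>r\<close>-separated set, so the size of a finite cover by such balls bounds all these sets
  at once.\<close>

lemma separated_finite_card:
  fixes F :: "'a::metric_space set"
  assumes c: "compact (UNIV :: 'a set)" and r: "0 < r"
  shows "\<exists>n. \<forall>F::'a set. (\<forall>x\<in>F. \<forall>y\<in>F. x \<noteq> y \<longrightarrow> r \<le> dist x y) \<longrightarrow> finite F \<and> card F \<le> n"
proof -
  obtain T where T: "finite T" "UNIV = (\<Union>t\<in>T. ball t (r / 2) :: 'a set)"
  proof -
    have "(UNIV :: 'a set) \<subseteq> (\<Union>t\<in>UNIV. ball t (r / 2))" using r by auto
    from compactE_image[OF c _ this] obtain T where "finite T" "UNIV \<subseteq> (\<Union>t\<in>T. ball t (r / 2) :: 'a set)"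
      by (metis open_ball)
    then show ?thesis using that by blast
  qed
  have "finite F \<and> card F \<le> card T" if F: "\<forall>x\<in>F. \<forall>y\<in>F. x \<noteq> y \<longrightarrow> r \<le> dist x y" for F :: "'a set"
  proof -
    have "\<forall>x. \<exists>t. t \<in> T \<and> dist t x < r / 2"
    proof
      fix x
      have "x \<in> (\<Union>t\<in>T. ball t (r / 2))" using T(2) by blast
      then show "\<exists>t. t \<in> T \<and> dist t x < r / 2" by auto
    qed
    then obtain h where h: "\<And>x. h x \<in> T" "\<And>x. dist (h x) x < r / 2" by metis
    have "inj_on h F"
    proof (rule inj_onI)
      fix x y assume "x \<in> F" "y \<in> F" "h x = h y"
      then show "x = y" using F h(2)[of x] h(2)[of y] dist_triangle2[of x y "h x"]
        by (force simp: dist_commute)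
    qed
    moreover have "h ` F \<subseteq> T" using h(1) by blast
    ultimately show ?thesis using T(1) by (meson inj_on_finite card_inj_on_le)
  qed
  then show ?thesis by blast
qed

text \<open>By the uniform bound there is a separated subset of greatest cardinality; a point left
  uncovered could be added to it. Used for the Vitali argument as well as for the existence of
  lattices.\<close>

lemma maximal_separated_subset:
  fixes S :: "'a::metric_space set"
  assumes c: "compact (UNIV :: 'a set)" and r: "0 < r"
  shows "\<exists>F. finite F \<and> F \<subseteq> S \<and> (\<forall>x\<in>F. \<forall>y\<in>F. x \<noteq> y \<longrightarrow> r \<le> dist x y) \<and> S \<subseteq> (\<Union>x\<in>F. ball x r)"
proof -
  define P where "P F \<longleftrightarrow> F \<subseteq> S \<and> (\<forall>x\<in>F. \<forall>y\<in>F. x \<noteq> y \<longrightarrow> r \<le> dist x y)" for F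
  from separated_finite_card[OF c r] obtain n where
    sepn: "\<forall>F::'a set. (\<forall>x\<in>F. \<forall>y\<in>F. x \<noteq> y \<longrightarrow> r \<le> dist x y) \<longrightarrow> finite F \<and> card F \<le> n"
    by (elim exE)
  have n: "finite F \<and> card F \<le> n" if "P F" for F
    using spec[OF sepn, of F] that by (simp add: P_def)
  have "P {}" by (simp add: P_def)
  then have "\<exists>F. P F \<and> (\<forall>G. P G \<longrightarrow> card G \<le> card F)"
    by (rule ex_has_greatest_nat[where b = "Suc n"]) (use n in \<open>auto simp: less_Suc_eq_le\<close>)
  then obtain F where F: "P F" and max: "\<And>G. P G \<Longrightarrow> card G \<le> card F" by blast
  have "x \<in> (\<Union>y\<in>F. ball y r)" if "x \<in> S" for x
  proof (rule ccontr)
    assume no: "x \<notin> (\<Union>y\<in>F. ball y r)"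
    then have "P (insert x F)" "x \<notin> F"
      using F that r unfolding P_def by (auto simp: dist_commute not_less)
    then show False using max[of "insert x F"] n[OF F] by auto
  qed
  then have "S \<subseteq> (\<Union>y\<in>F. ball y r)" by (rule subsetI)
  then show ?thesis using F n[OF F] unfolding P_def by (intro exI[of _ F]) simp
qed

lemma compact_radon_finite_measure:
  assumes "compact (UNIV :: 'a::metric_space set)" "radon_measure (M :: 'a measure)"
  shows "finite_measure M" "sets M = sets borel" "space M = UNIV"
proof -
  show s: "sets M = sets borel" using assms(2) by (simp add: radon_measure_def)
  then show sp: "space M = UNIV" using sets_eq_imp_space_eq by fastforce
  show "finite_measure M"
  proof (rule finite_measureI)
    have "emeasure M UNIV < \<infinity>" using assms unfolding radon_measure_def by blast
    then show "emeasure M (space M) \<noteq> \<infinity>" by (simp add: sp)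
  qed
qed

lemma set_integrable_of_integrable:
  fixes f :: "'a \<Rightarrow> real"
  assumes "integrable M f" "A \<in> sets M"
  shows "set_integrable M A f"
  unfolding set_integrable_def by (rule integrable_mult_indicator[OF assms(2,1)])

text \<open>Suppose \<open>g \<le> - e\<close> on a compact \<open>K\<close> of positive measure.
  Disjoint small balls centred in \<open>K\<close> have a union \<open>B\<close> of measure at least
  \<open>measure M K / 2 powr D\<close>, while \<open>B - K\<close> lies in a thin shell around
  \<open>K\<close> that contributes arbitrarily little. The integral of \<open>g\<close> over
  \<open>B\<close> is then negative, although it is a sum of non-negative ball integrals.\<close>

lemma AE_nonneg_if_ball_integrals_nonneg:
  fixes M :: "'a::metric_space measure" and g :: "'a \<Rightarrow> real"
  assumes c: "compact (UNIV :: 'a set)" and rad: "radon_measure M" and dbl: "doubling M"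
    and g: "integrable M g" and r0: "0 < r0"
    and balls: "\<And>x r. 0 < r \<Longrightarrow> r < r0 \<Longrightarrow> 0 \<le> (LINT y:ball x r|M. g y)"
  shows "AE x in M. 0 \<le> g x"
proof -
  interpret finite_measure M using compact_radon_finite_measure[OF c rad] by simp
  have setsM: "sets M = sets borel" and sp: "space M = UNIV"
    using compact_radon_finite_measure[OF c rad] by auto
  have [measurable]: "g \<in> borel_measurable M" using g by auto
  obtain D where D: "0 < D" and doub: "\<And>x r. 0 < r \<Longrightarrow> measure M (ball x (2 * r)) \<le> 2 powr D * measure M (ball x r)"
    using dbl unfolding doubling_def by blast
  have bset[measurable]: "ball x r \<in> sets M" for x r using setsM by simp
  have lev: "{x. g x \<le> s} \<in> sets M" for s
  proof -
    have "{x \<in> space M. g x \<le> s} \<in> sets M" by measurable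
    then show ?thesis by (simp add: sp)
  qed
  have null: "emeasure M {x. g x \<le> - e} = 0" if e: "0 < e" for e
  proof (rule ccontr)
    assume "emeasure M {x. g x \<le> - e} \<noteq> 0"
    moreover have "{x. g x \<le> - e} \<in> sets M" by (rule lev)
    ultimately have "0 < (SUP K\<in>{K. compact K \<and> K \<subseteq> {x. g x \<le> - e}}. emeasure M K)"
      using rad unfolding radon_measure_def by (metis zero_less_iff_neq_zero)
    then obtain K where K: "compact K" "K \<subseteq> {x. g x \<le> - e}" "0 < emeasure M K"
      by (auto simp: less_SUP_iff)
    have Kcl: "closed K" using K(1) by (rule compact_imp_closed)
    have Km[measurable]: "K \<in> sets M" using Kcl setsM by simp
    have Kpos: "0 < measure M K" using K(3) by (simp add: emeasure_eq_measure)
    have Kne: "K \<noteq> {}" using K(3) by auto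
    define U where "U n = {x. infdist x K < 1 / Suc n}" for n
    have Uop: "open (U n)" for n
      unfolding U_def by (intro open_Collect_less continuous_intros)
    have Um[measurable]: "U n \<in> sets M" for n using Uop setsM by simp
    \<comment> \<open>With the extra \<open>e\<close>, the inequality \<open>g \<le> h - e\<close>
      also holds on the part of \<open>B\<close> outside \<open>K\<close>, so that
      \<open>e * measure M B\<close> can be split off over all of \<open>B\<close>.\<close>
    define h where "h x = \<bar>g x\<bar> + e" for x
    have hi: "integrable M h" unfolding h_def using g by auto
    have [measurable]: "h \<in> borel_measurable M" using hi by auto
    have lim: "(\<lambda>n. LINT x|M. indicator (U n - K) x * h x) \<longlonglongrightarrow> (LINT x|M. 0)"
    proof (rule integral_dominated_convergence[where w = h])
      show "AE x in M. (\<lambda>n. indicator (U n - K) x * h x) \<longlonglongrightarrow> 0"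
      proof (intro AE_I2)
        fix x
        show "(\<lambda>n. indicator (U n - K) x * h x) \<longlonglongrightarrow> 0"
        proof (cases "x \<in> K")
          case False
          then have "0 < infdist x K"
            using infdist_pos_not_in_closed[OF Kcl Kne] by simp
          then obtain N where N: "1 / real (Suc N) < infdist x K"
            using nat_approx_posE by blast
          have "x \<notin> U n" if "N \<le> n" for n
          proof -
            have "1 / real (Suc n) \<le> 1 / real (Suc N)" using that by (simp add: field_simps)
            then show ?thesis using N by (simp add: U_def)
          qed
          then have "\<forall>\<^sub>F n in sequentially. indicator (U n - K) x * h x = 0"
            unfolding eventually_sequentially by (intro exI[of _ N]) (simp add: indicator_def)
          then show ?thesis by (rule tendsto_eventually)
        qed simp
      qed
      show "AE x in M. norm (indicator (U n - K) x * h x) \<le> h x" for n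
        using e by (intro AE_I2) (auto simp: indicator_def h_def)
    qed (use hi in auto)
    \<comment> \<open>The lower bound for \<open>e * measure M B\<close> that doubling will provide;
      the shell integral is made smaller than this.\<close>
    define \<kappa> where "\<kappa> = e * (measure M K / 2 powr D)"
    have "0 < \<kappa>" using Kpos e by (simp add: \<kappa>_def)
    with order_tendstoD(2)[OF lim, of \<kappa>] obtain n
      where n: "(LINT x|M. indicator (U n - K) x * h x) < \<kappa>" by (auto simp: eventually_sequentially)
    \<comment> \<open>Small enough for the hypothesis on balls and for the balls to stay inside
      \<open>U n\<close>. Centres are taken \<open>2 * r\<close> apart: balls of radius
      \<open>r\<close> are then disjoint while the doubled balls cover \<open>K\<close>.\<close>
    define r where "r = min (r0 / 2) (1 / Suc n)"
    have r: "0 < r" "r < r0" "r \<le> 1 / Suc n" using r0 by (auto simp: r_def)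
    have "0 < 2 * r" using r(1) by simp
    from maximal_separated_subset[OF c this, of K] obtain F where F: "finite F" "F \<subseteq> K"
      and sep: "\<forall>x\<in>F. \<forall>y\<in>F. x \<noteq> y \<longrightarrow> 2 * r \<le> dist x y" and cov: "K \<subseteq> (\<Union>x\<in>F. ball x (2 * r))"
      by (elim exE conjE)
    define B where "B = (\<Union>x\<in>F. ball x r)"
    have Bm[measurable]: "B \<in> sets M" unfolding B_def using F(1) by auto
    have BU: "B \<subseteq> U n"
    proof
      fix y assume "y \<in> B"
      then obtain x where "x \<in> K" "dist x y < r" using F(2) unfolding B_def by auto
      then show "y \<in> U n" using infdist_le[of x K y] r(3) by (simp add: U_def dist_commute)
    qed
    have disj: "disjoint_family_on (\<lambda>x. ball x r) F"
      unfolding disjoint_family_on_def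
    proof (intro ballI impI equals0I)
      fix x y z assume "x \<in> F" "y \<in> F" "x \<noteq> y" "z \<in> ball x r \<inter> ball y r"
      then show False using sep dist_triangle2[of x y z] by (fastforce simp: dist_commute)
    qed
    have meas: "measure M K / 2 powr D \<le> measure M B"
    proof -
      have "measure M K \<le> measure M (\<Union>x\<in>F. ball x (2 * r))"
        by (rule finite_measure_mono[OF cov]) (use F(1) in auto)
      also have "\<dots> \<le> (\<Sum>x\<in>F. measure M (ball x (2 * r)))"
        using F(1) by (intro finite_measure_subadditive_finite) auto
      also have "\<dots> \<le> (\<Sum>x\<in>F. 2 powr D * measure M (ball x r))"
        by (intro sum_mono doub r(1))
      also have "\<dots> = 2 powr D * measure M B"
        unfolding B_def using F(1) disj
        by (subst finite_measure_finite_Union) (auto simp: sum_distrib_left)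
      finally show ?thesis by (simp add: field_simps)
    qed
    have "0 \<le> (\<Sum>x\<in>F. LINT y:ball x r|M. g y)" using balls[OF r(1,2)] by (intro sum_nonneg)
    also have "\<dots> = (LINT y:B|M. g y)"
      unfolding B_def using F(1) disj g
      by (intro set_integral_finite_Union[symmetric]) (auto simp: set_integrable_of_integrable)
    also have "\<dots> = (LINT x|M. indicator B x * g x)" by (simp add: set_lebesgue_integral_def)
    also have "\<dots> \<le> (LINT x|M. indicator (U n - K) x * h x - e * indicator B x)"
    proof (rule integral_mono)
      show "integrable M (\<lambda>x. indicator B x * g x)"
        using integrable_mult_indicator[OF Bm g] by simp
      show "integrable M (\<lambda>x. indicator (U n - K) x * h x - e * indicator B x)"
        using integrable_mult_indicator[OF _ hi, of "U n - K"]
        by (intro Bochner_Integration.integrable_diff integrable_mult_right integrable_real_indicator)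
          (auto simp: emeasure_eq_measure)
      fix x
      show "indicator B x * g x \<le> indicator (U n - K) x * h x - e * indicator B x"
        using BU K(2) e by (auto simp: indicator_def h_def)
    qed
    also have "\<dots> = (LINT x|M. indicator (U n - K) x * h x) - e * measure M B"
      using integrable_mult_indicator[OF _ hi, of "U n - K"]
      by (subst Bochner_Integration.integral_diff) (auto simp: emeasure_eq_measure)
    also have "\<dots> < \<kappa> - e * measure M B" using n by simp
    also have "\<dots> \<le> 0" using mult_left_mono[OF meas, of e] e unfolding \<kappa>_def by simp
    finally show False by simp
  qed
  have "AE x in M. \<forall>n. - (1 / real (Suc n)) < g x"
  proof (subst AE_all_countable, intro allI AE_I)
    fix n
    show "{x \<in> space M. \<not> - (1 / real (Suc n)) < g x} \<subseteq> {x. g x \<le> - (1 / Suc n)}" by auto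
    show "emeasure M {x. g x \<le> - (1 / Suc n)} = 0" by (rule null) simp
    show "{x. g x \<le> - (1 / Suc n)} \<in> sets M" by (rule lev)
  qed
  then show ?thesis
  proof eventually_elim
    case (elim x)
    have "(\<lambda>n. - (1 / real (Suc n))) \<longlonglongrightarrow> - 0" by (intro tendsto_intros LIMSEQ_Suc[OF lim_1_over_n])
    then show ?case using elim by (intro LIMSEQ_le_const2[where a = "g x", of "\<lambda>n. - (1 / real (Suc n))", simplified]) (auto intro: less_imp_le)
  qed
qed

lemma metric_lattice_finite:
  fixes S :: "'a::metric_space set"
  assumes c: "compact (UNIV :: 'a set)" and S: "metric_lattice r N S" and r: "0 < r"
  shows "finite S"
proof -
  have "r / 2 \<le> dist x y" if "x \<in> S" "y \<in> S" "x \<noteq> y" for x y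
  proof (rule ccontr)
    assume "\<not> ?thesis"
    then have "y \<in> ball x (r / 2) \<inter> ball y (r / 2)" using r by simp
    then show False using S that unfolding metric_lattice_def disjoint_family_on_def by blast
  qed
  then show ?thesis using separated_finite_card[OF c, of "r/2"] r by fastforce
qed

text \<open>If balls of radius \<open>r\<close> around the points of \<open>J\<close> all contain
  \<open>x\<close>, their disjoint cores of radius \<open>r / 2\<close> lie in
  \<open>ball x (2 * r)\<close>, and each has at least the fraction \<open>1 / Q ^ 3\<close> of its
  measure: three doublings lead from \<open>r / 2\<close> to \<open>4 * r\<close>. The multiplicity
  bound is therefore independent of \<open>r\<close>.\<close>

lemma metric_lattice_exists:
  fixes M :: "'a::metric_space measure"
  assumes c: "compact (UNIV :: 'a set)" and rad: "radon_measure M" and dbl: "doubling M"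
  shows "\<exists>N. \<forall>r>0. \<exists>S :: 'a set. metric_lattice r N S"
proof -
  interpret finite_measure M using compact_radon_finite_measure[OF c rad] by simp
  have [measurable]: "ball x r \<in> sets M" for x r
    using compact_radon_finite_measure[OF c rad] by simp
  obtain D where D: "0 < D" and mpos: "\<And>x r. 0 < r \<Longrightarrow> 0 < measure M (ball x (2 * r))"
    and doub: "\<And>x r. 0 < r \<Longrightarrow> measure M (ball x (2 * r)) \<le> 2 powr D * measure M (ball x r)"
    using dbl unfolding doubling_def by blast
  define Q where "Q = 2 powr D"
  have Q: "0 < Q" by (simp add: Q_def)
  have "\<exists>S :: 'a set. metric_lattice r (nat \<lceil>Q ^ 3\<rceil>) S" if r: "0 < r" for r
  proof -
    from maximal_separated_subset[OF c r, of UNIV] obtain S :: "'a set" where S: "finite S"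
      and sep: "\<forall>x\<in>S. \<forall>y\<in>S. x \<noteq> y \<longrightarrow> r \<le> dist x y" and cov: "UNIV \<subseteq> (\<Union>x\<in>S. ball x r)"
      by (elim exE conjE)
    have disj: "disjoint_family_on (\<lambda>p. ball p (r / 2)) S"
      unfolding disjoint_family_on_def
    proof (intro ballI impI equals0I)
      fix x y z assume "x \<in> S" "y \<in> S" "x \<noteq> y" "z \<in> ball x (r / 2) \<inter> ball y (r / 2)"
      then show False using sep dist_triangle2[of x y z] by (fastforce simp: dist_commute)
    qed
    have "card {p \<in> S. x \<in> ball p r} \<le> nat \<lceil>Q ^ 3\<rceil>" for x
    proof -
      define J where "J = {p \<in> S. x \<in> ball p r}"
      have J: "finite J" "J \<subseteq> S" using S by (auto simp: J_def)
      let ?m = "measure M (ball x (2 * r))"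
      have "?m \<le> Q ^ 3 * measure M (ball p (r / 2))" if "p \<in> J" for p
      proof -
        have "ball x (2 * r) \<subseteq> ball p (2 * (2 * r))"
        proof
          fix y assume "y \<in> ball x (2 * r)"
          then show "y \<in> ball p (2 * (2 * r))"
            using that dist_triangle[of p y x] r by (auto simp: J_def)
        qed
        then have "?m \<le> measure M (ball p (2 * (2 * r)))" by (intro finite_measure_mono) auto
        also have "\<dots> \<le> Q * measure M (ball p (2 * r))" unfolding Q_def using r by (intro doub) simp
        also have "\<dots> \<le> Q * (Q * measure M (ball p r))"
          using Q doub[of r p] r by (intro mult_left_mono) (auto simp: Q_def)
        also have "\<dots> \<le> Q * (Q * (Q * measure M (ball p (r / 2))))"
          using Q doub[of "r / 2" p] r by (intro mult_left_mono) (auto simp: Q_def)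
        finally show ?thesis by (simp add: power3_eq_cube mult.assoc)
      qed
      then have "(\<Sum>p\<in>J. ?m) \<le> (\<Sum>p\<in>J. Q ^ 3 * measure M (ball p (r / 2)))" by (intro sum_mono)
      also have "\<dots> = Q ^ 3 * measure M (\<Union>p\<in>J. ball p (r / 2))"
        using J disjoint_family_on_mono[OF J(2) disj]
        by (subst finite_measure_finite_Union) (auto simp: sum_distrib_left)
      also have "\<dots> \<le> Q ^ 3 * ?m"
      proof (intro mult_left_mono finite_measure_mono subsetI)
        fix y assume "y \<in> (\<Union>p\<in>J. ball p (r / 2))"
        then obtain p where "dist p x < r" "dist p y < r / 2" by (auto simp: J_def)
        then show "y \<in> ball x (2 * r)" using dist_triangle2[of x y p] r by (simp add: dist_commute)
      qed (use Q in auto)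
      finally have "real (card J) * ?m \<le> Q ^ 3 * ?m" by simp
      then have "real (card J) \<le> Q ^ 3" using mpos[OF r, of x] by simp
      then show ?thesis unfolding J_def by linarith
    qed
    then have "metric_lattice r (nat \<lceil>Q ^ 3\<rceil>) S"
      using S disj cov unfolding metric_lattice_def by auto
    then show ?thesis ..
  qed
  then show ?thesis by blast
qed

section \<open>Square integrable functions\<close>

text \<open>Turns the type of all real functions into a real vector space, the carrier on which the
  abstract locales are interpreted.\<close>

instantiation "fun" :: (type, real_vector) real_vector
begin

definition scaleR_fun :: "real \<Rightarrow> ('a \<Rightarrow> 'b) \<Rightarrow> 'a \<Rightarrow> 'b" where
  "scaleR_fun c f = (\<lambda>x. c *\<^sub>R f x)"

instance
  by standard (auto simp: scaleR_fun_def fun_eq_iff scaleR_add_right scaleR_add_left)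

end

lemma scaleR_fun_apply [simp]: "(c *\<^sub>R f) x = c *\<^sub>R f x"
  by (simp add: scaleR_fun_def)

lemma sum_fun_apply: "(\<Sum>i\<in>S. f i) x = (\<Sum>i\<in>S. f i x)"
  by (induction S rule: infinite_finite_induct) auto

text \<open>A weighted Young inequality. On a finite measure space it passes from square norms to
  integrals of absolute values; the weight \<open>q\<close> is tuned to the size of
  \<open>d\<close>.\<close>

lemma abs_le_inverse_plus_square:
  fixes d q :: real
  assumes "0 < q"
  shows "\<bar>d\<bar> \<le> 1 / q + q * d\<^sup>2"
proof -
  have "0 \<le> (1 - q * \<bar>d\<bar>)\<^sup>2" by simp
  also have "\<dots> = 1 - 2 * (q * \<bar>d\<bar>) + q * (q * d\<^sup>2)"
    by (simp add: power2_diff power_mult_distrib) (simp add: power2_eq_square)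
  finally have "2 * (q * \<bar>d\<bar>) \<le> 1 + q * (q * d\<^sup>2)" by simp
  moreover have "0 \<le> q * \<bar>d\<bar>" using assms by simp
  ultimately have "q * \<bar>d\<bar> \<le> 1 + q * (q * d\<^sup>2)" by linarith
  also have "\<dots> = q * (1 / q + q * d\<^sup>2)" using assms by (simp add: distrib_left)
  finally show ?thesis using assms by simp
qed

lemma integrable_mult_l2:
  assumes "f \<in> l2 M" "g \<in> l2 M"
  shows "integrable M (\<lambda>x. f x * g x)"
proof (rule Bochner_Integration.integrable_bound)
  show "integrable M (\<lambda>x. (f x)\<^sup>2 + (g x)\<^sup>2)" using assms by (simp add: l2_def)
  show "(\<lambda>x. f x * g x) \<in> borel_measurable M" using assms by (intro borel_measurable_times) (auto simp: l2_def)
  have "\<bar>a * b\<bar> \<le> a\<^sup>2 + b\<^sup>2" for a b :: real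
    using zero_le_power2[of "a - b"] zero_le_power2[of "a + b"] by (simp add: power2_eq_square algebra_simps abs_le_iff)
  then show "AE x in M. norm (f x * g x) \<le> norm ((f x)\<^sup>2 + (g x)\<^sup>2)" by simp
qed

lemma l2_add: "f \<in> l2 M \<Longrightarrow> g \<in> l2 M \<Longrightarrow> f + g \<in> l2 M"
  using integrable_mult_l2[of f M g] by (auto simp: l2_def power2_sum plus_fun_def mult.assoc)

lemma l2_scale: "f \<in> l2 M \<Longrightarrow> c *\<^sub>R f \<in> l2 M"
  by (auto simp: l2_def scaleR_fun_def power_mult_distrib)

lemma subspace_l2: "subspace (l2 M)"
  by (rule subspaceI) (auto simp: l2_add l2_scale, simp add: l2_def zero_fun_def)

lemma l2_diff: "f \<in> l2 M \<Longrightarrow> g \<in> l2 M \<Longrightarrow> f - g \<in> l2 M"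
  using subspace_l2 by (rule subspace_diff)

lemma l2_inner_cong_AE:
  assumes "f \<in> borel_measurable M" "f' \<in> borel_measurable M" "AE x in M. f x = f' x"
    "g \<in> borel_measurable M" "g' \<in> borel_measurable M" "AE x in M. g x = g' x"
  shows "l2_inner M f g = l2_inner M f' g'"
  unfolding l2_inner_def using assms by (intro integral_cong_AE) auto

lemma l2_norm_eq_0_iff:
  assumes "f \<in> l2 M"
  shows "l2_norm M f = 0 \<longleftrightarrow> (AE x in M. f x = 0)"
proof -
  have "(LINT x|M. (f x)\<^sup>2) = 0 \<longleftrightarrow> (AE x in M. (f x)\<^sup>2 = 0)"
    using assms by (intro integral_nonneg_eq_0_iff_AE) (auto simp: l2_def)
  then show ?thesis by (simp add: l2_norm_def l2_inner_def power2_eq_square)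
qed

context finite_measure
begin

lemma integrable_l2:
  assumes "f \<in> l2 M"
  shows "integrable M f"
proof -
  have "(\<lambda>_. 1) \<in> l2 M" by (simp add: l2_def)
  from integrable_mult_l2[OF assms this] show ?thesis by simp
qed

lemma indicator_l2:
  assumes "A \<in> sets M"
  shows "(\<lambda>x. c * indicator A x) \<in> l2 M"
proof -
  have "(\<lambda>x. (c * indicator A x)\<^sup>2) = (\<lambda>x. c\<^sup>2 * indicator A x)" by (auto simp: indicator_def)
  then show ?thesis using assms by (simp add: l2_def emeasure_eq_measure)
qed

text \<open>Riesz--Fischer; a rapidly convergent subsequence converges almost everywhere.\<close>

lemma l2_complete:
  assumes x: "\<And>n. x n \<in> l2 M"
    and cauchy: "\<And>e. 0 < e \<Longrightarrow> \<exists>N. \<forall>m\<ge>N. \<forall>n\<ge>N. l2_norm M (x m - x n) < e"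
  shows "\<exists>l\<in>l2 M. (\<lambda>n. l2_norm M (x n - l)) \<longlonglongrightarrow> 0"
proof -
  have xm[measurable]: "x n \<in> borel_measurable M" for n using x by (simp add: l2_def)
  have "\<exists>N. \<forall>k. \<forall>m\<ge>N k. \<forall>n\<ge>N k. l2_norm M (x m - x n) < (1/2) ^ k"
    using cauchy by (intro choice allI) (meson zero_less_power half_gt_zero zero_less_one)
  then obtain N where N: "\<And>k m n. m \<ge> N k \<Longrightarrow> n \<ge> N k \<Longrightarrow> l2_norm M (x m - x n) < (1/2) ^ k" by blast
  \<comment> \<open>The maximum makes \<open>r j\<close> at least \<open>N k\<close> for every
    \<open>k \<le> j\<close>, although \<open>N\<close> need not be monotone.\<close>
  define r where "r k = k + Max (N ` {..k})" for k
  have rN: "N k \<le> r j" if "k \<le> j" for k j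
    using Max_ge[of "N ` {..j}" "N k"] that by (simp add: r_def trans_le_add2)
  define y where "y k = x (r k)" for k
  have ym[measurable]: "y n \<in> borel_measurable M" for n by (simp add: y_def)
  have sq: "(\<integral>\<^sup>+t. ennreal ((f t)\<^sup>2) \<partial>M) = ennreal ((l2_norm M f)\<^sup>2)" if "f \<in> l2 M" for f
  proof -
    have "0 \<le> l2_inner M f f" unfolding l2_inner_def by (intro integral_nonneg_AE) auto
    then have "(l2_norm M f)\<^sup>2 = (LINT t|M. (f t)\<^sup>2)" by (simp add: l2_norm_def l2_inner_def power2_eq_square)
    then show ?thesis using that by (subst nn_integral_eq_integral) (auto simp: l2_def)
  qed
  \<comment> \<open>Young's inequality with weight \<open>2 ^ k\<close>: the constant part gives
    \<open>measure M (space M)\<close> times \<open>(1/2) ^ k\<close>, and the square norm, at most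
    \<open>(1/4) ^ k\<close>, gives another \<open>(1/2) ^ k\<close>.\<close>
  have step: "(\<integral>\<^sup>+t. ennreal \<bar>y (Suc k) t - y k t\<bar> \<partial>M) \<le> ennreal ((measure M (space M) + 1) * (1/2) ^ k)" for k
  proof -
    let ?d = "\<lambda>t. y (Suc k) t - y k t"
    have d2: "?d \<in> l2 M" using l2_diff[OF x x, of "r (Suc k)" "r k"] by (simp add: y_def fun_diff_def)
    have "l2_norm M ?d \<le> (1/2) ^ k"
      using N[of k "r (Suc k)" "r k"] rN[of k] by (simp add: y_def fun_diff_def)
    moreover have "0 \<le> l2_norm M ?d"
      unfolding l2_norm_def l2_inner_def by (auto intro!: integral_nonneg_AE)
    ultimately have n2: "(l2_norm M ?d)\<^sup>2 \<le> ((1/2) ^ k)\<^sup>2" by (intro power_mono)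
    have "(\<integral>\<^sup>+t. ennreal \<bar>?d t\<bar> \<partial>M) \<le> (\<integral>\<^sup>+t. ennreal ((1/2) ^ k) + ennreal (2 ^ k) * ennreal ((?d t)\<^sup>2) \<partial>M)"
    proof (rule nn_integral_mono)
      fix t
      have "\<bar>?d t\<bar> \<le> (1/2) ^ k + 2 ^ k * (?d t)\<^sup>2"
        using abs_le_inverse_plus_square[of "2 ^ k" "?d t"] by (simp add: power_one_over)
      then show "ennreal \<bar>?d t\<bar> \<le> ennreal ((1/2) ^ k) + ennreal (2 ^ k) * ennreal ((?d t)\<^sup>2)"
        by (simp add: ennreal_leI flip: ennreal_plus ennreal_mult)
    qed
    also have "\<dots> = ennreal ((1/2) ^ k) * emeasure M (space M) + ennreal (2 ^ k) * ennreal ((l2_norm M ?d)\<^sup>2)"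
      using sq[OF d2] by (subst nn_integral_add) (auto simp: nn_integral_cmult)
    also have "\<dots> = ennreal ((1/2) ^ k * measure M (space M) + 2 ^ k * (l2_norm M ?d)\<^sup>2)"
      by (simp add: emeasure_eq_measure flip: ennreal_plus ennreal_mult)
    also have "\<dots> \<le> ennreal ((measure M (space M) + 1) * (1/2) ^ k)"
    proof (rule ennreal_leI)
      have "2 ^ k * (l2_norm M ?d)\<^sup>2 \<le> 2 ^ k * ((1/2) ^ k)\<^sup>2" using n2 by (intro mult_left_mono) auto
      also have "\<dots> = (1/2) ^ k" by (simp add: power2_eq_square field_simps)
      finally show "(1/2) ^ k * measure M (space M) + 2 ^ k * (l2_norm M ?d)\<^sup>2 \<le> (measure M (space M) + 1) * (1/2) ^ k"
        by (simp add: algebra_simps)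
    qed
    finally show ?thesis .
  qed
  have "(\<integral>\<^sup>+t. (\<Sum>k. ennreal \<bar>y (Suc k) t - y k t\<bar>) \<partial>M) = (\<Sum>k. \<integral>\<^sup>+t. ennreal \<bar>y (Suc k) t - y k t\<bar> \<partial>M)"
    by (rule nn_integral_suminf) simp
  also have "\<dots> \<le> (\<Sum>k. ennreal ((measure M (space M) + 1) * (1/2) ^ k))"
    by (intro suminf_le step) auto
  also have "\<dots> < \<infinity>"
    by (subst suminf_ennreal2) (auto intro: summable_mult)
  finally have "AE t in M. (\<Sum>k. ennreal \<bar>y (Suc k) t - y k t\<bar>) \<noteq> \<infinity>"
    by (intro nn_integral_PInf_AE) auto
  then have conv: "AE t in M. convergent (\<lambda>k. y k t)"
  proof eventually_elim
    case (elim t)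
    then have "summable (\<lambda>k. \<bar>y (Suc k) t - y k t\<bar>)" by (intro summable_suminf_not_top) auto
    then have "summable (\<lambda>k. y (Suc k) t - y k t)" by (rule summable_rabs_cancel)
    then have "convergent (\<lambda>n. y n t - y 0 t)"
      unfolding summable_iff_convergent sum_lessThan_telescope[of "\<lambda>k. y k t"] .
    then have "convergent (\<lambda>n. (y n t - y 0 t) + y 0 t)"
      by (intro convergent_add convergent_const)
    then show ?case by simp
  qed
  define l where "l t = lim (\<lambda>k. y k t)" for t
  have lm[measurable]: "l \<in> borel_measurable M"
    unfolding l_def by (rule borel_measurable_lim_metric) simp
  have lim: "AE t in M. (\<lambda>k. y k t) \<longlonglongrightarrow> l t"
    using conv by eventually_elim (simp add: l_def convergent_LIMSEQ_iff)
  \<comment> \<open>Fatou's lemma along the subsequence with \<open>n\<close> held fixed, so the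
    Cauchy estimate passes to the limit and covers the whole sequence.\<close>
  have bound: "(\<integral>\<^sup>+t. ennreal ((x n t - l t)\<^sup>2) \<partial>M) \<le> ennreal (((1/2) ^ k)\<^sup>2)" if n: "N k \<le> n" for k n
  proof -
    have "(\<integral>\<^sup>+t. ennreal ((x n t - l t)\<^sup>2) \<partial>M) = (\<integral>\<^sup>+t. liminf (\<lambda>j. ennreal ((x n t - y j t)\<^sup>2)) \<partial>M)"
    proof (rule nn_integral_cong_AE)
      show "AE t in M. ennreal ((x n t - l t)\<^sup>2) = liminf (\<lambda>j. ennreal ((x n t - y j t)\<^sup>2))"
        using lim
      proof eventually_elim
        case (elim t)
        then have "(\<lambda>j. ennreal ((x n t - y j t)\<^sup>2)) \<longlonglongrightarrow> ennreal ((x n t - l t)\<^sup>2)"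
          by (intro tendsto_intros)
        then show ?case by (rule lim_imp_Liminf[OF sequentially_bot, symmetric])
      qed
    qed
    also have "\<dots> \<le> liminf (\<lambda>j. \<integral>\<^sup>+t. ennreal ((x n t - y j t)\<^sup>2) \<partial>M)"
      by (rule nn_integral_liminf) simp
    also have "\<dots> \<le> liminf (\<lambda>j. ennreal (((1/2) ^ k)\<^sup>2))"
    proof (rule Liminf_mono)
      show "\<forall>\<^sub>F j in sequentially. (\<integral>\<^sup>+t. ennreal ((x n t - y j t)\<^sup>2) \<partial>M) \<le> ennreal (((1/2) ^ k)\<^sup>2)"
        using eventually_ge_at_top[of k]
      proof eventually_elim
        case (elim j)
        have "l2_norm M (x n - y j) < (1/2) ^ k" using N[OF n rN[OF elim]] by (simp add: y_def)
        moreover have "0 \<le> l2_norm M (x n - y j)"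
          unfolding l2_norm_def l2_inner_def by (auto intro!: integral_nonneg_AE)
        ultimately have "(l2_norm M (x n - y j))\<^sup>2 \<le> ((1/2) ^ k)\<^sup>2" by (intro power_mono) auto
        then show ?case using sq[OF l2_diff[OF x x, of n "r j"]] by (simp add: y_def ennreal_leI)
      qed
    qed
    finally show ?thesis by (simp add: Liminf_const)
  qed
  have diff: "x n - l \<in> l2 M" if "N k \<le> n" for k n
  proof -
    have "(\<integral>\<^sup>+t. ennreal (norm ((x n t - l t)\<^sup>2)) \<partial>M) < \<infinity>"
      using order.strict_trans1[OF bound[OF that]] by simp
    then have "integrable M (\<lambda>t. (x n t - l t)\<^sup>2)" by (intro integrableI_bounded) auto
    then show ?thesis by (simp add: l2_def fun_diff_def)
  qed
  have "x (N 0) - (x (N 0) - l) = l" by simp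
  then have l2l: "l \<in> l2 M" using l2_diff[OF x[of "N 0"] diff[of 0 "N 0"]] by simp
  have "(\<lambda>n. l2_norm M (x n - l)) \<longlonglongrightarrow> 0"
  proof (rule LIMSEQ_I)
    fix e :: real assume "0 < e"
    then obtain k where k: "(1/2) ^ k < e" using real_arch_pow_inv[of e "1/2"] by auto
    have "norm (l2_norm M (x n - l) - 0) < e" if n: "N k \<le> n" for n
    proof -
      have nn: "0 \<le> l2_norm M (x n - l)"
        unfolding l2_norm_def l2_inner_def by (auto intro!: integral_nonneg_AE)
      have "ennreal ((l2_norm M (x n - l))\<^sup>2) \<le> ennreal (((1/2) ^ k)\<^sup>2)"
        using bound[OF n] sq[OF diff[OF n]] by simp
      then have "(l2_norm M (x n - l))\<^sup>2 \<le> ((1/2) ^ k)\<^sup>2" by simp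
      then have "l2_norm M (x n - l) \<le> (1/2) ^ k" by (rule power2_le_imp_le) simp
      then show ?thesis using nn k by simp
    qed
    then show "\<exists>N. \<forall>n\<ge>N. norm (l2_norm M (x n - l) - 0) < e" by blast
  qed
  with l2l show ?thesis by blast
qed

end

text \<open>More than \<open>n\<close> independent vectors would have a non-trivial combination
  annihilated by all \<open>n\<close> functionals. This bounds the dimension of the whole space, of
  eigenspaces and of Paley-Wiener spaces.\<close>

lemma l2_dim_le:
  assumes V: "subspace V" "V \<subseteq> l2 M"
    and null: "\<And>f. f \<in> V \<Longrightarrow> (\<And>i. i < n \<Longrightarrow> l2_inner M f (g i) = 0) \<Longrightarrow> AE x in M. f x = 0"
    and g: "\<And>i. i < n \<Longrightarrow> g i \<in> l2 M"
  shows "l2_dim M V \<le> enat n"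
  unfolding l2_dim_def
proof (rule SUP_least, clarify)
  fix B assume B: "finite B" "B \<subseteq> V" and ind: "ae_independent M B"
  have "card B \<le> n"
  proof (rule ccontr)
    assume "\<not> ?thesis"
    then have "n < card B" by simp
    from underdetermined_system[OF B(1) this, of "\<lambda>i b. l2_inner M b (g i)"] obtain c
      where c: "\<exists>b\<in>B. c b \<noteq> 0" and c0: "\<And>i. i < n \<Longrightarrow> (\<Sum>b\<in>B. c b * l2_inner M b (g i)) = 0" by blast
    define f where "f = (\<Sum>b\<in>B. c b *\<^sub>R b)"
    have f_eq: "f x = (\<Sum>b\<in>B. c b * b x)" for x by (simp add: f_def sum_fun_apply)
    have "f \<in> V" unfolding f_def using V(1) B(2) by (intro subspace_sum subspace_scale) auto
    moreover have "l2_inner M f (g i) = 0" if "i < n" for i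
    proof -
      have "l2_inner M f (g i) = (LINT x|M. (\<Sum>b\<in>B. c b * (b x * g i x)))"
        by (simp add: l2_inner_def f_eq sum_distrib_right mult.assoc)
      also have "\<dots> = (\<Sum>b\<in>B. c b * l2_inner M b (g i))"
        using B(2) V(2) g[OF that]
        by (subst Bochner_Integration.integral_sum) (auto simp: l2_inner_def intro!: integrable_mult_right integrable_mult_l2)
      finally show ?thesis using c0[OF that] by simp
    qed
    ultimately have "AE x in M. (\<Sum>b\<in>B. c b * b x) = 0" using null by (simp add: f_eq[symmetric])
    with ind c show False unfolding ae_independent_def by blast
  qed
  then show "enat (card B) \<le> enat n" by simp
qed

text \<open>On a ball, subtracting the mean lowers the integral of the square by exactly the squared
  integral of \<open>f\<close> divided by the measure of the ball, which is the squared inner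
  product with the indicator normalized in L2. Covering bounds the norm from above by the balls, and
  multiplicity bounds the sum of the integrals of \<open>g\<close>.\<close>

lemma l2_lattice_bound:
  fixes f g :: "'a::metric_space \<Rightarrow> real"
  assumes fin: "finite_measure M"
    and S: "finite S" "(\<Union>p\<in>S. ball p r) = UNIV" "\<And>x. card {p \<in> S. x \<in> ball p r} \<le> N"
    and ball: "\<And>p. ball p r \<in> sets M" "\<And>p. 0 < measure M (ball p r)"
    and f: "f \<in> l2 M" and g: "integrable M g" "AE x in M. 0 \<le> g x" and K: "0 \<le> K"
    and poin: "\<And>p. (LINT y:ball p r|M. \<bar>f y - ball_mean M f p r\<bar>\<^sup>2) \<le> K * (LINT y:ball p r|M. g y)"
  shows "l2_inner M f f \<le> K * N * (LINT x|M. g x)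
    + (\<Sum>p\<in>S. (l2_inner M f (\<lambda>x. 1 / sqrt (measure M (ball p r)) * indicator (ball p r) x))\<^sup>2)"
proof -
  interpret finite_measure M by (rule fin)
  let ?I = "\<lambda>p x. indicator (ball p r) x :: real"
  let ?F = "\<lambda>p. LINT x|M. ?I p x * f x"
  let ?m = "\<lambda>p. measure M (ball p r)"
  note [measurable] = ball(1)
  have fi: "integrable M f" using f by (rule integrable_l2)
  have f2: "integrable M (\<lambda>x. (f x)\<^sup>2)" using f by (simp add: l2_def)
  have Iint: "integrable M (\<lambda>x. ?I p x * h x)" if "integrable M h" for h p
    using integrable_mult_indicator[OF ball(1) that] by simp
  have card_sum: "(\<Sum>p\<in>S. ?I p x) = real (card {p \<in> S. x \<in> ball p r})" for x
    using S(1) by (simp add: indicator_def sum.If_cases Int_def)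
  have on_ball: "(LINT x|M. ?I p x * (f x)\<^sup>2) \<le> K * (LINT x|M. ?I p x * g x)
      + (l2_inner M f (\<lambda>x. 1 / sqrt (?m p) * ?I p x))\<^sup>2" for p
  proof -
    let ?a = "?F p / ?m p"
    have "(LINT y:ball p r|M. \<bar>f y - ball_mean M f p r\<bar>\<^sup>2)
        = (LINT x|M. ?I p x * (f x)\<^sup>2 - 2 * ?a * (?I p x * f x) + ?a\<^sup>2 * ?I p x)"
      unfolding set_lebesgue_integral_def ball_mean_def
      by (intro Bochner_Integration.integral_cong) (simp_all add: power2_diff algebra_simps)
    also have "\<dots> = (LINT x|M. ?I p x * (f x)\<^sup>2) - 2 * ?a * ?F p + ?a\<^sup>2 * ?m p"
      using Iint[OF f2] Iint[OF fi] by (simp add: emeasure_eq_measure)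
    also have "\<dots> = (LINT x|M. ?I p x * (f x)\<^sup>2) - (?F p)\<^sup>2 / ?m p"
      using ball(2)[of p] by (simp add: power2_eq_square field_simps)
    finally have "(LINT x|M. ?I p x * (f x)\<^sup>2) \<le> K * (LINT x|M. ?I p x * g x) + (?F p)\<^sup>2 / ?m p"
      using poin[of p] by (simp add: set_lebesgue_integral_def)
    moreover have "l2_inner M f (\<lambda>x. 1 / sqrt (?m p) * ?I p x) = ?F p / sqrt (?m p)"
    proof -
      have "l2_inner M f (\<lambda>x. 1 / sqrt (?m p) * ?I p x) = (LINT x|M. 1 / sqrt (?m p) * (?I p x * f x))"
        unfolding l2_inner_def by (intro Bochner_Integration.integral_cong) (simp_all add: mult_ac)
      then show ?thesis by simp
    qed
    ultimately show ?thesis using ball(2)[of p] by (simp add: power_divide)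
  qed
  have "l2_inner M f f = (LINT x|M. (f x)\<^sup>2)" by (simp add: l2_inner_def power2_eq_square)
  also have "\<dots> \<le> (LINT x|M. (\<Sum>p\<in>S. ?I p x * (f x)\<^sup>2))"
  proof (rule integral_mono)
    fix x
    have "x \<in> (\<Union>p\<in>S. ball p r)" using S(2) by simp
    then have "{p \<in> S. x \<in> ball p r} \<noteq> {}" by blast
    then have "1 \<le> (\<Sum>p\<in>S. ?I p x)" using S(1) unfolding card_sum by (simp add: Suc_le_eq card_gt_0_iff)
    from mult_right_mono[OF this, of "(f x)\<^sup>2"] show "(f x)\<^sup>2 \<le> (\<Sum>p\<in>S. ?I p x * (f x)\<^sup>2)"
      by (simp add: sum_distrib_right)
  qed (use f2 Iint[OF f2] in auto)
  also have "\<dots> = (\<Sum>p\<in>S. LINT x|M. ?I p x * (f x)\<^sup>2)"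
    using Iint[OF f2] by (intro Bochner_Integration.integral_sum)
  also have "\<dots> \<le> (\<Sum>p\<in>S. K * (LINT x|M. ?I p x * g x) + (l2_inner M f (\<lambda>x. 1 / sqrt (?m p) * ?I p x))\<^sup>2)"
    by (intro sum_mono on_ball)
  also have "\<dots> = K * (LINT x|M. (\<Sum>p\<in>S. ?I p x * g x)) + (\<Sum>p\<in>S. (l2_inner M f (\<lambda>x. 1 / sqrt (?m p) * ?I p x))\<^sup>2)"
    using Iint[OF g(1)] by (simp add: sum.distrib sum_distrib_left[symmetric])
  also have "(LINT x|M. (\<Sum>p\<in>S. ?I p x * g x)) \<le> (LINT x|M. N * g x)"
  proof (rule integral_mono_AE)
    show "AE x in M. (\<Sum>p\<in>S. ?I p x * g x) \<le> N * g x"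
      using g(2)
    proof eventually_elim
      case (elim x)
      have "(\<Sum>p\<in>S. ?I p x) \<le> N" unfolding card_sum using S(3)[of x] by simp
      then have "(\<Sum>p\<in>S. ?I p x) * g x \<le> N * g x" using elim by (intro mult_right_mono)
      then show ?case by (simp add: sum_distrib_right)
    qed
  qed (use g Iint[OF g(1)] in auto)
  finally show ?thesis using K by (simp add: mult_left_mono mult.assoc)
qed

section \<open>Extending the inner product and the operator from \<open>l2 M\<close> to all
  functions\<close>

lemma l2_projection_exists: "\<exists>p. linear p \<and> (\<forall>f. p f \<in> l2 M) \<and> (\<forall>f\<in>l2 M. p f = f)"
proof -
  have "\<exists>p. p ` UNIV \<subseteq> l2 M \<and> linear p \<and> (\<forall>f\<in>l2 M. p (id f) = f)"
    by (rule real_vector.linear_exists_left_inverse_on[OF linear_id subspace_l2]) simp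
  then show ?thesis by auto
qed

definition l2_part :: "'a measure \<Rightarrow> ('a \<Rightarrow> real) \<Rightarrow> 'a \<Rightarrow> real" where
  "l2_part M = (SOME p. linear p \<and> (\<forall>f. p f \<in> l2 M) \<and> (\<forall>f\<in>l2 M. p f = f))"

lemma linear_l2_part: "linear (l2_part M)"
  and l2_part_in: "l2_part M f \<in> l2 M"
  and l2_part_id: "f \<in> l2 M \<Longrightarrow> l2_part M f = f"
  using someI_ex[OF l2_projection_exists[of M]] unfolding l2_part_def[symmetric] by auto

text \<open>
  Composing with an algebraic projection onto \<open>L\<^sub>2\<close> extends the inner product and the operator to
  all functions, so that the abstract theory applies without carrier sets.
\<close>

definition part_inner :: "'a measure \<Rightarrow> ('a \<Rightarrow> real) \<Rightarrow> ('a \<Rightarrow> real) \<Rightarrow> real" where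
  "part_inner M f g = l2_inner M (l2_part M f) (l2_part M g)"

definition part_rel :: "'a measure \<Rightarrow> ('a \<Rightarrow> real) rel \<Rightarrow> ('a \<Rightarrow> real) rel" where
  "part_rel M L = {(f, h). (l2_part M f, l2_part M h) \<in> L}"

lemma part_inner_l2: "f \<in> l2 M \<Longrightarrow> g \<in> l2 M \<Longrightarrow> part_inner M f g = l2_inner M f g"
  by (simp add: part_inner_def l2_part_id)

lemma semi_inner_part_inner: "semi_inner (part_inner M)"
proof
  fix f g h :: "'a \<Rightarrow> real" and a :: real
  note i = integrable_mult_l2[OF l2_part_in l2_part_in]
  show "part_inner M f g = part_inner M g f" by (simp add: part_inner_def l2_inner_def mult.commute)
  show "part_inner M (f + g) h = part_inner M f h + part_inner M g h"
    unfolding part_inner_def l2_inner_def linear_add[OF linear_l2_part]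
    by (simp add: distrib_right i)
  show "part_inner M (a *\<^sub>R f) g = a * part_inner M f g"
    unfolding part_inner_def l2_inner_def linear_scale[OF linear_l2_part] by (simp add: mult.assoc)
  show "0 \<le> part_inner M f f" unfolding part_inner_def l2_inner_def by (intro integral_nonneg_AE) auto
qed

lemma nrm_part_inner: "semi_inner.nrm (part_inner M) f = l2_norm M (l2_part M f)"
  unfolding semi_inner.nrm_def[OF semi_inner_part_inner] part_inner_def l2_norm_def ..

lemma (in finite_measure) semi_hilbert_part_inner: "semi_hilbert (part_inner M)"
proof -
  interpret semi_inner "part_inner M" by (rule semi_inner_part_inner)
  show ?thesis
  proof
    fix x :: "nat \<Rightarrow> 'a \<Rightarrow> real"
    assume "\<And>e. 0 < e \<Longrightarrow> \<exists>N. \<forall>m\<ge>N. \<forall>n\<ge>N. nrm (x m - x n) < e"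
    then have "\<And>e. 0 < e \<Longrightarrow> \<exists>N. \<forall>m\<ge>N. \<forall>n\<ge>N. l2_norm M (l2_part M (x m) - l2_part M (x n)) < e"
      unfolding nrm_part_inner linear_diff[OF linear_l2_part] .
    from l2_complete[OF l2_part_in this] obtain l where
      l: "l \<in> l2 M" "(\<lambda>n. l2_norm M (l2_part M (x n) - l)) \<longlonglongrightarrow> 0" by blast
    then show "\<exists>l. (\<lambda>n. nrm (x n - l)) \<longlonglongrightarrow> 0"
      unfolding nrm_part_inner linear_diff[OF linear_l2_part] by (intro exI[of _ l]) (simp add: l2_part_id)
  qed
qed

lemma l2_operator_in_l2: "l2_operator M L \<Longrightarrow> (f, h) \<in> L \<Longrightarrow> f \<in> l2 M \<and> h \<in> l2 M"
  unfolding l2_operator_def by blast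

lemma part_rel_l2: "f \<in> l2 M \<Longrightarrow> h \<in> l2 M \<Longrightarrow> (f, h) \<in> part_rel M L \<longleftrightarrow> (f, h) \<in> L"
  by (simp add: part_rel_def l2_part_id)

lemma selfadjoint_iff:
  assumes "selfadjoint_op M L"
  shows "(g, k) \<in> L \<longleftrightarrow> g \<in> l2 M \<and> k \<in> l2 M \<and> (\<forall>(f, h)\<in>L. l2_inner M h g = l2_inner M f k)"
proof -
  have "L = op_adjoint M L" using assms by (simp add: selfadjoint_op_def)
  then have "(g, k) \<in> L \<longleftrightarrow> (g, k) \<in> op_adjoint M L" by simp
  then show ?thesis by (simp add: op_adjoint_def)
qed

lemma (in finite_measure) pos_selfadjoint_part_rel:
  assumes sa: "selfadjoint_op M L" and nn: "nonneg_op M L"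
  shows "pos_selfadjoint (part_inner M) (part_rel M L)"
proof -
  interpret semi_hilbert "part_inner M" by (rule semi_hilbert_part_inner)
  have L2: "f \<in> l2 M" "h \<in> l2 M" if "(f, h) \<in> L" for f h
    using sa that l2_operator_in_l2 unfolding selfadjoint_op_def by blast+
  have inL: "(f, h) \<in> part_rel M L" if "(f, h) \<in> L" for f h
    using that L2[OF that] by (simp add: part_rel_l2)
  show ?thesis
  proof
    fix e :: real and f :: "'a \<Rightarrow> real"
    assume "0 < e"
    then have "\<exists>g\<in>Domain L. l2_norm M (\<lambda>x. l2_part M f x - g x) < e"
      using sa l2_part_in[of M f] unfolding selfadjoint_op_def densely_defined_def by blast
    then obtain g k where gk: "(g, k) \<in> L" "l2_norm M (l2_part M f - g) < e"
      by (auto simp: fun_diff_def)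
    then have "nrm (f - g) < e"
      unfolding nrm_part_inner linear_diff[OF linear_l2_part] using L2[OF gk(1)] by (simp add: l2_part_id)
    with inL[OF gk(1)] show "\<exists>(g, k)\<in>part_rel M L. nrm (f - g) < e" by blast
  next
    fix g k :: "'a \<Rightarrow> real"
    show "(g, k) \<in> part_rel M L \<longleftrightarrow> (\<forall>(f, h)\<in>part_rel M L. part_inner M h g = part_inner M f k)"
    proof
      assume "(g, k) \<in> part_rel M L"
      then show "\<forall>(f, h)\<in>part_rel M L. part_inner M h g = part_inner M f k"
        using selfadjoint_iff[OF sa, of "l2_part M g" "l2_part M k"]
        unfolding part_rel_def part_inner_def by blast
    next
      assume *: "\<forall>(f, h)\<in>part_rel M L. part_inner M h g = part_inner M f k"
      have "l2_inner M h (l2_part M g) = l2_inner M f (l2_part M k)" if "(f, h) \<in> L" for f h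
        using * inL[OF that] L2[OF that] unfolding part_inner_def by (force simp: l2_part_id)
      then show "(g, k) \<in> part_rel M L"
        unfolding part_rel_def using selfadjoint_iff[OF sa, of "l2_part M g" "l2_part M k"] l2_part_in by blast
    qed
  next
    fix f h :: "'a \<Rightarrow> real"
    assume "(f, h) \<in> part_rel M L"
    then show "0 \<le> part_inner M h f"
      using nn unfolding nonneg_op_def part_rel_def part_inner_def by blast
  qed
qed

section \<open>The form inequality from the Poincare inequality\<close>

lemma op_app_in: "f \<in> Domain T \<Longrightarrow> (f, op_app T f) \<in> T"
  unfolding op_app_def by (metis DomainE someI)

lemma relpow_part_rel: "(f, h) \<in> part_rel M L ^^ n \<Longrightarrow> (l2_part M f, l2_part M h) \<in> L ^^ n"
proof (induction n arbitrary: h)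
  case (Suc n)
  then obtain g where "(f, g) \<in> part_rel M L ^^ n" "(g, h) \<in> part_rel M L" by auto
  with Suc.IH[of g] show ?case by (auto simp: part_rel_def)
qed simp

lemma l2_operator_unique: "l2_operator M T \<Longrightarrow> (f, h) \<in> T \<Longrightarrow> (f, h') \<in> T \<Longrightarrow> AE x in M. h x = h' x"
  unfolding l2_operator_def by blast

text \<open>Since \<open>R O R = L\<close>, there is \<open>k\<close> with \<open>(f, k)\<close> and
  \<open>(k, h)\<close> in \<open>R\<close>, and symmetry moves one factor across. This identifies
  the right side of Assumption C with the quadratic form of \<open>L\<close>.\<close>

lemma nonneg_sqrt_norm:
  assumes sqrt: "is_nonneg_sqrt M L R" and L: "l2_operator M L" and fh: "(f, h) \<in> L"
  shows "(l2_norm M (op_app R f))\<^sup>2 = l2_inner M h f"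
proof -
  have R: "l2_operator M R" "selfadjoint_op M R" "R O R = L"
    using sqrt unfolding is_nonneg_sqrt_def selfadjoint_op_def by auto
  from fh R(3) obtain k where k: "(f, k) \<in> R" "(k, h) \<in> R" by blast
  have k': "(f, op_app R f) \<in> R" using k(1) by (intro op_app_in) auto
  note in_l2 = l2_operator_in_l2[OF R(1)]
  have meas: "k \<in> borel_measurable M" "op_app R f \<in> borel_measurable M"
    using in_l2[OF k(1)] in_l2[OF k'] by (auto simp: l2_def)
  have "(l2_norm M (op_app R f))\<^sup>2 = l2_inner M (op_app R f) (op_app R f)"
    unfolding l2_norm_def l2_inner_def by (simp add: integral_nonneg_AE)
  also have "\<dots> = l2_inner M k k"
    using l2_operator_unique[OF R(1) k' k(1)] meas by (intro l2_inner_cong_AE) auto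
  also have "\<dots> = l2_inner M f h"
    using selfadjoint_iff[OF R(2), of k h] k by blast
  finally show ?thesis by (simp add: l2_inner_def mult.commute)
qed

text \<open>The mixed terms are products of two L2 functions; the remaining one makes sense because
  the algebra property puts the square of \<open>f\<close> into the domain, and L2 embeds into L1
  over a finite measure.\<close>

lemma integrable_Gamma:
  assumes fin: "finite_measure M" and L: "l2_operator M L" and alg: "subalgebra_of_C M (dom_infinity L)"
    and f: "f \<in> dom_infinity L"
  shows "integrable M (Gamma L f f)"
proof -
  interpret finite_measure M by (rule fin)
  have dom: "g \<in> Domain L" if "g \<in> dom_infinity L" for g
    using that relpow_1[of L] unfolding dom_infinity_def by (metis INT_E atLeast_iff le_refl)
  have l2: "g \<in> l2 M" "op_app L g \<in> l2 M" if "g \<in> dom_infinity L" for g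
    using l2_operator_in_l2[OF L op_app_in[OF dom[OF that]]] by auto
  have ff: "(\<lambda>x. f x * f x) \<in> dom_infinity L" using alg f unfolding subalgebra_of_C_def by blast
  show ?thesis
    unfolding Gamma_def
    using integrable_mult_l2[OF l2[OF f]] integrable_l2[OF l2(2)[OF ff]] by simp
qed

text \<open>The order of the quantifiers matters: \<open>K\<close> and \<open>r0\<close> come from
  Assumptions C and D and are fixed before the radius, the multiplicity and the lattice.\<close>

lemma form_lattice_inequality:
  fixes M :: "'a::metric_space measure"
  assumes c: "compact (UNIV :: 'a set)" and rad: "radon_measure M" and dbl: "doubling M"
    and sa: "selfadjoint_op M L" and nn: "nonneg_op M L"
    and alg: "subalgebra_of_C M (dom_infinity L)" and sqrt: "is_nonneg_sqrt M L R"
    and C: "assumption_C M L R" and P: "poincare M L"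
  shows "\<exists>K>0. \<exists>r0>0. \<forall>r N (S :: 'a set). 0 < r \<longrightarrow> r < r0 \<longrightarrow> metric_lattice r N S \<longrightarrow>
    (\<exists>g. \<forall>(f, h)\<in>part_rel M L. part_inner M f f \<le>
       K * r\<^sup>2 * real N * part_inner M h f + (\<Sum>i<card S. (part_inner M f (g i))\<^sup>2))"
proof -
  obtain C0 r0 where C0: "0 < C0" and r0: "0 < r0"
    and poin: "\<And>f x r. f \<in> dom_infinity L \<Longrightarrow> 0 < r \<Longrightarrow> r < r0 \<Longrightarrow>
      (LINT y:ball x r|M. \<bar>f y - ball_mean M f x r\<bar>\<^sup>2) \<le> C0 * r\<^sup>2 * (LINT y:ball x r|M. Gamma L f f y)"
    using P unfolding poincare_def by blast
  obtain c0 where c0: "0 < c0"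
    and AC: "\<And>f. f \<in> dom_infinity L \<Longrightarrow> (LINT x|M. Gamma L f f x) \<le> c0 * (l2_norm M (op_app R f))\<^sup>2"
    using C unfolding assumption_C_def by blast
  have fin: "finite_measure M" and setsM: "sets M = sets borel"
    using compact_radon_finite_measure[OF c rad] by auto
  interpret finite_measure M by (rule fin)
  interpret pos_selfadjoint "part_inner M" "part_rel M L" by (rule pos_selfadjoint_part_rel[OF sa nn])
  have L: "l2_operator M L" using sa by (simp add: selfadjoint_op_def)
  have ball_pos: "0 < measure M (ball p r)" if "0 < r" for p r
    using dbl that unfolding doubling_def by (metis field_sum_of_halves half_gt_zero mult_2)
  have "\<exists>g. \<forall>(f, h)\<in>part_rel M L. part_inner M f f \<le>
       C0 * c0 * r\<^sup>2 * real N * part_inner M h f + (\<Sum>i<card S. (part_inner M f (g i))\<^sup>2)"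
    if r: "0 < r" "r < r0" and S: "metric_lattice r N S" for r N and S :: "'a set"
  proof -
    have Sfin: "finite S" by (rule metric_lattice_finite[OF c S r(1)])
    then obtain e where e: "bij_betw e {..<card S} S"
      using ex_bij_betw_nat_finite atLeast0LessThan by metis
    define g0 where "g0 p = (\<lambda>x. 1 / sqrt (measure M (ball p r)) * indicator (ball p r) x)" for p
    have g0: "g0 p \<in> l2 M" for p unfolding g0_def using setsM by (intro indicator_l2) simp
    have "part_inner M f f \<le> (C0 * c0 * r\<^sup>2 * real N) * part_inner M h f + (\<Sum>i<card S. (part_inner M f (g0 (e i)))\<^sup>2)"
      if "(f, h) \<in> part_rel M L" for f h
    proof (rule form_ineq_from_smooth[OF _ that])
      fix f h assume fh: "(f, h) \<in> part_rel M L" and sm: "\<And>n. f \<in> Domain (part_rel M L ^^ n)"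
      define F H where "F = l2_part M f" and "H = l2_part M h"
      have FH: "(F, H) \<in> L" using fh by (simp add: part_rel_def F_def H_def)
      have F: "F \<in> dom_infinity L"
        unfolding dom_infinity_def F_def using sm relpow_part_rel by (fastforce elim: DomainE)
      have Fl2: "F \<in> l2 M" unfolding F_def by (rule l2_part_in)
      have \<Gamma>: "integrable M (Gamma L F F)" by (rule integrable_Gamma[OF fin L alg F])
      \<comment> \<open>The left side of the Poincare inequality is non-negative, hence so is the
        integral of \<Gamma>(F, F) over every small ball.\<close>
      have \<Gamma>0: "AE x in M. 0 \<le> Gamma L F F x"
      proof (rule AE_nonneg_if_ball_integrals_nonneg[OF c rad dbl \<Gamma> r0])
        fix x s assume s: "0 < s" "s < r0"
        have "0 \<le> (LINT y:ball x s|M. \<bar>F y - ball_mean M F x s\<bar>\<^sup>2)"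
          unfolding set_lebesgue_integral_def by (intro integral_nonneg_AE) auto
        also have "\<dots> \<le> C0 * s\<^sup>2 * (LINT y:ball x s|M. Gamma L F F y)" by (rule poin[OF F s])
        finally show "0 \<le> (LINT y:ball x s|M. Gamma L F F y)"
          using zero_le_mult_iff[of "C0 * s\<^sup>2"] mult_pos_pos[OF C0 zero_less_power[OF s(1), of 2]] by auto
      qed
      have "l2_inner M F F \<le> C0 * r\<^sup>2 * real N * (LINT x|M. Gamma L F F x) + (\<Sum>p\<in>S. (l2_inner M F (g0 p))\<^sup>2)"
        unfolding g0_def
        by (rule l2_lattice_bound[OF fin Sfin _ _ _ _ Fl2 \<Gamma> \<Gamma>0])
          (use S setsM ball_pos[OF r(1)] C0 poin[OF F r] in \<open>auto simp: metric_lattice_def\<close>)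
      also have "C0 * r\<^sup>2 * real N * (LINT x|M. Gamma L F F x) \<le> C0 * r\<^sup>2 * real N * (c0 * l2_inner M H F)"
        using AC[OF F] nonneg_sqrt_norm[OF sqrt L FH] C0 by (intro mult_left_mono) auto
      also have "(\<Sum>p\<in>S. (l2_inner M F (g0 p))\<^sup>2) = (\<Sum>i<card S. (l2_inner M F (g0 (e i)))\<^sup>2)"
        by (rule sum.reindex_bij_betw[OF e, symmetric])
      finally show "part_inner M f f \<le> (C0 * c0 * r\<^sup>2 * real N) * part_inner M h f + (\<Sum>i<card S. (part_inner M f (g0 (e i)))\<^sup>2)"
        unfolding part_inner_def F_def[symmetric] H_def[symmetric] l2_part_id[OF g0] by (simp add: mult_ac)
    qed
    then show ?thesis by (intro exI[of _ "\<lambda>i. g0 (e i)"]) blast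
  qed
  note main = this
  show ?thesis
  proof (rule exI[of _ "C0 * c0"], rule conjI)
    show "0 < C0 * c0" using C0 c0 by simp
    show "\<exists>r0>0. \<forall>r N (S :: 'a set). 0 < r \<longrightarrow> r < r0 \<longrightarrow> metric_lattice r N S \<longrightarrow>
      (\<exists>g. \<forall>(f, h)\<in>part_rel M L. part_inner M f f \<le>
         C0 * c0 * r\<^sup>2 * real N * part_inner M h f + (\<Sum>i<card S. (part_inner M f (g i))\<^sup>2))"
    proof (rule exI[of _ r0], rule conjI[OF r0], intro allI impI)
      fix r N and S :: "'a set"
      assume "0 < r" "r < r0" "metric_lattice r N S"
      then show "\<exists>g. \<forall>(f, h)\<in>part_rel M L. part_inner M f f \<le>
         C0 * c0 * r\<^sup>2 * real N * part_inner M h f + (\<Sum>i<card S. (part_inner M f (g i))\<^sup>2)"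
        by (rule main)
    qed
  qed
qed

section \<open>The spectral measure of an eigenbasis\<close>

lemma l2_inner_linear:
  assumes "f \<in> l2 M" "g \<in> l2 M" "h \<in> l2 M"
  shows "l2_inner M (\<lambda>x. a * f x + b * g x) h = a * l2_inner M f h + b * l2_inner M g h"
proof -
  have "l2_inner M (\<lambda>x. a * f x + b * g x) h = (LINT x|M. a * (f x * h x) + b * (g x * h x))"
    unfolding l2_inner_def by (intro Bochner_Integration.integral_cong) (simp_all add: algebra_simps)
  then show ?thesis using integrable_mult_l2[OF assms(1,3)] integrable_mult_l2[OF assms(2,3)]
    by (simp add: l2_inner_def)
qed

lemma l2_lincomb: "f \<in> l2 M \<Longrightarrow> g \<in> l2 M \<Longrightarrow> (\<lambda>x. a * f x + b * g x) \<in> l2 M"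
  using l2_add[OF l2_scale l2_scale, of f M g a b] by (simp add: plus_fun_def scaleR_fun_def)

locale l2_eigenbasis =
  fixes M :: "'a measure" and L :: "('a \<Rightarrow> real) rel" and \<phi> :: "nat \<Rightarrow> 'a \<Rightarrow> real" and ev :: "nat \<Rightarrow> real"
  assumes fin: "finite_measure M" and sa: "selfadjoint_op M L" and nn: "nonneg_op M L"
    and \<phi>_l2: "\<phi> j \<in> l2 M"
    and eb: "eigenbasis (part_inner M) (part_rel M L) \<phi> ev"
begin

interpretation eb: eigenbasis "part_inner M" "part_rel M L" \<phi> ev by (rule eb)

definition coeff :: "('a \<Rightarrow> real) \<Rightarrow> nat \<Rightarrow> real" where
  "coeff f j = l2_inner M f (\<phi> j)"

lemma coeff_part: "f \<in> l2 M \<Longrightarrow> part_inner M f (\<phi> j) = coeff f j"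
  by (simp add: coeff_def part_inner_l2 \<phi>_l2)

lemma coeff_lincomb:
  "f \<in> l2 M \<Longrightarrow> g \<in> l2 M \<Longrightarrow> coeff (\<lambda>x. a * f x + b * g x) j = a * coeff f j + b * coeff g j"
  unfolding coeff_def by (rule l2_inner_linear[OF _ _ \<phi>_l2])

lemma coeff_cong_AE:
  "f \<in> l2 M \<Longrightarrow> g \<in> l2 M \<Longrightarrow> AE x in M. f x = g x \<Longrightarrow> coeff f j = coeff g j"
  unfolding coeff_def using \<phi>_l2[of j] by (intro l2_inner_cong_AE) (auto simp: l2_def)

lemma coeff_zero: "\<phi> j = 0 \<Longrightarrow> coeff f j = 0"
  by (simp add: coeff_def l2_inner_def)

lemma parseval:
  assumes "f \<in> l2 M" "g \<in> l2 M"
  shows "(\<lambda>j. coeff f j * coeff g j) sums l2_inner M f g"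
  using eb.parseval[of f g] assms by (simp add: coeff_part part_inner_l2)

lemma parseval_sq: "f \<in> l2 M \<Longrightarrow> (\<lambda>j. (coeff f j)\<^sup>2) sums l2_inner M f f"
  using parseval[of f f] by (simp add: power2_eq_square)

lemma riesz_fischer:
  assumes "summable (\<lambda>j. (c j)\<^sup>2)" "\<And>j. \<phi> j = 0 \<Longrightarrow> c j = 0"
  shows "\<exists>f\<in>l2 M. \<forall>j. coeff f j = c j"
proof -
  from eb.riesz_fischer[OF assms] obtain f where f: "\<And>j. part_inner M f (\<phi> j) = c j" by blast
  have "coeff (l2_part M f) j = c j" for j
    using f[of j] \<phi>_l2[of j] by (simp add: coeff_def part_inner_def l2_part_id)
  then show ?thesis using l2_part_in by blast
qed

lemma L_l2: "(f, h) \<in> L \<Longrightarrow> f \<in> l2 M \<and> h \<in> l2 M"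
  using sa l2_operator_in_l2 unfolding selfadjoint_op_def by blast

lemma L_iff_coeff:
  assumes "f \<in> l2 M" "h \<in> l2 M"
  shows "(f, h) \<in> L \<longleftrightarrow> (\<forall>j. coeff h j = ev j * coeff f j)"
  using eb.L_iff_coeff[of f h] assms by (simp add: part_rel_l2 coeff_part)

lemma AE_zero_if_coeff_zero:
  assumes "f \<in> l2 M" "\<And>j. coeff f j = 0"
  shows "AE x in M. f x = 0"
proof -
  have "eb.nrm f = 0" by (rule eb.null_if_coeffs_zero) (simp add: coeff_part assms)
  then show ?thesis using l2_norm_eq_0_iff[OF assms(1)] by (simp add: nrm_part_inner l2_part_id assms(1))
qed

lemma AE_eq_if_coeff_eq:
  assumes "f \<in> l2 M" "g \<in> l2 M" "\<And>j. coeff f j = coeff g j"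
  shows "AE x in M. f x = g x"
proof -
  have "coeff (\<lambda>x. 1 * f x + (- 1) * g x) j = 0" for j
    unfolding coeff_lincomb[OF assms(1,2)] using assms(3)[of j] by simp
  then have "AE x in M. 1 * f x + (- 1) * g x = 0"
    by (intro AE_zero_if_coeff_zero l2_lincomb assms)
  then show ?thesis by simp
qed

lemma \<phi>_coeff: "coeff (\<phi> i) j = (if i = j \<and> \<phi> i \<noteq> 0 then 1 else 0)"
  using eb.\<psi>_unit[of i] eb.\<psi>_orth[of i j] by (auto simp: coeff_part[OF \<phi>_l2] coeff_zero)

lemma ev_nonneg: "\<phi> j \<noteq> 0 \<Longrightarrow> 0 \<le> ev j"
  by (rule eb.ev_nonneg)

text \<open>The spectral projection in eigencoordinates. Membership is decided by coefficients
  alone, so every representative of the image belongs to the relation.\<close>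

definition E :: "real set \<Rightarrow> ('a \<Rightarrow> real) rel" where
  "E B = {(f, g). f \<in> l2 M \<and> g \<in> l2 M \<and> (\<forall>j. coeff g j = (if ev j \<in> B then coeff f j else 0))}"

lemma E_l2: "(f, g) \<in> E B \<Longrightarrow> f \<in> l2 M \<and> g \<in> l2 M"
  by (simp add: E_def)

lemma E_coeff: "(f, g) \<in> E B \<Longrightarrow> coeff g j = (if ev j \<in> B then coeff f j else 0)"
  by (simp add: E_def)

lemma E_exists:
  assumes "f \<in> l2 M"
  shows "\<exists>g. (f, g) \<in> E B"
proof -
  have "summable (\<lambda>j. (if ev j \<in> B then coeff f j else 0)\<^sup>2)"
    by (rule summable_comparison_test'[OF sums_summable[OF parseval_sq[OF assms]]]) auto
  then have "\<exists>g\<in>l2 M. \<forall>j. coeff g j = (if ev j \<in> B then coeff f j else 0)"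
    by (rule riesz_fischer) (simp add: coeff_zero)
  with assms show ?thesis by (auto simp: E_def)
qed

lemma l2_projection_E: "l2_projection M (E B)"
  unfolding l2_projection_def
proof (intro conjI)
  have "(\<lambda>_. 0) \<in> l2 M" by (simp add: l2_def)
  moreover have "coeff (\<lambda>_. 0) j = 0" for j by (simp add: coeff_def l2_inner_def)
  ultimately have zero: "(\<lambda>_. 0, \<lambda>_. 0) \<in> E B" by (simp add: E_def)
  show "l2_operator M (E B)"
    unfolding l2_operator_def
  proof (intro conjI)
    show "E B \<subseteq> l2 M \<times> l2 M" by (auto simp: E_def)
    show "\<forall>(f, h)\<in>E B. \<forall>(g, k)\<in>E B. \<forall>a b. (\<lambda>x. a * f x + b * g x, \<lambda>x. a * h x + b * k x) \<in> E B"
      by (auto simp: E_def l2_lincomb coeff_lincomb)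
    show "\<forall>(f, h)\<in>E B. \<forall>f'\<in>l2 M. \<forall>h'\<in>l2 M.
        (AE x in M. f x = f' x) \<longrightarrow> (AE x in M. h x = h' x) \<longrightarrow> (f', h') \<in> E B"
    proof (clarify)
      fix f h f' h'
      assume fh: "(f, h) \<in> E B" and "f' \<in> l2 M" "h' \<in> l2 M" "AE x in M. f x = f' x" "AE x in M. h x = h' x"
      then have "coeff f' j = coeff f j" "coeff h' j = coeff h j" for j
        using coeff_cong_AE[of f f'] coeff_cong_AE[of h h'] E_l2[OF fh] by auto
      then show "(f', h') \<in> E B" using \<open>f' \<in> l2 M\<close> \<open>h' \<in> l2 M\<close> fh by (simp add: E_def)
    qed
    show "\<forall>f h h'. (f, h) \<in> E B \<longrightarrow> (f, h') \<in> E B \<longrightarrow> (AE x in M. h x = h' x)"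
      by (intro allI impI AE_eq_if_coeff_eq) (auto simp: E_def)
  qed (rule zero)
  show "Domain (E B) = l2 M" using E_exists E_l2 by blast
  show "symmetric_op M (E B)"
    unfolding symmetric_op_def
  proof clarify
    fix f h g k assume fh: "(f, h) \<in> E B" and gk: "(g, k) \<in> E B"
    have "(\<lambda>j. coeff h j * coeff g j) = (\<lambda>j. coeff f j * coeff k j)"
      using E_coeff[OF fh] E_coeff[OF gk] by auto
    then show "l2_inner M h g = l2_inner M f k"
      using parseval[of h g] parseval[of f k] E_l2[OF fh] E_l2[OF gk] sums_unique2 by metis
  qed
  show "E B O E B = E B"
  proof (intro set_eqI iffI; clarify)
    fix f h g assume "(f, h) \<in> E B" "(h, g) \<in> E B"
    then show "(f, g) \<in> E B" by (simp add: E_def)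
  next
    fix f g assume "(f, g) \<in> E B"
    then have "(f, g) \<in> E B" "(g, g) \<in> E B" by (simp_all add: E_def)
    then show "(f, g) \<in> E B O E B" by (rule relcompI)
  qed
qed

text \<open>The sum of point masses \<open>(coeff f j)^2\<close> at \<open>ev j\<close>. As the
  image of a density over counting measure it turns integrals into series.\<close>

definition spec_meas :: "('a \<Rightarrow> real) \<Rightarrow> real measure" where
  "spec_meas f = distr (density (count_space UNIV) (\<lambda>j. ennreal ((coeff f j)\<^sup>2))) borel ev"

lemma nn_integral_spec_meas:
  assumes "u \<in> borel_measurable borel"
  shows "(\<integral>\<^sup>+t. u t \<partial>spec_meas f) = (\<Sum>j. ennreal ((coeff f j)\<^sup>2) * u (ev j))"
  using assms unfolding spec_meas_def
  by (simp add: nn_integral_distr nn_integral_density nn_integral_count_space_nat)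

lemma E_inner_sums:
  assumes f: "f \<in> l2 M"
  shows "(\<lambda>j. (coeff f j)\<^sup>2 * indicator B (ev j)) sums l2_inner M (op_app (E B) f) f"
proof -
  have "(f, op_app (E B) f) \<in> E B" unfolding op_app_def using E_exists[OF f] by (rule someI_ex)
  then have "coeff (op_app (E B) f) j = (if ev j \<in> B then coeff f j else 0)" "op_app (E B) f \<in> l2 M" for j
    using E_coeff E_l2 by auto
  then have "(\<lambda>j. (if ev j \<in> B then coeff f j else 0) * coeff f j) sums l2_inner M (op_app (E B) f) f"
    using parseval[of "op_app (E B) f" f] f by simp
  moreover have "(\<lambda>j. (if ev j \<in> B then coeff f j else 0) * coeff f j) = (\<lambda>j. (coeff f j)\<^sup>2 * indicator B (ev j))"
    by (auto simp: power2_eq_square indicator_def)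
  ultimately show ?thesis by simp
qed

lemma emeasure_spec_meas:
  assumes f: "f \<in> l2 M" and B: "B \<in> sets borel"
  shows "emeasure (spec_meas f) B = ennreal (l2_inner M (op_app (E B) f) f)"
proof -
  have "emeasure (spec_meas f) B = (\<integral>\<^sup>+t. indicator B t \<partial>spec_meas f)"
    using B by (simp add: spec_meas_def)
  also have "\<dots> = (\<Sum>j. ennreal ((coeff f j)\<^sup>2) * indicator B (ev j))"
    using B by (intro nn_integral_spec_meas) simp
  also have "\<dots> = (\<Sum>j. ennreal ((coeff f j)\<^sup>2 * indicator B (ev j)))"
    by (intro suminf_cong) (auto simp: indicator_def)
  also have "\<dots> = ennreal (l2_inner M (op_app (E B) f) f)"
    by (rule suminf_ennreal_eq[OF _ E_inner_sums[OF f]]) auto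
  finally show ?thesis .
qed

text \<open>The set function inside \<open>spectral_distr\<close> agrees on Borel sets with a
  genuine measure, which \<open>measure_of\<close> then reproduces.\<close>

lemma spectral_distr_E:
  assumes f: "f \<in> l2 M"
  shows "spectral_distr M E f = spec_meas f"
proof -
  have "spectral_distr M E f = measure_of UNIV (sets borel) (emeasure (spec_meas f))"
    unfolding spectral_distr_def
    by (rule measure_of_eq) (auto simp: emeasure_spec_meas[OF f] sets.sigma_sets_eq[of borel, simplified])
  also have "\<dots> = spec_meas f"
    using measure_of_of_measure[of "spec_meas f"] by (simp add: spec_meas_def)
  finally show ?thesis .
qed

lemma finite_measure_spec_meas:
  assumes f: "f \<in> l2 M"
  shows "finite_measure (spec_meas f)"
  using emeasure_spec_meas[OF f, of UNIV] by (intro finite_measureI) (simp add: spec_meas_def)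

lemma Domain_L_iff:
  assumes f: "f \<in> l2 M"
  shows "f \<in> Domain L \<longleftrightarrow> summable (\<lambda>j. (ev j * coeff f j)\<^sup>2)"
proof
  assume "f \<in> Domain L"
  then obtain h where h: "(f, h) \<in> L" by blast
  then have "h \<in> l2 M" using L_l2 by blast
  then show "summable (\<lambda>j. (ev j * coeff f j)\<^sup>2)"
    using sums_summable[OF parseval_sq[of h]] L_iff_coeff[OF f, of h] h by simp
next
  assume "summable (\<lambda>j. (ev j * coeff f j)\<^sup>2)"
  then have "\<exists>h\<in>l2 M. \<forall>j. coeff h j = ev j * coeff f j"
    by (rule riesz_fischer) (simp add: coeff_zero)
  then show "f \<in> Domain L" using L_iff_coeff[OF f] by blast
qed

text \<open>Supplies the witness that makes the choice in \<open>spectral_projection\<close>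
  meaningful. Every condition becomes a statement on series by Parseval; the domain condition is
  square summability of \<open>ev j * coeff f j\<close>.\<close>

lemma is_spectral_measure_E: "is_spectral_measure M L E"
  unfolding is_spectral_measure_def
proof (intro conjI)
  show "projection_valued_measure M E"
    unfolding projection_valued_measure_def
  proof (intro conjI ballI allI impI)
    fix B :: "real set"
    show "l2_projection M (E B)" by (rule l2_projection_E)
  next
    show "E UNIV = {(f, g). f \<in> l2 M \<and> g \<in> l2 M \<and> (AE x in M. f x = g x)}"
    proof (intro set_eqI iffI; clarify)
      fix f g assume fg: "(f, g) \<in> E UNIV"
      then have "AE x in M. g x = f x" by (intro AE_eq_if_coeff_eq) (simp_all add: E_def)
      then show "f \<in> l2 M \<and> g \<in> l2 M \<and> (AE x in M. f x = g x)" using E_l2[OF fg] by auto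
    next
      fix f g assume "f \<in> l2 M" "g \<in> l2 M" "AE x in M. f x = g x"
      then show "(f, g) \<in> E UNIV" using coeff_cong_AE[of f g] by (simp add: E_def)
    qed
  next
    fix A B :: "real set"
    show "E (A \<inter> B) = E A O E B"
    proof (intro set_eqI iffI; clarify)
      fix f g assume fg: "(f, g) \<in> E (A \<inter> B)"
      then obtain h where h: "(f, h) \<in> E A" using E_exists E_l2 by blast
      then have "(h, g) \<in> E B" using fg by (auto simp: E_def)
      with h show "(f, g) \<in> E A O E B" by (rule relcompI)
    qed (simp add: E_def)
  next
    fix f and B :: "nat \<Rightarrow> real set"
    assume f: "f \<in> l2 M" and B: "range B \<subseteq> sets borel" "disjoint_family B"
    interpret \<nu>: finite_measure "spec_meas f" by (rule finite_measure_spec_meas[OF f])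
    have nn: "0 \<le> l2_inner M (op_app (E A) f) f" for A
      using sums_le[OF _ sums_zero E_inner_sums[OF f]] by simp
    have m: "measure (spec_meas f) A = l2_inner M (op_app (E A) f) f" if "A \<in> sets borel" for A
      using emeasure_spec_meas[OF f that] nn by (simp add: measure_def)
    have "(\<lambda>n. measure (spec_meas f) (B n)) sums measure (spec_meas f) (\<Union>n. B n)"
      using B by (intro \<nu>.finite_measure_UNION) (simp_all add: spec_meas_def)
    then show "(\<lambda>n. l2_inner M (op_app (E (B n)) f) f) sums l2_inner M (op_app (E (\<Union>n. B n)) f) f"
      using B(1) m[of "\<Union>n. B n"] by (subst (asm) m) (auto simp: m range_subsetD)
  qed
  have int2: "(\<integral>\<^sup>+t. ennreal (t\<^sup>2) \<partial>spec_meas f) < \<infinity> \<longleftrightarrow> summable (\<lambda>j. (ev j * coeff f j)\<^sup>2)" for f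
  proof -
    have "(\<integral>\<^sup>+t. ennreal (t\<^sup>2) \<partial>spec_meas f) = (\<Sum>j. ennreal ((coeff f j)\<^sup>2) * ennreal ((ev j)\<^sup>2))"
      by (rule nn_integral_spec_meas) simp
    also have "\<dots> = (\<Sum>j. ennreal ((ev j * coeff f j)\<^sup>2))"
      by (intro suminf_cong) (simp add: power_mult_distrib mult.commute flip: ennreal_mult)
    finally have eq: "(\<integral>\<^sup>+t. ennreal (t\<^sup>2) \<partial>spec_meas f) = (\<Sum>j. ennreal ((ev j * coeff f j)\<^sup>2))" .
    show ?thesis
    proof
      assume "(\<integral>\<^sup>+t. ennreal (t\<^sup>2) \<partial>spec_meas f) < \<infinity>"
      then show "summable (\<lambda>j. (ev j * coeff f j)\<^sup>2)"
        unfolding eq by (intro summable_suminf_not_top) auto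
    next
      assume "summable (\<lambda>j. (ev j * coeff f j)\<^sup>2)"
      then show "(\<integral>\<^sup>+t. ennreal (t\<^sup>2) \<partial>spec_meas f) < \<infinity>"
        unfolding eq by (subst suminf_ennreal2) auto
    qed
  qed
  have "Domain L \<subseteq> l2 M" using L_l2 by blast
  show "Domain L = {f \<in> l2 M. (\<integral>\<^sup>+t. ennreal (t\<^sup>2) \<partial>spectral_distr M E f) < \<infinity>}"
  proof (intro set_eqI)
    fix f
    show "f \<in> Domain L \<longleftrightarrow> f \<in> {f \<in> l2 M. (\<integral>\<^sup>+t. ennreal (t\<^sup>2) \<partial>spectral_distr M E f) < \<infinity>}"
      using Domain_L_iff[of f] int2[of f] spectral_distr_E[of f] \<open>Domain L \<subseteq> l2 M\<close>
      by (cases "f \<in> l2 M") auto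
  qed
  show "\<forall>(f, h)\<in>L. l2_inner M h f = (LINT t|spectral_distr M E f. t)"
  proof clarify
    fix f h assume fh: "(f, h) \<in> L"
    then have f: "f \<in> l2 M" and h: "h \<in> l2 M" using L_l2 by auto
    have hc: "coeff h j * coeff f j = (coeff f j)\<^sup>2 * ev j" for j
      using fh L_iff_coeff[OF f h] by (simp add: power2_eq_square)
    have s: "(\<lambda>j. (coeff f j)\<^sup>2 * ev j) sums l2_inner M h f"
      using parseval[OF h f] by (simp add: hc)
    have pos: "0 \<le> (coeff f j)\<^sup>2 * ev j" for j
      using ev_nonneg[of j] by (cases "\<phi> j = 0") (simp_all add: coeff_zero)
    have "(LINT t|spec_meas f. t) = (LINT j|count_space UNIV. (coeff f j)\<^sup>2 * ev j)"
      unfolding spec_meas_def by (simp add: integral_distr integral_density)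
    also have "\<dots> = (\<Sum>j. (coeff f j)\<^sup>2 * ev j)"
      using sums_summable[OF s] pos by (intro integral_count_space_nat) (simp add: integrable_count_space_nat_iff)
    also have "\<dots> = l2_inner M h f" using sums_unique[OF s] by simp
    finally show "l2_inner M h f = (LINT t|spectral_distr M E f. t)" by (simp add: spectral_distr_E[OF f])
  qed
qed

end

text \<open>Stated for any \<open>E\<close> with the defining property, so it applies to whatever
  \<open>spectral_projection\<close> selects. The distribution of \<open>f\<close> lives on
  \<open>{0..w}\<close>: its second moment is finite, which puts \<open>f\<close> into the domain,
  and its mean is at most \<open>w\<close> times its mass.\<close>

lemma spectral_measure_bound:
  assumes E: "is_spectral_measure M L E" and w: "0 \<le> w" and f: "f \<in> Range (E {0..w})"
  shows "f \<in> l2 M" "\<exists>h. (f, h) \<in> L \<and> l2_inner M h f \<le> w * l2_inner M f f"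
proof -
  have pvm: "projection_valued_measure M E" using E by (simp add: is_spectral_measure_def)
  have proj: "l2_projection M (E B)" if "B \<in> sets borel" for B
    using pvm that by (simp add: projection_valued_measure_def)
  have Eint: "E (A \<inter> B) = E A O E B" if "A \<in> sets borel" "B \<in> sets borel" for A B
    using pvm that unfolding projection_valued_measure_def by blast
  have idem: "(g, g) \<in> E B" if B: "B \<in> sets borel" and fg: "(f, g) \<in> E B" for B f g
  proof -
    have op: "l2_operator M (E B)" and "E B O E B = E B" using proj[OF B] by (auto simp: l2_projection_def)
    then obtain g' where g': "(f, g') \<in> E B" "(g', g) \<in> E B" using fg by blast
    have "AE x in M. g' x = g x" using op g'(1) fg unfolding l2_operator_def by blast
    then show ?thesis using op g'(2) l2_operator_in_l2[OF op fg] unfolding l2_operator_def by blast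
  qed
  have ff: "(f, f) \<in> E {0..w}" using f idem[of "{0..w}"] by auto
  have fl2: "f \<in> l2 M" using proj[of "{0..w}"] ff l2_operator_in_l2 by (auto simp: l2_projection_def)
  then show "f \<in> l2 M" .
  define Q where "Q B = l2_inner M (op_app (E B) f) f" for B
  have app: "(f, op_app (E B) f) \<in> E B" if B: "B \<in> sets borel" for B
  proof -
    have "f \<in> Domain (E B)" using proj[OF B] fl2 by (simp add: l2_projection_def)
    then show ?thesis unfolding op_app_def by (metis DomainE someI)
  qed
  have Q0: "0 \<le> Q B" if B: "B \<in> sets borel" for B
  proof -
    have "l2_inner M (op_app (E B) f) (op_app (E B) f) = l2_inner M f (op_app (E B) f)"
      using proj[OF B] app[OF B] idem[OF B app[OF B]] unfolding l2_projection_def symmetric_op_def by blast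
    moreover have "0 \<le> l2_inner M (op_app (E B) f) (op_app (E B) f)"
      unfolding l2_inner_def by (intro integral_nonneg_AE) auto
    ultimately show ?thesis unfolding Q_def by (simp add: l2_inner_def mult.commute)
  qed
  have Qsums: "(\<lambda>n. Q (B n)) sums Q (\<Union>n. B n)" if "range B \<subseteq> sets borel" "disjoint_family B" for B :: "nat \<Rightarrow> real set"
    using pvm fl2 that unfolding projection_valued_measure_def Q_def by blast
  \<comment> \<open>Countable additivity for the sequence of empty sets makes a constant series
    summable.\<close>
  have Qempty: "Q {} = 0"
  proof -
    have "(\<lambda>n::nat. Q {}) sums Q {}" using Qsums[of "\<lambda>_. {}"] by (simp add: disjoint_family_on_def)
    then have "summable (\<lambda>n::nat. Q {})" by (rule sums_summable)
    then show ?thesis by (simp add: summable_const_iff)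
  qed
  define \<nu> where "\<nu> = spectral_distr M E f"
  have sets\<nu>: "sets \<nu> = sets borel" and space\<nu>: "space \<nu> = UNIV"
    unfolding \<nu>_def spectral_distr_def using sets.sigma_sets_eq[of "borel :: real measure"] by simp_all
  \<comment> \<open>\<open>measure_of\<close> returns the given set function only after positivity
    and countable additivity have been verified; both are inherited from \<open>Q\<close>.\<close>
  have em: "emeasure \<nu> B = ennreal (Q B)" if "B \<in> sets borel" for B
  proof (rule emeasure_measure_of[where \<Omega> = UNIV and A = "sets borel"])
    show "\<nu> = measure_of UNIV (sets borel) (\<lambda>B. ennreal (Q B))" by (simp add: \<nu>_def spectral_distr_def Q_def)
    show "positive (sets \<nu>) (\<lambda>B. ennreal (Q B))" by (simp add: positive_def Qempty)
    show "countably_additive (sets \<nu>) (\<lambda>B. ennreal (Q B))"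
      unfolding countably_additive_def sets\<nu>
      using Q0 by (intro allI impI suminf_ennreal_eq[OF _ Qsums]) auto
  qed (use that sets\<nu> in auto)
  have Quniv: "Q UNIV = l2_inner M f f"
  proof -
    have "(f, op_app (E UNIV) f) \<in> {(f, g). f \<in> l2 M \<and> g \<in> l2 M \<and> (AE x in M. f x = g x)}"
      using app[of UNIV] pvm unfolding projection_valued_measure_def by auto
    then show ?thesis unfolding Q_def using fl2
      by (intro l2_inner_cong_AE) (auto simp: l2_def)
  qed
  interpret \<nu>: finite_measure \<nu> by (rule finite_measureI) (simp add: space\<nu> em)
  have mU: "measure \<nu> UNIV = l2_inner M f f" using em[of UNIV] Q0[of UNIV] by (simp add: measure_def Quniv)
  \<comment> \<open>Since \<open>f\<close> is fixed by the projection on \<open>{0..w}\<close>, its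
    projection on the complement is also a value of \<open>E {}\<close> at \<open>f\<close>.\<close>
  have QN: "Q (- {0..w}) = 0"
  proof -
    have "(f, op_app (E (- {0..w})) f) \<in> E {0..w} O E (- {0..w})" using ff app[of "- {0..w}"] by auto
    also have "E {0..w} O E (- {0..w}) = E ({0..w} \<inter> - {0..w})"
      by (rule Eint[symmetric]) auto
    finally have "(f, op_app (E (- {0..w})) f) \<in> E {}" by simp
    moreover have op: "l2_operator M (E {})" using proj[of "{}"] by (simp add: l2_projection_def)
    ultimately have "AE x in M. op_app (E (- {0..w})) f x = op_app (E {}) f x"
      and "op_app (E (- {0..w})) f \<in> l2 M" "op_app (E {}) f \<in> l2 M"
      using app[of "{}"] l2_operator_in_l2[OF op] unfolding l2_operator_def by blast+
    then have "Q (- {0..w}) = Q {}" unfolding Q_def using fl2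
      by (intro l2_inner_cong_AE) (auto simp: l2_def)
    then show ?thesis using Qempty by simp
  qed
  have AE\<nu>: "AE t in \<nu>. t \<in> {0..w}"
  proof (rule AE_I[of _ _ "- {0..w}"])
    show "emeasure \<nu> (- {0..w}) = 0" using em[of "- {0..w}"] QN by simp
  qed (auto simp: sets\<nu>)
  have "(\<integral>\<^sup>+t. ennreal (t\<^sup>2) \<partial>\<nu>) \<le> (\<integral>\<^sup>+t. ennreal (w\<^sup>2) \<partial>\<nu>)"
    by (rule nn_integral_mono_AE) (use AE\<nu> in \<open>auto intro!: ennreal_leI power_mono\<close>)
  also have "\<dots> < \<infinity>" by (simp add: \<nu>.emeasure_eq_measure ennreal_mult_less_top)
  finally have "f \<in> Domain L" using E fl2 by (simp add: is_spectral_measure_def \<nu>_def)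
  then obtain h where h: "(f, h) \<in> L" by blast
  have "l2_inner M h f = (LINT t|\<nu>. t)" using E h unfolding is_spectral_measure_def \<nu>_def by blast
  also have "\<dots> \<le> (LINT t|\<nu>. w)"
  proof (rule integral_mono_AE)
    show "integrable \<nu> (\<lambda>t. t)"
      by (rule \<nu>.integrable_const_bound[of _ w]) (use AE\<nu> sets\<nu> in \<open>auto cong: measurable_cong_sets\<close>)
  qed (use AE\<nu> in auto)
  also have "\<dots> = w * l2_inner M f f" using mU space\<nu> by simp
  finally show "\<exists>h. (f, h) \<in> L \<and> l2_inner M h f \<le> w * l2_inner M f f" using h by blast
qed

section \<open>Eigenvalue counting\<close>

text \<open>The abstract eigenvectors may lie outside \<open>l2 M\<close>. Replacing them by their
  L2 parts changes no inner product, because \<open>part_inner\<close> sees only these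
  parts.\<close>

lemma eigenbasis_l2_part:
  assumes "eigenbasis (part_inner M) (part_rel M L) \<psi> ev"
  shows "eigenbasis (part_inner M) (part_rel M L) (\<lambda>j. l2_part M (\<psi> j)) ev"
proof -
  interpret eb: eigenbasis "part_inner M" "part_rel M L" \<psi> ev by (rule assms)
  note lin = linear_diff[OF linear_l2_part] linear_sum[OF linear_l2_part] linear_scale[OF linear_l2_part]
  have id: "l2_part M (l2_part M f) = l2_part M f" for f by (rule l2_part_id[OF l2_part_in])
  have ip: "part_inner M f (l2_part M g) = part_inner M f g" "part_inner M (l2_part M f) g = part_inner M f g" for f g
    by (simp_all add: part_inner_def id)
  show ?thesis
  proof
    fix j assume "l2_part M (\<psi> j) \<noteq> 0"
    then have "\<psi> j \<noteq> 0" using linear_0[OF linear_l2_part] by metis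
    then show "part_inner M (l2_part M (\<psi> j)) (l2_part M (\<psi> j)) = 1" unfolding ip by (rule eb.\<psi>_unit)
  next
    fix i j :: nat assume "i \<noteq> j"
    then show "part_inner M (l2_part M (\<psi> i)) (l2_part M (\<psi> j)) = 0" unfolding ip by (rule eb.\<psi>_orth)
  next
    fix j
    show "(l2_part M (\<psi> j), ev j *\<^sub>R l2_part M (\<psi> j)) \<in> part_rel M L"
      using eb.\<psi>_eigen[of j] by (simp add: part_rel_def id lin)
  next
    fix f
    show "(\<lambda>n. eb.nrm (f - (\<Sum>j<n. part_inner M f (l2_part M (\<psi> j)) *\<^sub>R l2_part M (\<psi> j)))) \<longlonglongrightarrow> 0"
      using eb.\<psi>_complete[of f] unfolding nrm_part_inner lin id ip .
  qed
qed

text \<open>By the first axiom a dummy vector occurs exactly when the earlier vectors already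
  separate L2, so the non-zero indices form an initial segment.\<close>

locale ordered_eigenbasis = l2_eigenbasis M L \<phi> ev for M :: "'a measure" and L \<phi> ev +
  assumes \<phi>_zero_iff: "\<phi> n = 0 \<longleftrightarrow> (\<forall>f\<in>l2 M. (\<forall>i<n. l2_inner M f (\<phi> i) = 0) \<longrightarrow> (AE x in M. f x = 0))"
    and ev_mono: "i \<le> j \<Longrightarrow> \<phi> j \<noteq> 0 \<Longrightarrow> ev i \<le> ev j"
    and finite_ev_le: "finite {j. \<phi> j \<noteq> 0 \<and> ev j \<le> w}"
begin

interpretation eb: eigenbasis "part_inner M" "part_rel M L" \<phi> ev by (rule eb)

lemma \<phi>_inner: "l2_inner M (\<phi> i) (\<phi> j) = (if i = j \<and> \<phi> i \<noteq> 0 then 1 else 0)"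
  using \<phi>_coeff[of i j] by (simp add: coeff_def)

text \<open>If \<open>\<phi> j \<noteq> 0\<close>, the vectors up to index \<open>j\<close> are
  \<open>Suc j\<close> independent ones; if \<open>\<phi> j = 0\<close>, the first \<open>j\<close>
  functionals separate L2 and bound its dimension by \<open>j\<close>.\<close>

lemma basis_index_eq: "basis_index M = {j. \<phi> j \<noteq> 0}"
proof -
  have "enat j < l2_dim M (l2 M)" if j: "\<phi> j \<noteq> 0" for j
  proof -
    have nz: "\<phi> i \<noteq> 0" if "i \<le> j" for i
      using j that \<phi>_zero_iff[of i] \<phi>_zero_iff[of j] by (meson order.strict_trans2)
    \<comment> \<open>\<open>ae_independent\<close> speaks of sets of functions, so distinct indices
      must give distinct functions before the sum can be reindexed.\<close>
    have inj: "inj_on \<phi> {..j}"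
    proof (rule inj_onI)
      fix i k assume "i \<in> {..j}" "k \<in> {..j}" and eq: "\<phi> i = \<phi> k"
      then show "i = k" using \<phi>_inner[of i k] \<phi>_inner[of k k] nz[of k] by (auto split: if_splits)
    qed
    have "ae_independent M (\<phi> ` {..j})"
      unfolding ae_independent_def
    proof (intro allI impI ballI)
      fix c b assume ae: "AE x in M. (\<Sum>b\<in>\<phi> ` {..j}. c b * b x) = 0" and "b \<in> \<phi> ` {..j}"
      then obtain k where k: "k \<le> j" "b = \<phi> k" by auto
      have "0 = l2_inner M (\<lambda>x. \<Sum>b\<in>\<phi> ` {..j}. c b * b x) (\<phi> k)"
      proof -
        have "l2_inner M (\<lambda>x. \<Sum>b\<in>\<phi> ` {..j}. c b * b x) (\<phi> k) = l2_inner M (\<lambda>_. 0) (\<phi> k)"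
          using ae \<phi>_l2
          by (intro l2_inner_cong_AE) (auto simp: l2_def intro!: borel_measurable_sum borel_measurable_times)
        then show ?thesis by (simp add: l2_inner_def)
      qed
      also have "\<dots> = (LINT x|M. (\<Sum>i\<le>j. c (\<phi> i) * (\<phi> i x * \<phi> k x)))"
        unfolding l2_inner_def sum.reindex[OF inj] by (simp add: sum_distrib_right mult.assoc)
      also have "\<dots> = (\<Sum>i\<le>j. c (\<phi> i) * l2_inner M (\<phi> i) (\<phi> k))"
        using \<phi>_l2 by (subst Bochner_Integration.integral_sum)
          (auto simp: l2_inner_def intro!: integrable_mult_right integrable_mult_l2)
      also have "\<dots> = (\<Sum>i\<le>j. if i = k then c (\<phi> k) else 0)"
        using nz by (intro sum.cong) (auto simp: \<phi>_inner)
      also have "\<dots> = c b" using k by simp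
      finally show "c b = 0" by simp
    qed
    then have "enat (card (\<phi> ` {..j})) \<le> l2_dim M (l2 M)"
      unfolding l2_dim_def using \<phi>_l2 by (intro SUP_upper) auto
    moreover have "card (\<phi> ` {..j}) = Suc j" using inj by (simp add: card_image)
    ultimately show ?thesis by (metis enat_ord_simps(2) lessI less_le_trans)
  qed
  moreover have "l2_dim M (l2 M) \<le> enat j" if j: "\<phi> j = 0" for j
    by (rule l2_dim_le[where g = \<phi>]) (use \<phi>_zero_iff[of j] j \<phi>_l2 in \<open>auto simp: subspace_l2\<close>)
  ultimately show ?thesis unfolding basis_index_def by (auto simp: not_less[symmetric])
qed

lemma orthonormal_basis_\<phi>: "orthonormal_basis M \<phi>"
  unfolding orthonormal_basis_def
proof (intro conjI ballI)
  fix f assume f: "f \<in> l2 M"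
  have "l2_norm M (\<lambda>x. f x - (\<Sum>j\<in>basis_index M \<inter> {..<n}. l2_inner M f (\<phi> j) * \<phi> j x))
      = eb.nrm (f - (\<Sum>j<n. part_inner M f (\<phi> j) *\<^sub>R \<phi> j))" for n
  proof -
    let ?S = "\<Sum>j<n. part_inner M f (\<phi> j) *\<^sub>R \<phi> j"
    have "?S \<in> l2 M" using \<phi>_l2 by (intro subspace_sum[OF subspace_l2] l2_scale)
    then have "l2_part M (f - ?S) = f - ?S" using f by (intro l2_part_id l2_diff)
    moreover have "(\<lambda>x. f x - (\<Sum>j\<in>basis_index M \<inter> {..<n}. l2_inner M f (\<phi> j) * \<phi> j x)) = f - ?S"
    proof
      fix x
      have "(\<Sum>j\<in>basis_index M \<inter> {..<n}. l2_inner M f (\<phi> j) * \<phi> j x) = (\<Sum>j<n. l2_inner M f (\<phi> j) * \<phi> j x)"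
        by (rule sum.mono_neutral_left) (auto simp: basis_index_eq)
      then show "f x - (\<Sum>j\<in>basis_index M \<inter> {..<n}. l2_inner M f (\<phi> j) * \<phi> j x) = (f - ?S) x"
        using f \<phi>_l2 by (simp add: sum_fun_apply part_inner_l2)
    qed
    ultimately show ?thesis by (simp add: nrm_part_inner)
  qed
  then show "(\<lambda>n. l2_norm M (\<lambda>x. f x - (\<Sum>j\<in>basis_index M \<inter> {..<n}. l2_inner M f (\<phi> j) * \<phi> j x))) \<longlonglongrightarrow> 0"
    using eb.\<psi>_complete[of f] by simp
qed (use \<phi>_l2 \<phi>_inner basis_index_eq in auto)

section \<open>Spectrum, multiplicities and Paley-Wiener dimension in the eigenbasis\<close>

lemma \<phi>_eigen: "(\<phi> j, \<lambda>x. ev j * \<phi> j x) \<in> L"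
proof -
  have "(\<lambda>x. ev j * \<phi> j x) = ev j *\<^sub>R \<phi> j" by auto
  then show ?thesis using eb.\<psi>_eigen[of j] l2_scale[OF \<phi>_l2, of "ev j" j] \<phi>_l2[of j]
    by (simp add: part_rel_l2)
qed

text \<open>At an eigenvalue the eigenvector violates the lower bound. Off the eigenvalues
  \<open>L - z\<close> is inverted by dividing coefficients by \<open>ev j - z\<close>, which stays
  away from 0.\<close>

lemma op_spectrum_eq: "op_spectrum M L = ev ` {j. \<phi> j \<noteq> 0}"
proof (intro set_eqI iffI)
  fix z assume "z \<in> ev ` {j. \<phi> j \<noteq> 0}"
  then obtain j where j: "\<phi> j \<noteq> 0" "z = ev j" by blast
  have "\<not> (\<forall>(f, g)\<in>L. l2_norm M f \<le> K * l2_norm M (\<lambda>x. g x - z * f x))" for K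
  proof
    assume "\<forall>(f, g)\<in>L. l2_norm M f \<le> K * l2_norm M (\<lambda>x. g x - z * f x)"
    from bspec[OF this \<phi>_eigen[of j]] have "l2_norm M (\<phi> j) \<le> K * l2_norm M (\<lambda>x. ev j * \<phi> j x - z * \<phi> j x)"
      by (simp only: prod.case)
    then show False using \<phi>_inner[of j j] j by (simp add: l2_norm_def) (simp add: l2_inner_def)
  qed
  then show "z \<in> op_spectrum M L" by (simp add: op_spectrum_def)
next
  fix z assume z: "z \<in> op_spectrum M L"
  show "z \<in> ev ` {j. \<phi> j \<noteq> 0}"
  proof (rule ccontr)
    assume no: "z \<notin> ev ` {j. \<phi> j \<noteq> 0}"
    \<comment> \<open>Only finitely many eigenvalues are at most \<open>z + 1\<close> and all others
      are more than 1 away from \<open>z\<close>, so \<open>z\<close> keeps a positive distance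
      \<open>d\<close> from all of them.\<close>
    have "finite (ev ` {j. \<phi> j \<noteq> 0 \<and> ev j \<le> z + 1})" using finite_ev_le by (rule finite_imageI)
    from finite_set_avoid[OF this, of z] obtain d0 where d0: "0 < d0"
      "\<forall>y\<in>ev ` {j. \<phi> j \<noteq> 0 \<and> ev j \<le> z + 1}. y \<noteq> z \<longrightarrow> d0 \<le> dist z y" by blast
    define d where "d = min d0 1"
    have d: "0 < d" using d0 by (simp add: d_def)
    have gap: "d \<le> \<bar>ev j - z\<bar>" if "\<phi> j \<noteq> 0" for j
    proof (cases "ev j \<le> z + 1")
      case True
      then have "ev j \<in> ev ` {j. \<phi> j \<noteq> 0 \<and> ev j \<le> z + 1}" using that by blast
      moreover have "ev j \<noteq> z" using no that by auto
      ultimately have "d0 \<le> dist z (ev j)" using d0(2) by blast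
      then show ?thesis by (simp add: d_def dist_real_def abs_minus_commute)
    qed (simp add: d_def)
    have "\<exists>(f, g)\<in>L. AE x in M. g x - z * f x = h x" if h: "h \<in> l2 M" for h
    proof -
      have "summable (\<lambda>j. (coeff h j / (ev j - z))\<^sup>2)"
      proof (rule summable_comparison_test')
        show "summable (\<lambda>j. (coeff h j)\<^sup>2 * (1 / d\<^sup>2))"
          using sums_summable[OF parseval_sq[OF h]] by (rule summable_mult2)
        fix j
        show "norm ((coeff h j / (ev j - z))\<^sup>2) \<le> (coeff h j)\<^sup>2 * (1 / d\<^sup>2)"
        proof (cases "\<phi> j = 0")
          case False
          have le: "d\<^sup>2 \<le> (ev j - z)\<^sup>2" using gap[OF False] d by (simp add: abs_le_square_iff[symmetric])
          have "(coeff h j)\<^sup>2 / (ev j - z)\<^sup>2 \<le> (coeff h j)\<^sup>2 / d\<^sup>2"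
            using le less_le_trans[OF zero_less_power[OF d, of 2] le] d by (intro divide_left_mono mult_pos_pos) auto
          then show ?thesis by (simp add: power_divide)
        qed (simp add: coeff_zero)
      qed
      then have "\<exists>f\<in>l2 M. \<forall>j. coeff f j = coeff h j / (ev j - z)"
        by (rule riesz_fischer) (simp add: coeff_zero)
      then obtain f where f: "f \<in> l2 M" "\<And>j. coeff f j = coeff h j / (ev j - z)" by blast
      define g where "g = (\<lambda>x. 1 * h x + z * f x)"
      have g: "g \<in> l2 M" unfolding g_def using h f(1) by (rule l2_lincomb)
      have "coeff g j = ev j * coeff f j" for j
      proof (cases "\<phi> j = 0")
        case False
        then have "ev j - z \<noteq> 0" using gap[OF False] d by auto
        then show ?thesis
          unfolding g_def coeff_lincomb[OF h f(1)] f(2) by (simp add: field_simps)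
      qed (simp add: coeff_zero)
      then have "(f, g) \<in> L" using L_iff_coeff[OF f(1) g] by simp
      moreover have "AE x in M. g x - z * f x = h x" by (simp add: g_def)
      ultimately show ?thesis by blast
    qed
    moreover have "l2_norm M f \<le> (1 / d) * l2_norm M (\<lambda>x. g x - z * f x)" if fg: "(f, g) \<in> L" for f g
    proof -
      have f: "f \<in> l2 M" and g: "g \<in> l2 M" using L_l2[OF fg] by auto
      define u where "u = (\<lambda>x. 1 * g x + (- z) * f x)"
      have u: "u \<in> l2 M" unfolding u_def using g f by (rule l2_lincomb)
      have "coeff u j = (ev j - z) * coeff f j" for j
        unfolding u_def coeff_lincomb[OF g f] using fg L_iff_coeff[OF f g] by (simp add: algebra_simps)
      then have "d\<^sup>2 * (coeff f j)\<^sup>2 \<le> (coeff u j)\<^sup>2" for j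
        using gap[of j] d by (cases "\<phi> j = 0")
          (auto simp: coeff_zero power_mult_distrib abs_le_square_iff[symmetric] intro!: mult_right_mono)
      then have "d\<^sup>2 * l2_inner M f f \<le> l2_inner M u u"
        by (rule sums_le[OF _ sums_mult[OF parseval_sq[OF f]] parseval_sq[OF u]])
      then have "sqrt (d\<^sup>2 * l2_inner M f f) \<le> sqrt (l2_inner M u u)" by (rule real_sqrt_le_mono)
      then have "d * l2_norm M f \<le> l2_norm M u" using d by (simp add: l2_norm_def real_sqrt_mult)
      moreover have "u = (\<lambda>x. g x - z * f x)" by (simp add: u_def)
      ultimately show ?thesis using d by (simp add: field_simps)
    qed
    ultimately have "z \<notin> op_spectrum M L" unfolding op_spectrum_def by blast
    with z show False by simp
  qed
qed

lemma not_islimpt_op_spectrum: "\<not> z islimpt op_spectrum M L"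
proof
  assume "z islimpt op_spectrum M L"
  then have "infinite (op_spectrum M L \<inter> ball z 1)" by (simp add: islimpt_eq_infinite_ball)
  moreover have "op_spectrum M L \<inter> ball z 1 \<subseteq> ev ` {j. \<phi> j \<noteq> 0 \<and> ev j \<le> z + 1}"
    unfolding op_spectrum_eq by (auto simp: dist_real_def)
  ultimately show False using finite_ev_le finite_imageI finite_subset by blast
qed

lemma ev_at_top:
  assumes "l2_dim M (l2 M) = \<infinity>"
  shows "filterlim ev at_top sequentially"
  unfolding filterlim_at_top
proof
  fix w
  have "\<phi> j \<noteq> 0" for j using assms basis_index_eq unfolding basis_index_def by auto
  then have "finite {j. ev j \<le> w}" using finite_ev_le[of w] by simp
  then obtain n where n: "\<And>j. ev j \<le> w \<Longrightarrow> j < n" unfolding finite_nat_set_iff_bounded by blast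
  have "w \<le> ev j" if "n \<le> j" for j using n[of j] that by (meson linear not_less)
  then show "\<forall>\<^sub>F j in sequentially. w \<le> ev j" unfolding eventually_sequentially by blast
qed

text \<open>An eigenfunction for \<open>z\<close> has non-zero coefficients only where
  \<open>ev j = z\<close>, so these basis vectors separate the eigenspace.\<close>

lemma l2_dim_eigenspace_le: "l2_dim M (eigenspace L z) \<le> enat (card {j. \<phi> j \<noteq> 0 \<and> ev j = z})"
proof -
  let ?J = "{j. \<phi> j \<noteq> 0 \<and> ev j = z}"
  have "?J \<subseteq> {j. \<phi> j \<noteq> 0 \<and> ev j \<le> z}" by auto
  then have "finite ?J" by (rule finite_subset) (rule finite_ev_le)
  from ex_bij_betw_nat_finite[OF this] obtain e where e: "bij_betw e {..<card ?J} ?J"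
    unfolding atLeast0LessThan by (elim exE)
  have sp: "f \<in> eigenspace L z \<longleftrightarrow> f \<in> l2 M \<and> (\<forall>j. coeff f j = 0 \<or> z = ev j)" for f
  proof (cases "f \<in> l2 M")
    case True
    have "coeff (\<lambda>x. z * f x) j = z * coeff f j" for j
      using coeff_lincomb[OF True True, of z 0 j] by simp
    moreover have "(\<lambda>x. z * f x) \<in> l2 M" using l2_lincomb[OF True True, of z 0] by simp
    ultimately show ?thesis using True L_iff_coeff[OF True] by (auto simp: eigenspace_def)
  next
    case False
    then show ?thesis using L_l2 unfolding eigenspace_def by blast
  qed
  show ?thesis
  proof (rule l2_dim_le[where g = "\<lambda>i. \<phi> (e i)"])
    show "subspace (eigenspace L z)"
    proof (rule subspaceI)
      have "coeff 0 j = 0" for j by (simp add: coeff_def l2_inner_def)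
      then show "0 \<in> eigenspace L z" using subspace_0[OF subspace_l2] by (simp add: sp)
    next
      fix f g assume "f \<in> eigenspace L z" "g \<in> eigenspace L z"
      moreover have "f + g = (\<lambda>x. 1 * f x + 1 * g x)" by auto
      ultimately show "f + g \<in> eigenspace L z"
        using l2_lincomb[of f M g 1 1] coeff_lincomb[of f g 1 1] by (auto simp: sp) (metis add.right_neutral)
    next
      fix c f assume f: "f \<in> eigenspace L z"
      moreover have "c *\<^sub>R f = (\<lambda>x. c * f x + 0 * f x)" by auto
      ultimately show "c *\<^sub>R f \<in> eigenspace L z"
        using l2_lincomb[of f M f c 0] coeff_lincomb[of f f c 0] by (auto simp: sp)
    qed
    show "eigenspace L z \<subseteq> l2 M" using sp by blast
    fix f assume f: "f \<in> eigenspace L z" and orth: "\<And>i. i < card ?J \<Longrightarrow> l2_inner M f (\<phi> (e i)) = 0"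
    have "coeff f j = 0" for j
    proof (cases "j \<in> ?J")
      case True
      then obtain i where "i < card ?J" "j = e i" using e unfolding bij_betw_def by blast
      then show ?thesis using orth by (simp add: coeff_def)
    next
      case False
      then show ?thesis using f sp[of f] coeff_zero[of j f] by auto
    qed
    then show "AE x in M. f x = 0" using f sp by (intro AE_zero_if_coeff_zero) auto
  qed (rule \<phi>_l2)
qed

text \<open>Different eigenvalues use disjoint index sets, all contained in the finite set on the
  right.\<close>

lemma eigenvalue_count_le: "eigenvalue_count M L w \<le> enat (card {j. \<phi> j \<noteq> 0 \<and> ev j \<le> w})"
  unfolding eigenvalue_count_def
proof (rule SUP_least, clarify)
  fix F assume F: "finite F" "F \<subseteq> eigenvalues M L \<inter> {..w}"
  let ?J = "\<lambda>z. {j. \<phi> j \<noteq> 0 \<and> ev j = z}"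
  have Jsub: "(\<Union>z\<in>F. ?J z) \<subseteq> {j. \<phi> j \<noteq> 0 \<and> ev j \<le> w}" using F by auto
  have Jfin: "finite (?J z)" if "z \<in> F" for z
    using Jsub that finite_ev_le[of w] by (meson UN_upper finite_subset)
  have "(\<Sum>z\<in>F. l2_dim M (eigenspace L z)) \<le> (\<Sum>z\<in>F. enat (card (?J z)))"
    by (intro sum_mono l2_dim_eigenspace_le)
  also have "\<dots> = enat (\<Sum>z\<in>F. card (?J z))" by (simp flip: of_nat_eq_enat)
  also have "(\<Sum>z\<in>F. card (?J z)) = card (\<Union>z\<in>F. ?J z)"
    using F(1) Jfin by (intro card_UN_disjoint[symmetric]) auto
  also have "enat (card (\<Union>z\<in>F. ?J z)) \<le> enat (card {j. \<phi> j \<noteq> 0 \<and> ev j \<le> w})"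
    using card_mono[OF finite_ev_le Jsub] by simp
  finally show "(\<Sum>z\<in>F. l2_dim M (eigenspace L z)) \<le> enat (card {j. \<phi> j \<noteq> 0 \<and> ev j \<le> w})" .
qed

lemma is_spectral_measure_spectral_projection: "is_spectral_measure M L (spectral_projection M L)"
  unfolding spectral_projection_def
  by (rule someI[where P = "is_spectral_measure M L", OF is_spectral_measure_E])

lemma l2_dim_paley_wiener_le:
  assumes fi: "\<And>f h. (f, h) \<in> part_rel M L \<Longrightarrow>
      part_inner M f f \<le> e * part_inner M h f + (\<Sum>i<n. (part_inner M f (g i))\<^sup>2)"
    and e: "0 \<le> e" "e * w < 1" and w: "0 \<le> w"
  shows "l2_dim M (paley_wiener M L w) \<le> enat n"
proof -
  let ?P = "spectral_projection M L {0..w}"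
  note bound = spectral_measure_bound[OF is_spectral_measure_spectral_projection w]
  have op: "l2_operator M ?P"
    using is_spectral_measure_spectral_projection
    unfolding is_spectral_measure_def projection_valued_measure_def l2_projection_def by auto
  have lin: "(\<lambda>x. a * h x + b * k x) \<in> Range ?P" if "h \<in> Range ?P" "k \<in> Range ?P" for a b h k
  proof -
    obtain f g where "(f, h) \<in> ?P" "(g, k) \<in> ?P" using \<open>h \<in> Range ?P\<close> \<open>k \<in> Range ?P\<close> by blast
    then have "(\<lambda>x. a * f x + b * g x, \<lambda>x. a * h x + b * k x) \<in> ?P" using op unfolding l2_operator_def by blast
    then show ?thesis by blast
  qed
  show ?thesis
    unfolding paley_wiener_def
  proof (rule l2_dim_le[where g = "\<lambda>i. l2_part M (g i)"])
    show "subspace (Range ?P)"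
    proof (rule subspaceI)
      show "0 \<in> Range ?P" using op unfolding l2_operator_def zero_fun_def by blast
    next
      fix h k assume "h \<in> Range ?P" "k \<in> Range ?P"
      from lin[OF this, of 1 1] show "h + k \<in> Range ?P" by (simp add: plus_fun_def)
    next
      fix c h assume "h \<in> Range ?P"
      from lin[OF this this, of c 0] show "c *\<^sub>R h \<in> Range ?P" by (simp add: scaleR_fun_def)
    qed
    show "Range ?P \<subseteq> l2 M" using bound(1) by blast
    fix f assume f: "f \<in> Range ?P" and orth: "\<And>i. i < n \<Longrightarrow> l2_inner M f (l2_part M (g i)) = 0"
    have fl2: "f \<in> l2 M" using bound(1) f by blast
    obtain h where h: "(f, h) \<in> L" "l2_inner M h f \<le> w * l2_inner M f f" using bound(2)[OF f] by blast
    have hl2: "h \<in> l2 M" using L_l2[OF h(1)] by simp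
    have "part_inner M f (g i) = 0" if "i < n" for i using orth[OF that] by (simp add: part_inner_def l2_part_id fl2)
    then have "(\<Sum>i<n. (part_inner M f (g i))\<^sup>2) = 0" by simp
    then have "l2_inner M f f \<le> e * l2_inner M h f"
      using fi[of f h] h(1) by (simp add: part_rel_l2 part_inner_l2 fl2 hl2)
    also have "\<dots> \<le> e * (w * l2_inner M f f)" using h(2) e(1) by (rule mult_left_mono)
    finally have "(1 - e * w) * l2_inner M f f \<le> 0" by (simp add: algebra_simps)
    then have "l2_inner M f f \<le> 0" using e(2) by (simp add: mult_le_0_iff)
    moreover have "0 \<le> l2_inner M f f" unfolding l2_inner_def by (intro integral_nonneg_AE) auto
    ultimately have "l2_norm M f = 0" by (simp add: l2_norm_def)
    then show "AE x in M. f x = 0" using l2_norm_eq_0_iff[OF fl2] by simp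
  qed (rule l2_part_in)
qed

end

section \<open>Assembling the theorem\<close>

lemma ordered_eigenbasis_exists:
  assumes fin: "finite_measure M" and sa: "selfadjoint_op M L" and nn: "nonneg_op M L"
    and sf: "small_form (part_inner M) (part_rel M L)"
  shows "\<exists>\<phi> ev. ordered_eigenbasis M L \<phi> ev"
proof -
  interpret small_form "part_inner M" "part_rel M L" by (rule sf)
  obtain \<psi> ev where eb: "eigenbasis (part_inner M) (part_rel M L) \<psi> ev"
    and zero: "\<And>n. \<psi> n = 0 \<longleftrightarrow> (\<forall>x. (\<forall>i<n. part_inner M x (\<psi> i) = 0) \<longrightarrow> nrm x = 0)"
    and mono: "\<And>i j. i \<le> j \<Longrightarrow> \<psi> j \<noteq> 0 \<Longrightarrow> ev i \<le> ev j"
    and fin_le: "\<And>w. finite {j. \<psi> j \<noteq> 0 \<and> ev j \<le> w}"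
    using eigenbasis_exists by blast
  define \<phi> where "\<phi> j = l2_part M (\<psi> j)" for j
  have \<phi>_l2: "\<phi> j \<in> l2 M" for j unfolding \<phi>_def by (rule l2_part_in)
  have eb\<phi>: "eigenbasis (part_inner M) (part_rel M L) \<phi> ev"
    unfolding \<phi>_def using eb by (rule eigenbasis_l2_part)
  have z: "\<phi> j = 0 \<longleftrightarrow> \<psi> j = 0" for j
  proof
    assume "\<phi> j = 0"
    then have "part_inner M (\<psi> j) (\<psi> j) = 0" by (simp add: \<phi>_def part_inner_def l2_inner_def)
    then show "\<psi> j = 0" using eigenbasis.\<psi>_unit[OF eb, of j] by fastforce
  qed (simp add: \<phi>_def linear_0[OF linear_l2_part])
  have "\<phi> n = 0 \<longleftrightarrow> (\<forall>f\<in>l2 M. (\<forall>i<n. l2_inner M f (\<phi> i) = 0) \<longrightarrow> (AE x in M. f x = 0))" for n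
  proof -
    have *: "((\<forall>i<n. part_inner M f (\<psi> i) = 0) \<longrightarrow> nrm f = 0) \<longleftrightarrow>
      ((\<forall>i<n. l2_inner M (l2_part M f) (\<phi> i) = 0) \<longrightarrow> (AE x in M. l2_part M f x = 0))" for f
      unfolding nrm_part_inner l2_norm_eq_0_iff[OF l2_part_in] by (simp add: part_inner_def \<phi>_def)
    have "\<phi> n = 0 \<longleftrightarrow> (\<forall>f. (\<forall>i<n. l2_inner M (l2_part M f) (\<phi> i) = 0) \<longrightarrow> (AE x in M. l2_part M f x = 0))"
      unfolding z zero * ..
    also have "\<dots> \<longleftrightarrow> (\<forall>f\<in>l2 M. (\<forall>i<n. l2_inner M f (\<phi> i) = 0) \<longrightarrow> (AE x in M. f x = 0))"
      using l2_part_in[of M] l2_part_id[of _ M] by metis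
    finally show ?thesis .
  qed
  moreover have "ev i \<le> ev j" if "i \<le> j" "\<phi> j \<noteq> 0" for i j using mono[of i j] that z by simp
  moreover have "finite {j. \<phi> j \<noteq> 0 \<and> ev j \<le> w}" for w using fin_le[of w] by (simp add: z)
  ultimately have "ordered_eigenbasis M L \<phi> ev"
    by (intro ordered_eigenbasis.intro ordered_eigenbasis_axioms.intro l2_eigenbasis.intro fin sa nn \<phi>_l2 eb\<phi>)
  then show ?thesis by blast
qed

lemma small_radius:
  fixes a e r0 :: real
  assumes "0 < e" "0 \<le> a" "0 < r0"
  shows "\<exists>r>0. r < r0 \<and> a * r\<^sup>2 < e"
proof (intro exI conjI)
  \<comment> \<open>The denominator \<open>a + 1\<close> covers \<open>a = 0\<close> and makes
    \<open>a * (e / (a + 1)) < e\<close> strict.\<close>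
  let ?r = "min (r0 / 2) (sqrt (e / (a + 1)))"
  show "0 < ?r" "?r < r0" using assms by auto
  have "?r\<^sup>2 \<le> (sqrt (e / (a + 1)))\<^sup>2" using assms by (intro power_mono) auto
  then have "a * ?r\<^sup>2 \<le> a * (e / (a + 1))" using assms by (intro mult_left_mono) auto
  also have "\<dots> < e" using assms by (simp add: field_simps)
  finally show "a * ?r\<^sup>2 < e" .
qed

theorem theorem4p2:
  fixes M :: "'a::metric_space measure"
    and T L R :: "('a \<Rightarrow> real) rel"
  assumes "compact (UNIV :: 'a set)"
    and "radon_measure M"
    and "doubling M"
    and "assumption_B M T L"
    and "is_nonneg_sqrt M L R"
    and "assumption_C M L R"
    and "poincare M L"
  shows "(\<forall>\<omega>>0. l2_dim M (paley_wiener M L \<omega>) < \<infinity>)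
    \<and> (\<exists>(ev :: nat \<Rightarrow> real) (\<psi> :: nat \<Rightarrow> 'a \<Rightarrow> real).
          (\<forall>j\<in>basis_index M. 0 \<le> ev j)
        \<and> mono_on (basis_index M) ev
        \<and> op_spectrum M L = ev ` basis_index M
        \<and> (\<forall>z. \<not> z islimpt op_spectrum M L)
        \<and> (l2_dim M (l2 M) = \<infinity> \<longrightarrow> filterlim ev at_top sequentially)
        \<and> (\<forall>j\<in>basis_index M. (\<psi> j, \<lambda>x. ev j * \<psi> j x) \<in> L)
        \<and> orthonormal_basis M \<psi>)
    \<and> (\<forall>N. (\<forall>\<^sub>F \<rho> in at_right 0. \<exists>S :: 'a set. metric_lattice \<rho> N S) \<longrightarrow>
        (\<exists>\<gamma>. 0 < \<gamma> \<and> \<gamma> < 1 \<and>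
          (\<forall>\<^sub>F \<omega> in at_top. eigenvalue_count M L \<omega> \<le>
             enat (INF S\<in>{S :: 'a set. metric_lattice (\<gamma> * \<omega> powr (-1/2)) N S}. card S))))"
proof -
  have sa: "selfadjoint_op M L" and nn: "nonneg_op M L" and alg: "subalgebra_of_C M (dom_infinity L)"
    using assms(4) by (auto simp: assumption_B_def)
  interpret finite_measure M using compact_radon_finite_measure[OF assms(1,2)] by simp
  interpret op: pos_selfadjoint "part_inner M" "part_rel M L" by (rule pos_selfadjoint_part_rel[OF sa nn])
  let ?bound = "\<lambda>e (n::nat) g. \<forall>(f, h)\<in>part_rel M L. part_inner M f f \<le>
    e * part_inner M h f + (\<Sum>i<n. (part_inner M f (g i))\<^sup>2)"
  obtain K r0 where K: "0 < K" and r0: "0 < r0"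
    and lattice: "\<And>r N S. 0 < r \<Longrightarrow> r < r0 \<Longrightarrow> metric_lattice r N (S :: 'a set) \<Longrightarrow> \<exists>g. ?bound (K * r\<^sup>2 * real N) (card S) g"
    using form_lattice_inequality[OF assms(1-3) sa nn alg assms(5-7)] by blast
  \<comment> \<open>The first two claims mention no lattice, so doubling has to provide lattices of
    uniformly bounded multiplicity.\<close>
  obtain N0 where N0: "\<And>r. 0 < r \<Longrightarrow> \<exists>S :: 'a set. metric_lattice r N0 S"
    using metric_lattice_exists[OF assms(1-3)] by blast
  \<comment> \<open>The strict inequality \<open>d < e\<close> is kept because for
    \<open>e = 1 / \<omega>\<close> it becomes \<open>d * \<omega> < 1\<close>, as the Paley-Wiener
    bound requires.\<close>
  have small: "\<exists>d n g. 0 \<le> d \<and> d < e \<and> ?bound d (n::nat) g" if e: "0 < e" for e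
  proof -
    obtain r where r: "0 < r" "r < r0" "K * real N0 * r\<^sup>2 < e"
      using small_radius[OF e, of "K * real N0" r0] K r0 by auto
    obtain S :: "'a set" where S: "metric_lattice r N0 S" using N0[OF r(1)] by blast
    obtain g where "?bound (K * r\<^sup>2 * real N0) (card S) g" using lattice[OF r(1,2) S] by blast
    moreover have "0 \<le> K * r\<^sup>2 * real N0" "K * r\<^sup>2 * real N0 < e" using K r(3) by (auto simp: mult_ac)
    ultimately show ?thesis by blast
  qed
  have sf: "small_form (part_inner M) (part_rel M L)"
  proof
    fix e :: real assume "0 < e"
    from small[OF this] obtain d n g where d: "d < e" "?bound d n g" by blast
    have "part_inner M f f \<le> e * part_inner M h f + (\<Sum>i<n. (part_inner M f (g i))\<^sup>2)"
      if fh: "(f, h) \<in> part_rel M L" for f h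
    proof -
      have "d * part_inner M h f \<le> e * part_inner M h f" using d(1) op.pos[OF fh] by (intro mult_right_mono) auto
      moreover have "part_inner M f f \<le> d * part_inner M h f + (\<Sum>i<n. (part_inner M f (g i))\<^sup>2)"
        using d(2) fh by blast
      ultimately show ?thesis by linarith
    qed
    then show "\<exists>n g. ?bound e n g" by blast
  qed
  obtain \<phi> ev where oe: "ordered_eigenbasis M L \<phi> ev"
    using ordered_eigenbasis_exists[OF finite_measure_axioms sa nn sf] by blast
  interpret oe: ordered_eigenbasis M L \<phi> ev by (rule oe)
  have pw: "l2_dim M (paley_wiener M L \<omega>) < \<infinity>" if "0 < \<omega>" for \<omega>
  proof -
    from small[of "1 / \<omega>"] that obtain d n g where d: "0 \<le> d" "d < 1 / \<omega>" "?bound d n g" by auto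
    have "l2_dim M (paley_wiener M L \<omega>) \<le> enat n"
      by (rule oe.l2_dim_paley_wiener_le[where e = d and g = g]) (use d that in \<open>auto simp: field_simps\<close>)
    also have "enat n < \<infinity>" by simp
    finally show ?thesis .
  qed
  have eig: "(\<forall>j\<in>basis_index M. 0 \<le> ev j)
        \<and> mono_on (basis_index M) ev
        \<and> op_spectrum M L = ev ` basis_index M
        \<and> (\<forall>z. \<not> z islimpt op_spectrum M L)
        \<and> (l2_dim M (l2 M) = \<infinity> \<longrightarrow> filterlim ev at_top sequentially)
        \<and> (\<forall>j\<in>basis_index M. (\<phi> j, \<lambda>x. ev j * \<phi> j x) \<in> L)
        \<and> orthonormal_basis M \<phi>"
    using oe.ev_nonneg oe.ev_mono oe.op_spectrum_eq oe.not_islimpt_op_spectrum oe.ev_at_top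
      oe.\<phi>_eigen oe.orthonormal_basis_\<phi> by (simp add: oe.basis_index_eq mono_on_def)
  have count: "\<exists>\<gamma>. 0 < \<gamma> \<and> \<gamma> < 1 \<and> (\<forall>\<^sub>F \<omega> in at_top. eigenvalue_count M L \<omega> \<le>
      enat (INF S\<in>{S :: 'a set. metric_lattice (\<gamma> * \<omega> powr (-1/2)) N S}. card S))"
    if ex: "\<forall>\<^sub>F \<rho> in at_right 0. \<exists>S :: 'a set. metric_lattice \<rho> N S" for N
  proof -
    \<comment> \<open>This gives \<open>K * real N * \<gamma> \<le> 1\<close>, and the summand 2
      makes \<open>\<gamma> < 1\<close> even for \<open>N = 0\<close>; together they yield
      \<open>K * real N * \<gamma>^2 < 1\<close>.\<close>
    define \<gamma> where "\<gamma> = 1 / (K * real N + 2)"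
    have KN: "0 \<le> K * real N" using K by simp
    then have \<gamma>: "0 < \<gamma>" "\<gamma> < 1" by (auto simp: \<gamma>_def field_simps)
    have K\<gamma>: "K * real N * \<gamma>\<^sup>2 < 1"
    proof -
      have "K * real N * \<gamma> \<le> 1" using KN by (simp add: \<gamma>_def)
      then have "K * real N * \<gamma> * \<gamma> \<le> 1 * \<gamma>" using \<gamma>(1) by (intro mult_right_mono) auto
      then show ?thesis using \<gamma>(2) by (simp add: power2_eq_square mult.assoc)
    qed
    \<comment> \<open>Large \<open>\<omega>\<close> means small positive radius, so both
      \<open>\<rho> < r0\<close> and the existence of a lattice hold eventually.\<close>
    have lim: "filterlim (\<lambda>\<omega>. \<gamma> * \<omega> powr (-1/2)) (at_right 0) at_top"
      unfolding filterlim_at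
    proof
      have "((\<lambda>\<omega>::real. \<omega> powr (-1/2)) \<longlongrightarrow> 0) at_top"
        by (rule tendsto_neg_powr) (auto simp: filterlim_ident)
      from tendsto_mult[OF tendsto_const this, of \<gamma>]
      show "((\<lambda>\<omega>. \<gamma> * \<omega> powr (-1/2)) \<longlongrightarrow> 0) at_top" by simp
      show "\<forall>\<^sub>F \<omega> in at_top. \<gamma> * \<omega> powr (-1/2) \<in> {0<..} \<and> \<gamma> * \<omega> powr (-1/2) \<noteq> 0"
        using eventually_gt_at_top[of 0] by eventually_elim (use \<gamma>(1) in auto)
    qed
    have "\<forall>\<^sub>F \<rho> in at_right 0. \<rho> < r0" using eventually_at_right_real[OF r0] by eventually_elim auto
    from eventually_compose_filterlim[OF eventually_conj[OF this ex] lim]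
    have "\<forall>\<^sub>F \<omega> in at_top. \<gamma> * \<omega> powr (-1/2) < r0 \<and> (\<exists>S :: 'a set. metric_lattice (\<gamma> * \<omega> powr (-1/2)) N S)" .
    then have "\<forall>\<^sub>F \<omega> in at_top. eigenvalue_count M L \<omega> \<le>
      enat (INF S\<in>{S :: 'a set. metric_lattice (\<gamma> * \<omega> powr (-1/2)) N S}. card S)"
      using eventually_gt_at_top[of 0]
    proof eventually_elim
      case (elim \<omega>)
      define \<rho> where "\<rho> = \<gamma> * \<omega> powr (-1/2)"
      have \<rho>: "0 < \<rho>" "\<rho> < r0" using elim \<gamma>(1) by (auto simp: \<rho>_def)
      have "\<rho>\<^sup>2 * \<omega> = \<gamma>\<^sup>2"
      proof -
        have "(\<omega> powr (-1/2))\<^sup>2 = \<omega> powr -1" using elim by (simp add: power2_eq_square flip: powr_add)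
        then have "\<rho>\<^sup>2 = \<gamma>\<^sup>2 * \<omega> powr -1" unfolding \<rho>_def power_mult_distrib by simp
        then show ?thesis using elim by (simp add: powr_minus_divide)
      qed
      moreover have "K * \<rho>\<^sup>2 * real N * \<omega> = K * real N * (\<rho>\<^sup>2 * \<omega>)" by simp
      ultimately have small\<omega>: "K * \<rho>\<^sup>2 * real N * \<omega> < 1" using K\<gamma> by (simp only:)
      \<comment> \<open>The set of cardinalities is non-empty, so its infimum is attained and it
        suffices to treat one minimal lattice.\<close>
      have "(INF S\<in>{S :: 'a set. metric_lattice \<rho> N S}. card S) \<in> card ` {S :: 'a set. metric_lattice \<rho> N S}"
        by (rule Inf_nat_def1) (use elim in \<open>auto simp: \<rho>_def\<close>)
      then obtain S :: "'a set" where S: "metric_lattice \<rho> N S"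
        and card: "(INF S\<in>{S :: 'a set. metric_lattice \<rho> N S}. card S) = card S" by auto
      obtain g where g: "?bound (K * \<rho>\<^sup>2 * real N) (card S) g" using lattice[OF \<rho> S] by blast
      have "card {j. \<phi> j \<noteq> 0 \<and> ev j \<le> \<omega>} \<le> card S"
      proof (rule op.card_eigenvectors_le[where \<psi> = \<phi> and ev = ev and w = \<omega> and e = "K * \<rho>\<^sup>2 * real N" and g = g])
        show "part_inner M f f \<le> K * \<rho>\<^sup>2 * real N * part_inner M h f + (\<Sum>i<card S. (part_inner M f (g i))\<^sup>2)"
          if "(f, h) \<in> part_rel M L" for f h using g that by blast
        fix i j
        assume i: "i \<in> {j. \<phi> j \<noteq> 0 \<and> ev j \<le> \<omega>}"
        then show "(\<phi> i, ev i *\<^sub>R \<phi> i) \<in> part_rel M L \<and> ev i \<le> \<omega> \<and> part_inner M (\<phi> i) (\<phi> i) = 1"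
          using eigenbasis.\<psi>_eigen[OF oe.eb] eigenbasis.\<psi>_unit[OF oe.eb] by simp
        assume "i \<noteq> j"
        then show "part_inner M (\<phi> i) (\<phi> j) = 0" by (rule eigenbasis.\<psi>_orth[OF oe.eb])
      qed (use K small\<omega> oe.finite_ev_le in auto)
      then have "eigenvalue_count M L \<omega> \<le> enat (card S)"
        using oe.eigenvalue_count_le[of \<omega>] by (meson enat_ord_simps(1) order_trans)
      then show ?case using card by (simp add: \<rho>_def)
    qed
    with \<gamma> show ?thesis by blast
  qed
  show ?thesis
    by (rule conjI, intro allI impI, erule pw, rule conjI, rule exI[of _ ev], rule exI[of _ \<phi>], rule eig,
        intro allI impI, erule count)
qed

end
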